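(* Let $(X,x_0)$ be a pointed operator metric space and $n\in\mathbb{N}$. For any $m\in\mathbb{N}$ and $\mu\in\mathrm{M}_m(\mathcal{F}^n(X))$ we have \[\|\mu\|_{\mathrm{M}_m(\mathcal{F}^n(X))}=\inf\Big\{\|\alpha\|\,\|\beta\|\sup_{\ell}|c_\ell|\,\big\|[x^\ell_{ij}-y^\ell_{ij}]\big\|_{\mathrm{M}_n}\Big\},\] where the infimum is taken over all representations of $\mu$ of the form $\mu=\alpha\cdot D\cdot\beta$, where $\alpha\in\mathrm{M}_{m,\infty}$ and $\beta\in\mathrm{M}_{\infty,m}$ are scalar matrices and $D\in\mathrm{M}_\infty(\mathrm{M}_n(\mathrm{span}\{\delta_x\}_{x\in X}))$ is a diagonal matrix whose diagonal entries are of the form $c_\ell[\delta_{x^\ell_{ij}}-\delta_{y^\ell_{ij}}]_{ij}$ with $c_\ell$ a scalar and $[x^\ell_{ij}],[y^\ell_{ij}]\in\mathrm{M}_n(X)$ for each $\ell\in\mathbb{N}$.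
   Context: An operator metric space is a subset $X\subset\mathcal{B}(H)$, $H$ a (complex) Hilbert space; $\mathrm{M}_n(X)$ is the set of $n\times n$ matrices over $X$ and $\|[x_{ij}-y_{ij}]\|_{\mathrm{M}_n}$ denotes the norm of the difference in $\mathcal{B}(H^{\oplus n})$. A pointed operator metric space is a pair $(X,x_0)$ with $x_0\in X$. For a map $f$, its $n$-th amplification is $f_n([x_{ij}])=[f(x_{ij})]$ and $\mathrm{Lip}_n(f)$ is the Lipschitz constant of $f_n$. $\mathrm{Lip}_0(X,\mathbb{C})$ is the space of Lipschitz maps $f:X\to\mathbb{C}$ with $f(x_0)=0$. $\mathrm{Lip}_0^n(X,\mathbb{C})$ denotes this space with norm $\|f\|_{\mathrm{Lip},n}=\mathrm{Lip}_n(f)$ and operator space structure given, for $[f_{ij}]\in \mathrm{M}_k(\mathrm{Lip}_0(X,\mathbb{C}))$, by $\|[f_{ij}]\|_{\mathrm{Lip},n,k}=\mathrm{Lip}_n\big([f_{ij}]:X\to \mathrm{M}_k\big)$, where $[f_{ij}]$ is viewed as the map $x\mapsto[f_{ij}(x)]$. The dual $E^*$ of an operator space $E$ is an operator space via $\mathrm{M}_k(E^* )\cong\mathrm{CB}(E,\mathrm{M}_k)$. For $x\in X$, $\delta_x\in \mathrm{Lip}_0^n(X,\mathbb{C})^*$ is $\delta_x(f)=f(x)$. The $n$-Lipschitz-free operator space is $\mathcal{F}^n(X)=\overline{\mathrm{span}}\{\delta_x: x\in X\}\subset \mathrm{Lip}_0^n(X,\mathbb{C})^*$ with the inherited operator space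 structure. Infinite matrices: for a subspace $E$ of an operator space, $\mathrm{M}_\infty(E)$ is the space of infinite matrices $[x_{ij}]_{i,j=1}^\infty$ over $E$ whose finite truncations are uniformly bounded in norm, normed by the supremum of the norms of the truncations; similarly for $\mathrm{M}_\infty(\mathrm{M}_n(E))$ (infinite matrices of $n\times n$ blocks), $\mathrm{M}_{m,\infty}$ (complex matrices with $m$ rows and countably many columns) and $\mathrm{M}_{\infty,m}$. The product $\alpha\cdot D\cdot\beta$ is defined through truncations: $\mu=\alpha\cdot D\cdot\beta$ means that $\mu$ is the norm limit in $\mathrm{M}_m(\mathcal{F}^n(X))$, as $r\to\infty$, of the products $\alpha^{rn}\cdot D^{rn}\cdot\beta^{rn}$, where $\alpha^{rn}\in\mathrm{M}_{m,rn}$ consists of the first $rn$ columns of $\alpha$, $\beta^{rn}\in\mathrm{M}_{rn,m}$ of the first $rn$ rows of $\beta$, and $D^{rn}$ is the truncation of $D$ to its first $r\times r$ blocks. *)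

theory Defs
  imports "HOL-Analysis.Analysis"
begin

class complex_hilbert_space = banach +
  fixes scaleC :: "complex \<Rightarrow> 'a \<Rightarrow> 'a"
    and cinner :: "'a \<Rightarrow> 'a \<Rightarrow> complex"
  assumes scaleC_of_real: "scaleC (complex_of_real r) x = scaleR r x"
    and scaleC_add_right: "scaleC a (x + y) = scaleC a x + scaleC a y"
    and scaleC_add_left: "scaleC (a + b) x = scaleC a x + scaleC b x"
    and scaleC_scaleC: "scaleC a (scaleC b x) = scaleC (a * b) x"
    and cinner_commute: "cinner x y = cnj (cinner y x)"
    and cinner_add_left: "cinner (x + y) z = cinner x z + cinner y z"
    and cinner_scaleC_left: "cinner (scaleC a x) y = a * cinner x y"
    and cinner_self: "cinner x x = complex_of_real ((norm x)\<^sup>2)"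

definition bounded_clinear :: "('h::complex_hilbert_space \<Rightarrow> 'h) \<Rightarrow> bool" where
  "bounded_clinear T \<longleftrightarrow> bounded_linear T \<and> (\<forall>c h. T (scaleC c h) = scaleC c (T h))"

definition pointed_operator_metric_space ::
    "('h::complex_hilbert_space \<Rightarrow> 'h) set \<Rightarrow> ('h \<Rightarrow> 'h) \<Rightarrow> bool" where
  "pointed_operator_metric_space X x0 \<longleftrightarrow> (\<forall>x\<in>X. bounded_clinear x) \<and> x0 \<in> X"

text \<open>
  Matrices are functions of two indices, counted from 0. A size is given separately, and entries
  outside that size are never looked at; hence the same function also serves as its own truncation
  to any smaller size.
\<close>

definition mats :: "nat \<Rightarrow> 'a set \<Rightarrow> (nat \<Rightarrow> nat \<Rightarrow> 'a) set" where
  "mats n S = {A. \<forall>i<n. \<forall>j<n. A i j \<in> S}"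

text \<open>A matrix of \<open>k \<times> k\<close> blocks, \<open>A p q i j\<close> being entry \<open>(i, j)\<close> of block \<open>(p, q)\<close>, seen as a
  matrix of scalar indices.\<close>

definition flat :: "nat \<Rightarrow> (nat \<Rightarrow> nat \<Rightarrow> nat \<Rightarrow> nat \<Rightarrow> 'a) \<Rightarrow> nat \<Rightarrow> nat \<Rightarrow> 'a" where
  "flat k A s t = A (s div k) (t div k) (s mod k) (t mod k)"

text \<open>The norm of the \<open>k \<times> l\<close> matrix of operators \<open>A\<close> as an operator from the Hilbert sum of
  \<open>l\<close> copies of \<open>H\<close> to that of \<open>k\<close> copies.\<close>

definition opmat_norm ::
    "nat \<Rightarrow> nat \<Rightarrow> (nat \<Rightarrow> nat \<Rightarrow> 'h::real_normed_vector \<Rightarrow> 'h) \<Rightarrow> real" where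
  "opmat_norm k l A =
     Sup {L2_set (\<lambda>i. norm (\<Sum>j<l. A i j (h j))) {..<k} | h. L2_set (\<lambda>j. norm (h j)) {..<l} \<le> 1}"

definition cmat_norm :: "nat \<Rightarrow> nat \<Rightarrow> (nat \<Rightarrow> nat \<Rightarrow> complex) \<Rightarrow> real" where
  "cmat_norm k l A = opmat_norm k l (\<lambda>i j z. A i j * z)"

definition row_mats_inf :: "nat \<Rightarrow> (nat \<Rightarrow> nat \<Rightarrow> complex) set" where
  "row_mats_inf m = {\<alpha>. bdd_above (range (\<lambda>N. cmat_norm m N \<alpha>))}"

definition row_norm_inf :: "nat \<Rightarrow> (nat \<Rightarrow> nat \<Rightarrow> complex) \<Rightarrow> real" where
  "row_norm_inf m \<alpha> = (SUP N. cmat_norm m N \<alpha>)"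

definition col_mats_inf :: "nat \<Rightarrow> (nat \<Rightarrow> nat \<Rightarrow> complex) set" where
  "col_mats_inf m = {\<beta>. bdd_above (range (\<lambda>N. cmat_norm N m \<beta>))}"

definition col_norm_inf :: "nat \<Rightarrow> (nat \<Rightarrow> nat \<Rightarrow> complex) \<Rightarrow> real" where
  "col_norm_inf m \<beta> = (SUP N. cmat_norm N m \<beta>)"

text \<open>Functions on \<open>X\<close> are represented by their extension by 0, so that each has exactly one
  representative.\<close>

definition lip0 ::
    "('h::complex_hilbert_space \<Rightarrow> 'h) set \<Rightarrow> ('h \<Rightarrow> 'h) \<Rightarrow> (('h \<Rightarrow> 'h) \<Rightarrow> complex) set" where
  "lip0 X x0 = {f. f x0 = 0 \<and> (\<forall>x. x \<notin> X \<longrightarrow> f x = 0) \<and>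
     (\<exists>L. \<forall>x\<in>X. \<forall>y\<in>X. norm (f x - f y) \<le> L * onorm (\<lambda>h. x h - y h))}"

text \<open>The Lipschitz constant of the \<open>n\<close>-th amplification of a map from \<open>X\<close> to the complex
  \<open>k \<times> k\<close> matrices.\<close>

definition lip_const :: "nat \<Rightarrow> nat \<Rightarrow> ('h::complex_hilbert_space \<Rightarrow> 'h) set \<Rightarrow>
    (('h \<Rightarrow> 'h) \<Rightarrow> nat \<Rightarrow> nat \<Rightarrow> complex) \<Rightarrow> real" where
  "lip_const n k X F = Inf {L. 0 \<le> L \<and> (\<forall>x\<in>mats n X. \<forall>y\<in>mats n X.
     cmat_norm (n * k) (n * k) (flat k (\<lambda>i j p q. F (x i j) p q - F (y i j) p q))
       \<le> L * opmat_norm n n (\<lambda>i j h. x i j h - y i j h))}"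

definition lip_mnorm :: "nat \<Rightarrow> ('h::complex_hilbert_space \<Rightarrow> 'h) set \<Rightarrow> nat \<Rightarrow>
    (nat \<Rightarrow> nat \<Rightarrow> ('h \<Rightarrow> 'h) \<Rightarrow> complex) \<Rightarrow> real" where
  "lip_mnorm n X k f = lip_const n k X (\<lambda>x p q. f p q x)"

text \<open>Let \<open>E\<close> be a linear space of complex functions whose matrix norms are \<open>N k\<close>. As for
  functions above, a functional on \<open>E\<close> is represented by its extension by 0.\<close>

definition cdual :: "('a \<Rightarrow> complex) set \<Rightarrow> (nat \<Rightarrow> (nat \<Rightarrow> nat \<Rightarrow> 'a \<Rightarrow> complex) \<Rightarrow> real) \<Rightarrow>
    (('a \<Rightarrow> complex) \<Rightarrow> complex) set" where
  "cdual E N = {\<phi>. (\<forall>f\<in>E. \<forall>g\<in>E. \<phi> (\<lambda>x. f x + g x) = \<phi> f + \<phi> g) \<and>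
     (\<forall>c. \<forall>f\<in>E. \<phi> (\<lambda>x. c * f x) = c * \<phi> f) \<and>
     (\<exists>K. \<forall>f\<in>E. norm (\<phi> f) \<le> K * N 1 (\<lambda>_ _. f)) \<and>
     (\<forall>f. f \<notin> E \<longrightarrow> \<phi> f = 0)}"

text \<open>The norm on \<open>m \<times> m\<close> matrices over the dual: the completely bounded norm of the map
  \<open>f \<mapsto> [\<phi> i j f]\<close> from \<open>E\<close> to the complex \<open>m \<times> m\<close> matrices.\<close>

definition dual_mnorm :: "('a \<Rightarrow> complex) set \<Rightarrow> (nat \<Rightarrow> (nat \<Rightarrow> nat \<Rightarrow> 'a \<Rightarrow> complex) \<Rightarrow> real) \<Rightarrow>
    nat \<Rightarrow> (nat \<Rightarrow> nat \<Rightarrow> ('a \<Rightarrow> complex) \<Rightarrow> complex) \<Rightarrow> real" where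
  "dual_mnorm E N m \<phi> =
     Sup {cmat_norm (k * m) (k * m) (flat m (\<lambda>p q i j. \<phi> i j (f p q))) | k f.
       1 \<le> k \<and> f \<in> mats k E \<and> N k f \<le> 1}"

definition delta :: "('h::complex_hilbert_space \<Rightarrow> 'h) set \<Rightarrow> ('h \<Rightarrow> 'h) \<Rightarrow> ('h \<Rightarrow> 'h) \<Rightarrow>
    (('h \<Rightarrow> 'h) \<Rightarrow> complex) \<Rightarrow> complex" where
  "delta X x0 x f = (if f \<in> lip0 X x0 then f x else 0)"

definition delta_span :: "('h::complex_hilbert_space \<Rightarrow> 'h) set \<Rightarrow> ('h \<Rightarrow> 'h) \<Rightarrow>
    ((('h \<Rightarrow> 'h) \<Rightarrow> complex) \<Rightarrow> complex) set" where
  "delta_span X x0 = {\<lambda>f. \<Sum>x\<in>S. a x * delta X x0 x f | S a. finite S \<and> S \<subseteq> X}"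

definition free_mnorm :: "nat \<Rightarrow> ('h::complex_hilbert_space \<Rightarrow> 'h) set \<Rightarrow> ('h \<Rightarrow> 'h) \<Rightarrow> nat \<Rightarrow>
    (nat \<Rightarrow> nat \<Rightarrow> (('h \<Rightarrow> 'h) \<Rightarrow> complex) \<Rightarrow> complex) \<Rightarrow> real" where
  "free_mnorm n X x0 = dual_mnorm (lip0 X x0) (lip_mnorm n X)"

definition lip_free :: "nat \<Rightarrow> ('h::complex_hilbert_space \<Rightarrow> 'h) set \<Rightarrow> ('h \<Rightarrow> 'h) \<Rightarrow>
    ((('h \<Rightarrow> 'h) \<Rightarrow> complex) \<Rightarrow> complex) set" where
  "lip_free n X x0 = {\<phi> \<in> cdual (lip0 X x0) (lip_mnorm n X).
     \<forall>\<epsilon>>0. \<exists>\<psi>\<in>delta_span X x0. free_mnorm n X x0 1 (\<lambda>_ _ f. \<phi> f - \<psi> f) < \<epsilon>}"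

definition block_mats_inf :: "nat \<Rightarrow> ('h::complex_hilbert_space \<Rightarrow> 'h) set \<Rightarrow> ('h \<Rightarrow> 'h) \<Rightarrow>
    (nat \<Rightarrow> nat \<Rightarrow> nat \<Rightarrow> nat \<Rightarrow> (('h \<Rightarrow> 'h) \<Rightarrow> complex) \<Rightarrow> complex) set" where
  "block_mats_inf n X x0 = {D. (\<forall>p q. D p q \<in> mats n (delta_span X x0)) \<and>
     bdd_above (range (\<lambda>r. free_mnorm n X x0 (r * n) (flat n D)))}"

text \<open>\<open>D p q\<close> is the \<open>n \<times> n\<close> block in position \<open>(p, q)\<close>; the columns of \<open>\<alpha>\<close> and the rows of
  \<open>\<beta>\<close> carry scalar indices, so truncating to \<open>r \<times> r\<close> blocks keeps the first \<open>r * n\<close> of them.\<close>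

definition trunc_prod :: "nat \<Rightarrow> nat \<Rightarrow> (nat \<Rightarrow> nat \<Rightarrow> complex) \<Rightarrow>
    (nat \<Rightarrow> nat \<Rightarrow> nat \<Rightarrow> nat \<Rightarrow> 'e \<Rightarrow> complex) \<Rightarrow> (nat \<Rightarrow> nat \<Rightarrow> complex) \<Rightarrow>
    nat \<Rightarrow> nat \<Rightarrow> 'e \<Rightarrow> complex" where
  "trunc_prod n r \<alpha> D \<beta> i j f = (\<Sum>s<r * n. \<Sum>t<r * n. \<alpha> i s * flat n D s t f * \<beta> t j)"

definition is_product :: "nat \<Rightarrow> ('h::complex_hilbert_space \<Rightarrow> 'h) set \<Rightarrow> ('h \<Rightarrow> 'h) \<Rightarrow> nat \<Rightarrow>
    (nat \<Rightarrow> nat \<Rightarrow> (('h \<Rightarrow> 'h) \<Rightarrow> complex) \<Rightarrow> complex) \<Rightarrow> (nat \<Rightarrow> nat \<Rightarrow> complex) \<Rightarrow>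
    (nat \<Rightarrow> nat \<Rightarrow> nat \<Rightarrow> nat \<Rightarrow> (('h \<Rightarrow> 'h) \<Rightarrow> complex) \<Rightarrow> complex) \<Rightarrow>
    (nat \<Rightarrow> nat \<Rightarrow> complex) \<Rightarrow> bool" where
  "is_product n X x0 m \<mu> \<alpha> D \<beta> \<longleftrightarrow>
     (\<lambda>r. free_mnorm n X x0 m (\<lambda>i j f. \<mu> i j f - trunc_prod n r \<alpha> D \<beta> i j f)) \<longlonglongrightarrow> 0"

definition is_delta_diagonal :: "nat \<Rightarrow> ('h::complex_hilbert_space \<Rightarrow> 'h) set \<Rightarrow> ('h \<Rightarrow> 'h) \<Rightarrow>
    (nat \<Rightarrow> nat \<Rightarrow> nat \<Rightarrow> nat \<Rightarrow> (('h \<Rightarrow> 'h) \<Rightarrow> complex) \<Rightarrow> complex) \<Rightarrow> (nat \<Rightarrow> complex) \<Rightarrow>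
    (nat \<Rightarrow> nat \<Rightarrow> nat \<Rightarrow> 'h \<Rightarrow> 'h) \<Rightarrow> (nat \<Rightarrow> nat \<Rightarrow> nat \<Rightarrow> 'h \<Rightarrow> 'h) \<Rightarrow> bool" where
  "is_delta_diagonal n X x0 D c x y \<longleftrightarrow>
     (\<forall>l. x l \<in> mats n X \<and> y l \<in> mats n X) \<and>
     (\<forall>p q. \<forall>i<n. \<forall>j<n. D p q i j =
        (if p = q then (\<lambda>f. c p * (delta X x0 (x p i j) f - delta X x0 (y p i j) f)) else (\<lambda>f. 0)))"

end

theory Submission
  imports Defs "HOL-Library.Function_Algebras"
begin

text \<open>A representation of \<open>\<mu>\<close> bounds its norm by the Cauchy-Schwarz inequality: for a matrix \<open>f\<close> of functions in the
unit ball, \<open>(\<alpha> D \<beta>)(f)\<close> is \<open>\<alpha>\<close> times the diagonal matrix with blocks \<open>c l * (f (x l) - f (y l))\<close> times \<open>\<beta>\<close>, and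
such a block has norm at most \<open>\<bar>c l\<bar> * \<parallel>x l - y l\<parallel>\<close> (\<open>product_bound\<close>, \<open>free_mnorm_le_cost\<close>).

The converse asks for representations of cost close to the norm. Suppose that the entries of \<open>\<nu>\<close> are in the span
of the deltas. Absorbing square roots of \<open>\<parallel>x l - y l\<parallel>\<close> into the scalar matrices, \<open>\<nu>\<close> has a representation of cost
\<open>s\<close> if \<open>\<nu>\<close> is a sum of terms \<open>a (\<delta>(x) - \<delta>(y)) b\<close> such that the sums of \<open>\<parallel>x - y\<parallel> a a\<^sup>*\<close> and of \<open>\<parallel>x - y\<parallel> b\<^sup>* b\<close>
are at most \<open>s\<close> times the identity. The triples \<open>(A, B, \<nu>)\<close> in which \<open>A\<close> and \<open>B\<close> dominate these two sums
form a convex cone (\<open>rep_cone\<close>): this is what the formulation with two scalar matrices and a diagonal in between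
achieves, since adding triples just concatenates the sums. If \<open>(s 1, s 1, \<nu>)\<close> is not in the cone, the Hahn-Banach theorem
(\<open>cone_separation\<close>) gives positive forms \<open>P\<close>, \<open>Q\<close> and a matrix \<open>g\<close> of functions on \<open>X\<close> such that
the real part of the pairing of \<open>g\<close> with \<open>a (\<delta>(x) - \<delta>(y)) b\<close> is at most \<open>\<parallel>x - y\<parallel> (P(a) + Q(b))\<close>, while
its pairing with \<open>\<nu>\<close> is at least \<open>s\<close> times the sum of the traces of \<open>P\<close> and \<open>Q\<close> (\<open>separating_data\<close>). Make \<open>P\<close>
and \<open>Q\<close> positive definite by a small perturbation. In coordinates in which both forms are the standard one,
\<open>g\<close> becomes a matrix-valued map with Lipschitz constant at most 2, which shows that the norm of \<open>\<nu>\<close> is at least \<open>s\<close>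
up to the perturbation (\<open>Lip_matrix_of_functional\<close>, \<open>rep_cone_contains\<close>). This is the argument that proves
Ruan's theorem, with the Hahn-Banach step carried out on the cone of representations.

A general \<open>\<mu>\<close> is the sum of a series of such matrices, the first of norm close to that of \<open>\<mu>\<close> and the others of
rapidly decreasing norm. Their finite representations, enumerated in any order, form one infinite representation
of \<open>\<mu>\<close>, because every tail of the series has a representation of small cost (\<open>series_representation\<close>).\<close>

section \<open>Separation of a point from a convex cone\<close>

instantiation "fun" :: (type, real_vector) real_vector
begin
definition scaleR_fun_def: "r *\<^sub>R f = (\<lambda>x. r *\<^sub>R f x)"
instance
  by standard (simp_all add: scaleR_fun_def fun_eq_iff scaleR_add_right scaleR_add_left)
end

lemma scaleR_fun_apply [simp]: "(r *\<^sub>R f) x = r *\<^sub>R f x"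
  by (simp add: scaleR_fun_def)

lemma sum_fun_apply: "(\<Sum>i\<in>I. f i) x = (\<Sum>i\<in>I. f i x)"
  by (induction I rule: infinite_finite_induct) auto

lemma convex_cone_add_ray:
  assumes "convex_cone K"
  shows "convex_cone {k + t *\<^sub>R v | k t. k \<in> K \<and> 0 \<le> t}" (is "convex_cone ?L")
  unfolding convex_cone_iff
proof (intro conjI ballI allI impI)
  show "0 \<in> ?L" using assms unfolding convex_cone_iff by (auto intro!: exI[of _ 0])
next
  fix u w assume "u \<in> ?L" "w \<in> ?L"
  then obtain k t k' t' where "u = k + t *\<^sub>R v" "w = k' + t' *\<^sub>R v" "k \<in> K" "k' \<in> K" "0 \<le> t" "0 \<le> t'"
    by blast
  moreover from this have "u + w = (k + k') + (t + t') *\<^sub>R v" by (simp add: scaleR_add_left)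
  ultimately show "u + w \<in> ?L" using assms unfolding convex_cone_iff
    by (metis (mono_tags, lifting) add_nonneg_nonneg mem_Collect_eq)
next
  fix s :: real and u assume s: "0 \<le> s" and "u \<in> ?L"
  then obtain k t where "u = k + t *\<^sub>R v" "k \<in> K" "0 \<le> t" by blast
  moreover from this have "s *\<^sub>R u = s *\<^sub>R k + (s * t) *\<^sub>R v" by (simp add: scaleR_add_right)
  ultimately show "s *\<^sub>R u \<in> ?L" using assms s unfolding convex_cone_iff
    by (metis (mono_tags, lifting) mult_nonneg_nonneg mem_Collect_eq)
qed

text \<open>Zorn's lemma. If neither \<open>v\<close> nor \<open>- v\<close> could be adjoined to a maximal cone, then
\<open>- e = k + t v = k' - t' v\<close> for some \<open>k\<close>, \<open>k'\<close> in it and \<open>t\<close>, \<open>t' > 0\<close>; eliminating \<open>v\<close> puts \<open>- e\<close> into the cone.\<close>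

lemma maximal_cone:
  fixes V K :: "'v::real_vector set"
  assumes V: "subspace V" and KV: "K \<subseteq> V" and K: "convex_cone K" and eV: "e \<in> V" and eK: "- e \<notin> K"
  obtains M where "convex_cone M" "K \<subseteq> M" "M \<subseteq> V" "- e \<notin> M" "\<And>v. v \<in> V \<Longrightarrow> v \<in> M \<or> - v \<in> M"
proof -
  let ?Z = "{C. K \<subseteq> C \<and> C \<subseteq> V \<and> convex_cone C \<and> - e \<notin> C}"
  have "\<exists>M\<in>?Z. \<forall>X\<in>?Z. M \<subseteq> X \<longrightarrow> X = M"
  proof (rule subset_Zorn_nonempty)
    show "?Z \<noteq> {}" using KV K eK by blast
  next
    fix \<C> assume ne: "\<C> \<noteq> {}" and ch: "subset.chain ?Z \<C>"
    then have in_Z: "\<And>C. C \<in> \<C> \<Longrightarrow> K \<subseteq> C \<and> C \<subseteq> V \<and> convex_cone C \<and> - e \<notin> C"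
      unfolding subset.chain_def by blast
    have tot: "\<And>C D. C \<in> \<C> \<Longrightarrow> D \<in> \<C> \<Longrightarrow> C \<subseteq> D \<or> D \<subseteq> C"
      using ch unfolding subset.chain_def by blast
    have "convex_cone (\<Union>\<C>)"
      unfolding convex_cone_iff
    proof (intro conjI ballI allI impI)
      show "0 \<in> \<Union>\<C>" using ne in_Z unfolding convex_cone_iff by blast
    next
      fix u v assume "u \<in> \<Union>\<C>" "v \<in> \<Union>\<C>"
      then obtain C D where "C \<in> \<C>" "u \<in> C" "D \<in> \<C>" "v \<in> D" by blast
      then obtain E where "E \<in> \<C>" "u \<in> E" "v \<in> E" using tot[of C D] by blast
      then show "u + v \<in> \<Union>\<C>" using in_Z[of E] unfolding convex_cone_iff by blast
    next
      fix t :: real and u assume "0 \<le> t" "u \<in> \<Union>\<C>"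
      then show "t *\<^sub>R u \<in> \<Union>\<C>" using in_Z unfolding convex_cone_iff by blast
    qed
    then show "\<Union>\<C> \<in> ?Z" using ne in_Z by blast
  qed
  then obtain M where "M \<in> ?Z" and mx: "\<And>X. X \<in> ?Z \<Longrightarrow> M \<subseteq> X \<Longrightarrow> X = M"
    by (elim bexE) simp
  then have M: "K \<subseteq> M" "M \<subseteq> V" "convex_cone M" "- e \<notin> M" by simp_all
  have M0: "0 \<in> M" and Madd: "\<And>u v. u \<in> M \<Longrightarrow> v \<in> M \<Longrightarrow> u + v \<in> M"
    and Msc: "\<And>t u. 0 \<le> t \<Longrightarrow> u \<in> M \<Longrightarrow> t *\<^sub>R u \<in> M"
    using M(3) unfolding convex_cone_iff by auto
  have ext: "\<exists>k t. k \<in> M \<and> 0 < t \<and> - e = k + t *\<^sub>R v" if v: "v \<in> V" "v \<notin> M" for v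
  proof -
    let ?L = "{k + t *\<^sub>R v | k t. k \<in> M \<and> 0 \<le> t}"
    have sub: "M \<subseteq> ?L"
      using add.right_neutral scaleR_zero_left by (metis (mono_tags, lifting) mem_Collect_eq order_refl subsetI)
    have vL: "v \<in> ?L" using M0 by (auto intro!: exI[of _ 0] exI[of _ 1])
    have LV: "?L \<subseteq> V" using M(2) v V by (auto simp: subspace_add subspace_scale)
    have "- e \<in> ?L"
    proof (rule ccontr)
      assume "- e \<notin> ?L"
      then have "?L \<in> ?Z"
        using M(1) sub LV convex_cone_add_ray[OF M(3)] by (intro CollectI conjI) (auto dest: subsetD)
      then have "?L = M" using mx sub by simp
      then show False using vL v by blast
    qed
    then obtain k t where kt: "k \<in> M" "0 \<le> t" "- e = k + t *\<^sub>R v" by blast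
    then have "t \<noteq> 0" using M(4) by (metis add.right_neutral scaleR_zero_left)
    then show ?thesis using kt by (metis less_eq_real_def)
  qed
  have "v \<in> M \<or> - v \<in> M" if v: "v \<in> V" for v
  proof (rule ccontr)
    assume "\<not> ?thesis"
    then obtain k t k' t' where k: "k \<in> M" "0 < t" "- e = k + t *\<^sub>R v"
      and k': "k' \<in> M" "0 < t'" "- e = k' + t' *\<^sub>R (- v)"
      using ext[of v] ext[of "- v"] v V by (metis subspace_neg)
    have "t' *\<^sub>R (- e) + t *\<^sub>R (- e) = t' *\<^sub>R (k + t *\<^sub>R v) + t *\<^sub>R (k' + t' *\<^sub>R (- v))"
      using k(3) k'(3) by simp
    also have "\<dots> = t' *\<^sub>R k + t *\<^sub>R k'" by (simp add: algebra_simps)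
    finally have "(t' + t) *\<^sub>R (- e) = t' *\<^sub>R k + t *\<^sub>R k'" by (simp only: scaleR_add_left)
    moreover have "t' *\<^sub>R k + t *\<^sub>R k' \<in> M" using k k' Madd Msc by simp
    ultimately have "(1 / (t' + t)) *\<^sub>R ((t' + t) *\<^sub>R (- e)) \<in> M" using k k' Msc by simp
    then show False using M(4) k k' by simp
  qed
  then show thesis using that M by blast
qed

text \<open>A Hahn-Banach theorem in which the order unit \<open>e\<close> takes the place of a topology. The element \<open>- w\<close> can be
adjoined to \<open>K\<close> without admitting \<open>- e\<close>. In a maximal such cone \<open>M\<close> each \<open>v - t e\<close> or its negative is
present, so \<open>M\<close> determines \<open>F v\<close> as the value of \<open>t\<close> at which \<open>v - t e\<close> leaves \<open>M\<close>.\<close>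

lemma cone_separation:
  fixes V K :: "'v::real_vector set"
  assumes V: "subspace V" and KV: "K \<subseteq> V" and K: "convex_cone K"
    and e: "e \<in> K" and w: "w \<in> V"
    and ord_unit: "\<And>v. v \<in> V \<Longrightarrow> \<exists>t. v + t *\<^sub>R e \<in> K"
    and neK: "- e \<notin> K" and wK: "w \<notin> K"
  obtains F where "\<And>u v. u \<in> V \<Longrightarrow> v \<in> V \<Longrightarrow> F (u + v) = F u + F v"
    and "\<And>t v. v \<in> V \<Longrightarrow> F (t *\<^sub>R v) = t * F v"
    and "\<And>v. v \<in> K \<Longrightarrow> 0 \<le> F v" and "F e = (1::real)" and "F w \<le> 0"
proof -
  let ?K = "{k + t *\<^sub>R (- w) | k t. k \<in> K \<and> 0 \<le> t}"
  have eV: "e \<in> V" using e KV by blast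
  have neg: "- e \<notin> ?K"
  proof
    assume "- e \<in> ?K"
    then obtain k t where kt: "k \<in> K" "0 \<le> t" "- e = k - t *\<^sub>R w" by auto
    have "t \<noteq> 0" using kt neK by auto
    have "t *\<^sub>R w = k + e" using kt(3) by (simp add: algebra_simps add_eq_0_iff)
    then have "(1 / t) *\<^sub>R (t *\<^sub>R w) \<in> K" using kt K e unfolding convex_cone_iff by simp
    then show False using wK \<open>t \<noteq> 0\<close> by simp
  qed
  have KV': "?K \<subseteq> V" using KV w V by (auto simp: subspace_diff subspace_scale)
  obtain M where M: "convex_cone M" "?K \<subseteq> M" "M \<subseteq> V" "- e \<notin> M"
    and tot: "\<And>v. v \<in> V \<Longrightarrow> v \<in> M \<or> - v \<in> M"
    using maximal_cone[OF V KV' convex_cone_add_ray[OF K] eV neg] by blast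
  have KM: "K \<subseteq> M" using M(2) by (force intro: exI[of _ 0])
  have Madd: "\<And>u v. u \<in> M \<Longrightarrow> v \<in> M \<Longrightarrow> u + v \<in> M"
    and Msc: "\<And>t u. 0 \<le> t \<Longrightarrow> u \<in> M \<Longrightarrow> t *\<^sub>R u \<in> M"
    using M(1) unfolding convex_cone_iff by auto
  have ecoef: "0 \<le> t" if "t *\<^sub>R e \<in> M" for t
  proof (rule ccontr)
    assume "\<not> 0 \<le> t"
    then have "inverse (- t) *\<^sub>R (t *\<^sub>R e) \<in> M"
      using that \<open>\<not> 0 \<le> t\<close> by (intro Msc[of "inverse (- t)" "t *\<^sub>R e"]) auto
    moreover have "inverse (- t) *\<^sub>R (t *\<^sub>R e) = - e" using \<open>\<not> 0 \<le> t\<close> by simp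
    ultimately show False using M(4) by simp
  qed
  have lower: "v - t *\<^sub>R e \<in> M" if "v - s *\<^sub>R e \<in> M" "t \<le> s" for v s t
  proof -
    have "v - t *\<^sub>R e = (v - s *\<^sub>R e) + (s - t) *\<^sub>R e" by (simp add: algebra_simps)
    moreover have "(s - t) *\<^sub>R e \<in> M" using that(2) e KM by (intro Msc) auto
    ultimately show ?thesis using Madd[OF that(1)] by metis
  qed
  define F where "F v = Sup {t. v - t *\<^sub>R e \<in> M}" for v
  have bdd: "t \<le> s" if "v - t *\<^sub>R e \<in> M" "s *\<^sub>R e - v \<in> M" for v t s
  proof -
    have "(v - t *\<^sub>R e) + (s *\<^sub>R e - v) = (s - t) *\<^sub>R e" by (simp add: algebra_simps)
    then show ?thesis using ecoef[of "s - t"] Madd[OF that] by simp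
  qed
  have ex_up: "\<exists>s. s *\<^sub>R e - v \<in> M" if "v \<in> V" for v
    using ord_unit[of "- v"] that V KM by (auto simp: subspace_neg algebra_simps)
  have ex_lo: "\<exists>s. v - s *\<^sub>R e \<in> M" if v: "v \<in> V" for v
  proof -
    obtain t where "v + t *\<^sub>R e \<in> M" using ord_unit[OF v] KM by blast
    then have "v - (- t) *\<^sub>R e \<in> M" by simp
    then show ?thesis by blast
  qed
  have bddA: "bdd_above {t. v - t *\<^sub>R e \<in> M}" if v: "v \<in> V" for v
  proof -
    obtain s where "s *\<^sub>R e - v \<in> M" using ex_up[OF v] by blast
    then show ?thesis using bdd[of v _ s] by (intro bdd_aboveI[of _ s]) blast
  qed
  have F_ge: "t \<le> F v" if "v \<in> V" "v - t *\<^sub>R e \<in> M" for v t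
    unfolding F_def by (rule cSup_upper) (use bddA that in auto)
  have F_le: "F v \<le> s" if "v \<in> V" "s *\<^sub>R e - v \<in> M" for v s
    unfolding F_def
  proof (rule cSup_least)
    show "{t. v - t *\<^sub>R e \<in> M} \<noteq> {}" using ex_lo[OF that(1)] by blast
    show "t \<le> s" if "t \<in> {t. v - t *\<^sub>R e \<in> M}" for t
      using bdd[of v t s] that \<open>s *\<^sub>R e - v \<in> M\<close> by blast
  qed
  have below: "v - t *\<^sub>R e \<in> M" if v: "v \<in> V" "t < F v" for v t
  proof -
    obtain s where "v - s *\<^sub>R e \<in> M" "t < s"
      using less_cSupE[of t "{t. v - t *\<^sub>R e \<in> M}"] v ex_lo[of v] unfolding F_def by auto
    then show ?thesis using lower[of v s t] by simp
  qed
  have above: "t *\<^sub>R e - v \<in> M" if v: "v \<in> V" "F v < t" for v t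
  proof -
    have "v - t *\<^sub>R e \<notin> M" using F_ge[of v t] v by auto
    then have "- (v - t *\<^sub>R e) \<in> M" using tot[of "v - t *\<^sub>R e"] v V eV
      by (auto simp: subspace_diff subspace_scale)
    then show ?thesis by (simp add: algebra_simps)
  qed
  have Fadd: "F (u + v) = F u + F v" if u: "u \<in> V" and v: "v \<in> V" for u v
  proof (rule antisym)
    have uv: "u + v \<in> V" using u v V by (simp add: subspace_add)
    show "F (u + v) \<le> F u + F v"
    proof (rule field_le_epsilon)
      fix d :: real assume d: "0 < d"
      have "(F u + d / 2) *\<^sub>R e - u \<in> M" "(F v + d / 2) *\<^sub>R e - v \<in> M"
        using above[OF u] above[OF v] d by auto
      from Madd[OF this]
      have "((F u + d / 2) + (F v + d / 2)) *\<^sub>R e - (u + v) \<in> M"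
        by (simp only: scaleR_add_left) (simp add: algebra_simps)
      from F_le[OF uv this] show "F (u + v) \<le> F u + F v + d" by simp
    qed
    show "F u + F v \<le> F (u + v)"
    proof (rule field_le_epsilon)
      fix d :: real assume d: "0 < d"
      have "u - (F u - d / 2) *\<^sub>R e \<in> M" "v - (F v - d / 2) *\<^sub>R e \<in> M"
        using below[OF u] below[OF v] d by auto
      from Madd[OF this]
      have "(u + v) - ((F u - d / 2) + (F v - d / 2)) *\<^sub>R e \<in> M"
        by (simp only: scaleR_add_left) (simp add: algebra_simps)
      from F_ge[OF uv this] show "F u + F v \<le> F (u + v) + d" by simp
    qed
  qed
  have F0: "F 0 = 0" using Fadd[of 0 0] V by (simp add: subspace_0)
  have Fneg: "F (- v) = - F v" if "v \<in> V" for v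
    using Fadd[of v "- v"] that V F0 by (simp add: subspace_neg)
  have Fsc_ge: "t * F v \<le> F (t *\<^sub>R v)" if v: "v \<in> V" and t: "0 < t" for t v
  proof (rule field_le_epsilon)
    fix d :: real assume d: "0 < d"
    have "v - (F v - d / t) *\<^sub>R e \<in> M" using below[OF v] d t by simp
    then have "t *\<^sub>R (v - (F v - d / t) *\<^sub>R e) \<in> M" using Msc t by simp
    moreover have "t *\<^sub>R (v - (F v - d / t) *\<^sub>R e) = t *\<^sub>R v - (t * F v - d) *\<^sub>R e"
      using t by (simp add: scaleR_diff_right right_diff_distrib)
    ultimately show "t * F v \<le> F (t *\<^sub>R v) + d"
      using F_ge[of "t *\<^sub>R v" "t * F v - d"] v V by (simp add: subspace_scale)
  qed
  have Fsc_pos: "F (t *\<^sub>R v) = t * F v" if v: "v \<in> V" and t: "0 < t" for t v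
    using Fsc_ge[OF v t] Fsc_ge[of "t *\<^sub>R v" "1 / t"] v t V
    by (simp add: subspace_scale field_simps)
  have Fsc: "F (t *\<^sub>R v) = t * F v" if v: "v \<in> V" for t v
  proof (cases "t = 0")
    case True then show ?thesis using F0 by simp
  next
    case False
    show ?thesis
    proof (cases "0 < t")
      case True then show ?thesis using Fsc_pos v by blast
    next
      case neg: False
      have "F (- ((- t) *\<^sub>R v)) = - F ((- t) *\<^sub>R v)"
        by (rule Fneg) (rule subspace_scale[OF V v])
      then show ?thesis using Fsc_pos[OF v, of "- t"] neg False by simp
    qed
  qed
  have Fe: "F e = 1"
  proof (rule antisym)
    have z: "0 \<in> M" using KM K unfolding convex_cone_iff by blast
    show "F e \<le> 1" using F_le[OF eV, of 1] z by simp
    show "1 \<le> F e" using F_ge[OF eV, of 1] z by simp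
  qed
  have pos: "0 \<le> F v" if "v \<in> M" for v using F_ge[of v 0] that M(3) by auto
  have "- w \<in> M"
  proof -
    have "0 + 1 *\<^sub>R (- w) \<in> ?K" using K unfolding convex_cone_iff by (metis (mono_tags, lifting) mem_Collect_eq zero_le_one)
    then show ?thesis using M(2) by auto
  qed
  then have "F w \<le> 0" using pos[of "- w"] Fneg[OF w] by simp
  then show thesis using that[of F] Fadd Fsc pos KM Fe by blast
qed

section \<open>Factorisation of positive definite forms\<close>

type_synonym 'a matrix = "nat \<Rightarrow> nat \<Rightarrow> 'a"

abbreviation sqnorm :: "nat \<Rightarrow> (nat \<Rightarrow> complex) \<Rightarrow> real" where
  "sqnorm m v \<equiv> \<Sum>i<m. (norm (v i))\<^sup>2"

text \<open>Coordinates in which \<open>P\<close> becomes the standard form: \<open>S\<close> maps the new coordinates to the old ones and \<open>R\<close>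
is its inverse. They are found by completing the square in the last variable, which leaves a form of one
variable less.\<close>

lemma hermitian_cholesky:
  fixes P :: "complex matrix"
  assumes "\<And>i j. P i j = cnj (P j i)"
    and "\<And>a. (\<exists>i<m. a i \<noteq> 0) \<Longrightarrow> 0 < Re (\<Sum>i<m. \<Sum>j<m. P i j * (a i * cnj (a j)))"
  shows "\<exists>S R. (\<forall>i<m. \<forall>k<m. (\<Sum>l<m. S i l * R l k) = (if i = k then 1 else 0)) \<and>
    (\<forall>c. Re (\<Sum>i<m. \<Sum>j<m. P i j * ((\<Sum>k<m. S i k * c k) * cnj (\<Sum>k<m. S j k * c k)))
       = sqnorm m c)"
  using assms
proof (induction m arbitrary: P)
  case 0
  show ?case by simp
next
  case (Suc m)
  define p where "p = Re (P m m)"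
  have Pmm: "P m m = complex_of_real p"
    using arg_cong[OF Suc.prems(1)[of m m], of Im] by (simp add: p_def complex_eq_iff)
  have p: "0 < p"
  proof -
    let ?a = "\<lambda>i. if i = m then 1 else 0 :: complex"
    have "(\<Sum>i<Suc m. \<Sum>j<Suc m. P i j * (?a i * cnj (?a j))) = P m m"
      by (simp add: lessThan_Suc)
    then show ?thesis using Suc.prems(2)[of ?a] by (auto simp: p_def)
  qed
  \<comment> \<open>the Schur complement of the last diagonal entry\<close>
  define Q where "Q i j = P i j - P i m * P m j / p" for i j
  define w where "w a = (\<Sum>i<m. P i m * a i)" for a :: "nat \<Rightarrow> complex"
  have square: "Re (\<Sum>i<Suc m. \<Sum>j<Suc m. P i j * (a i * cnj (a j)))
      = Re (\<Sum>i<m. \<Sum>j<m. Q i j * (a i * cnj (a j))) + p * (norm (a m + w a / p))\<^sup>2" for a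
  proof -
    have cw: "(\<Sum>j<m. P m j * cnj (a j)) = cnj (w a)"
      unfolding w_def cnj_sum by (intro sum.cong) (simp_all add: Suc.prems(1)[of m, symmetric])
    have 1: "(\<Sum>i<Suc m. \<Sum>j<Suc m. P i j * (a i * cnj (a j)))
      = (\<Sum>i<m. \<Sum>j<m. P i j * (a i * cnj (a j))) + w a * cnj (a m) + a m * cnj (w a) + p * (a m * cnj (a m))"
    proof -
      have row: "(\<Sum>j<m. P m j * (a m * cnj (a j))) = a m * cnj (w a)"
        unfolding cw[symmetric] by (simp add: sum_distrib_left mult_ac)
      have col: "(\<Sum>i<m. P i m * (a i * cnj (a m))) = w a * cnj (a m)"
        unfolding w_def sum_distrib_right by (simp add: mult_ac)
      show ?thesis using row col by (simp add: sum.distrib Pmm)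
    qed
    have 2: "(\<Sum>i<m. \<Sum>j<m. Q i j * (a i * cnj (a j)))
      = (\<Sum>i<m. \<Sum>j<m. P i j * (a i * cnj (a j))) - w a * cnj (w a) / p"
    proof -
      have "w a * cnj (w a) / p = (\<Sum>i<m. P i m * a i) * (\<Sum>j<m. P m j * cnj (a j)) / p"
        unfolding cw by (simp only: w_def)
      also have "\<dots> = (\<Sum>i<m. \<Sum>j<m. P i m * P m j / p * (a i * cnj (a j)))"
        unfolding sum_product sum_divide_distrib by (intro sum.cong refl) simp
      finally show ?thesis
        unfolding Q_def left_diff_distrib sum_subtractf by simp
    qed
    have 3: "complex_of_real (p * (norm (a m + w a / p))\<^sup>2) = p * ((a m + w a / p) * cnj (a m + w a / p))"
      by (simp only: of_real_mult complex_norm_square)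
    have 4: "\<dots> = w a * cnj (a m) + a m * cnj (w a) + p * (a m * cnj (a m)) + w a * cnj (w a) / p"
      using p by (simp add: field_simps)
    have "(\<Sum>i<Suc m. \<Sum>j<Suc m. P i j * (a i * cnj (a j)))
       = (\<Sum>i<m. \<Sum>j<m. Q i j * (a i * cnj (a j))) + complex_of_real (p * (norm (a m + w a / p))\<^sup>2)"
      unfolding 1 2 3 4 by simp
    then show ?thesis by (simp only: plus_complex.simps Re_complex_of_real)
  qed
  have Qherm: "Q i j = cnj (Q j i)" for i j
    unfolding Q_def by (simp add: Suc.prems(1)[of i j, symmetric] Suc.prems(1)[of m j, symmetric]
        Suc.prems(1)[of i m, symmetric])
  have Qpos: "0 < Re (\<Sum>i<m. \<Sum>j<m. Q i j * (a i * cnj (a j)))" if a: "\<exists>i<m. a i \<noteq> 0" for a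
  proof -
    \<comment> \<open>the last coordinate is chosen to make the square vanish\<close>
    let ?a = "\<lambda>i. if i = m then - w a / p else a i"
    have wa: "w ?a = w a" by (simp add: w_def)
    have "0 < Re (\<Sum>i<Suc m. \<Sum>j<Suc m. P i j * (?a i * cnj (?a j)))"
      by (rule Suc.prems(2)) (use a in \<open>auto intro: less_SucI\<close>)
    also have "\<dots> = Re (\<Sum>i<m. \<Sum>j<m. Q i j * (a i * cnj (a j)))"
      unfolding square wa by simp
    finally show ?thesis .
  qed
  obtain S R where SR: "\<And>i k. i < m \<Longrightarrow> k < m \<Longrightarrow> (\<Sum>l<m. S i l * R l k) = (if i = k then 1 else 0)"
    and S: "\<And>c. Re (\<Sum>i<m. \<Sum>j<m. Q i j * ((\<Sum>k<m. S i k * c k) * cnj (\<Sum>k<m. S j k * c k)))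
       = sqnorm m c"
    using Suc.IH[of Q, OF Qherm Qpos] by blast
  define S' where "S' i k = (if i < m then (if k < m then S i k else 0)
    else (if k < m then - (\<Sum>l<m. P l m * S l k) / p else 1 / sqrt p))" for i k
  define R' where "R' i k = (if i < m then (if k < m then R i k else 0)
    else (if k < m then P k m / sqrt p else sqrt p))" for i k
  have sp: "complex_of_real (sqrt p) * complex_of_real (sqrt p) = p"
    using p by (metis of_real_mult real_sqrt_mult_self abs_of_pos)
  have "(\<Sum>l<Suc m. S' i l * R' l k) = (if i = k then 1 else 0)" if ik: "i < Suc m" "k < Suc m" for i k
  proof (cases "i < m")
    case True
    then show ?thesis using ik SR by (auto simp: S'_def R'_def less_Suc_eq)
  next
    case False
    then have i: "i = m" using ik by simp
    show ?thesis
    proof (cases "k < m")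
      case True
      have "(\<Sum>l<m. (\<Sum>j<m. P j m * S j l) * R l k) = (\<Sum>j<m. P j m * (\<Sum>l<m. S j l * R l k))"
        by (simp add: sum_distrib_left sum_distrib_right mult.assoc) (rule sum.swap)
      also have "\<dots> = (\<Sum>j<m. if j = k then P k m else 0)" using SR True by (intro sum.cong) auto
      also have "\<dots> = P k m" using True by simp
      finally have "(\<Sum>l<m. (- (\<Sum>j<m. P j m * S j l) / p) * R l k) = - P k m / p"
        by (simp add: sum_negf sum_divide_distrib[symmetric] mult.commute)
      moreover have "1 / complex_of_real (sqrt p) * (P k m / complex_of_real (sqrt p)) = P k m / p"
        using sp by simp
      ultimately show ?thesis using True i by (simp add: S'_def R'_def)
    next
      case False
      then show ?thesis using i ik p by (simp add: S'_def R'_def less_Suc_eq)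
    qed
  qed
  moreover have "Re (\<Sum>i<Suc m. \<Sum>j<Suc m. P i j * ((\<Sum>k<Suc m. S' i k * c k) * cnj (\<Sum>k<Suc m. S' j k * c k)))
       = (\<Sum>k<Suc m. (norm (c k))\<^sup>2)" for c
  proof -
    let ?a = "\<lambda>i. \<Sum>k<Suc m. S' i k * c k"
    let ?b = "\<lambda>i. \<Sum>k<m. S i k * c k"
    have ab: "?a i = ?b i" if "i < m" for i using that by (simp add: S'_def)
    have wb: "w ?a = w ?b" unfolding w_def by (intro sum.cong) (simp_all only: ab lessThan_iff)
    have "?a m = - w ?b / p + c m / sqrt p"
      unfolding w_def S'_def
      by (simp add: sum_distrib_left sum_distrib_right sum_negf sum_divide_distrib mult.assoc)
         (rule sum.swap)
    then have "norm (?a m + w ?a / p) = norm (c m) / sqrt p"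
      unfolding wb using p by (simp add: norm_divide)
    then have "p * (norm (?a m + w ?a / p))\<^sup>2 = (norm (c m))\<^sup>2"
      using p by (simp add: power_divide)
    moreover have "(\<Sum>i<m. \<Sum>j<m. Q i j * (?a i * cnj (?a j))) = (\<Sum>i<m. \<Sum>j<m. Q i j * (?b i * cnj (?b j)))"
      by (intro sum.cong refl) (simp only: ab lessThan_iff)
    ultimately show ?thesis unfolding square using S[of c] by simp
  qed
  ultimately show ?case by blast
qed

text \<open>The real part of the form of \<open>P\<close> is the form of the hermitian part of \<open>P\<close>.\<close>

lemma posdef_cholesky:
  fixes P :: "complex matrix"
  assumes "\<And>a. (\<exists>i<m. a i \<noteq> 0) \<Longrightarrow> 0 < Re (\<Sum>i<m. \<Sum>j<m. P i j * (a i * cnj (a j)))"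
  obtains S R where "\<And>i k. i < m \<Longrightarrow> k < m \<Longrightarrow> (\<Sum>l<m. S i l * R l k) = (if i = k then 1 else 0)"
    and "\<And>c. Re (\<Sum>i<m. \<Sum>j<m. P i j * ((\<Sum>k<m. S i k * c k) * cnj (\<Sum>k<m. S j k * c k)))
       = sqnorm m c"
proof -
  define H where "H i j = (P i j + cnj (P j i)) / 2" for i j
  have same: "Re (\<Sum>i<m. \<Sum>j<m. H i j * (a i * cnj (a j))) = Re (\<Sum>i<m. \<Sum>j<m. P i j * (a i * cnj (a j)))" for a
  proof -
    have "(\<Sum>i<m. \<Sum>j<m. cnj (P j i) * (a i * cnj (a j))) = cnj (\<Sum>i<m. \<Sum>j<m. P i j * (a i * cnj (a j)))"
      unfolding cnj_sum by (subst sum.swap) (simp add: mult_ac)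
    moreover have "(\<Sum>i<m. \<Sum>j<m. H i j * (a i * cnj (a j)))
       = ((\<Sum>i<m. \<Sum>j<m. P i j * (a i * cnj (a j))) + (\<Sum>i<m. \<Sum>j<m. cnj (P j i) * (a i * cnj (a j)))) / 2"
      unfolding H_def by (simp add: sum.distrib sum_divide_distrib add_divide_distrib distrib_right)
    ultimately have "(\<Sum>i<m. \<Sum>j<m. H i j * (a i * cnj (a j)))
       = ((\<Sum>i<m. \<Sum>j<m. P i j * (a i * cnj (a j))) + cnj (\<Sum>i<m. \<Sum>j<m. P i j * (a i * cnj (a j)))) / 2"
      by argo
    moreover have "Re ((z + cnj z) / 2) = Re z" for z by simp
    ultimately show ?thesis by (simp only:)
  qed
  have herm: "H i j = cnj (H j i)" for i j by (simp add: H_def add.commute)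
  have pos: "0 < Re (\<Sum>i<m. \<Sum>j<m. H i j * (a i * cnj (a j)))" if "\<exists>i<m. a i \<noteq> 0" for a
    unfolding same using assms[OF that] .
  obtain S R where "\<forall>i<m. \<forall>k<m. (\<Sum>l<m. S i l * R l k) = (if i = k then 1 else 0)"
    and "\<forall>c. Re (\<Sum>i<m. \<Sum>j<m. H i j * ((\<Sum>k<m. S i k * c k) * cnj (\<Sum>k<m. S j k * c k)))
       = sqnorm m c"
    using hermitian_cholesky[of H m, OF herm pos] by blast
  then show thesis using that[of S R] by (simp only: same)
qed

section \<open>Norms of matrices\<close>

abbreviation vnorm :: "nat \<Rightarrow> (nat \<Rightarrow> 'a::real_normed_vector) \<Rightarrow> real" where
  "vnorm m v \<equiv> L2_set (\<lambda>i. norm (v i)) {..<m}"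

abbreviation block_form :: "nat \<Rightarrow> nat \<Rightarrow> (nat \<Rightarrow> nat \<Rightarrow> nat \<Rightarrow> nat \<Rightarrow> complex) \<Rightarrow>
    complex matrix \<Rightarrow> complex matrix \<Rightarrow> complex" where
  "block_form k m A u v \<equiv> \<Sum>p<k. \<Sum>i<m. \<Sum>q<k. \<Sum>j<m. u p i * A p q i j * v q j"

abbreviation increment :: "(nat \<Rightarrow> nat \<Rightarrow> 'b \<Rightarrow> complex) \<Rightarrow> (nat \<Rightarrow> nat \<Rightarrow> 'b) \<Rightarrow> (nat \<Rightarrow> nat \<Rightarrow> 'b) \<Rightarrow>
    nat \<Rightarrow> nat \<Rightarrow> nat \<Rightarrow> nat \<Rightarrow> complex" where
  "increment f x y i j p q \<equiv> f p q (x i j) - f p q (y i j)"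

text \<open>The squared norm of the row vector \<open>\<xi>\<close> times the matrix whose columns are those of all \<open>a l\<close>, side by side.\<close>

abbreviation frame :: "nat \<Rightarrow> nat \<Rightarrow> 'l set \<Rightarrow> ('l \<Rightarrow> nat \<Rightarrow> nat \<Rightarrow> complex) \<Rightarrow> (nat \<Rightarrow> complex) \<Rightarrow> real" where
  "frame n m I a \<xi> \<equiv> \<Sum>l\<in>I. \<Sum>s<n. (norm (\<Sum>i<m. \<xi> i * a l i s))\<^sup>2"

definition hs_norm :: "nat \<Rightarrow> nat \<Rightarrow> complex matrix \<Rightarrow> real" where
  "hs_norm k m v = sqrt (\<Sum>p<k. \<Sum>i<m. (norm (v p i))\<^sup>2)"

lemma hs_norm_nonneg [simp]: "0 \<le> hs_norm k m v"
  by (simp add: hs_norm_def sum_nonneg)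

lemma hs_norm_sq: "(hs_norm k m v)\<^sup>2 = (\<Sum>p<k. \<Sum>i<m. (norm (v p i))\<^sup>2)"
  by (simp add: hs_norm_def sum_nonneg)

lemma vnorm_sq: "(vnorm m v)\<^sup>2 = (\<Sum>i<m. (norm (v i))\<^sup>2)"
  by (simp add: L2_set_def sum_nonneg)

lemma vnorm_scale: "vnorm m (\<lambda>i. c *\<^sub>R v i) = \<bar>c\<bar> * vnorm m v"
  by (simp add: L2_set_right_distrib)

lemma hs_norm_column_le: "i < m \<Longrightarrow> hs_norm k 1 (\<lambda>p _. v p i) \<le> hs_norm k m v"
  unfolding hs_norm_def
  by (intro real_sqrt_le_mono sum_mono) (simp add: member_le_sum[of i "{..<m}" "\<lambda>i. (norm (v _ i))\<^sup>2"])

lemma norm_component_le_vnorm: "i < m \<Longrightarrow> norm (v i) \<le> vnorm m v"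
  by (rule member_le_L2_set) auto

lemma cauchy_schwarz_sum:
  fixes u v :: "'i \<Rightarrow> complex"
  shows "norm (\<Sum>i\<in>I. u i * v i) \<le> L2_set (\<lambda>i. norm (u i)) I * L2_set (\<lambda>i. norm (v i)) I"
proof -
  have "norm (\<Sum>i\<in>I. u i * v i) \<le> (\<Sum>i\<in>I. \<bar>norm (u i)\<bar> * \<bar>norm (v i)\<bar>)"
    by (rule order_trans[OF norm_sum]) (simp add: norm_mult)
  from order_trans[OF this L2_set_mult_ineq] show ?thesis .
qed

lemma opmat_bdd:
  fixes A :: "nat \<Rightarrow> nat \<Rightarrow> 'h::real_normed_vector \<Rightarrow> 'h"
  assumes A: "\<And>i j. i < k \<Longrightarrow> j < l \<Longrightarrow> bounded_linear (A i j)"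
  shows "vnorm k (\<lambda>i. \<Sum>j<l. A i j (h j)) \<le> (\<Sum>i<k. \<Sum>j<l. onorm (A i j)) * vnorm l h"
proof -
  have "vnorm k (\<lambda>i. \<Sum>j<l. A i j (h j)) \<le> (\<Sum>i<k. norm (\<Sum>j<l. A i j (h j)))"
    by (rule L2_set_le_sum) auto
  also have "\<dots> \<le> (\<Sum>i<k. \<Sum>j<l. onorm (A i j) * vnorm l h)"
  proof (rule sum_mono)
    fix i assume i: "i \<in> {..<k}"
    show "norm (\<Sum>j<l. A i j (h j)) \<le> (\<Sum>j<l. onorm (A i j) * vnorm l h)"
    proof (rule sum_norm_le)
      fix j assume j: "j \<in> {..<l}"
      have b: "bounded_linear (A i j)" using A i j by simp
      have "norm (A i j (h j)) \<le> onorm (A i j) * norm (h j)" by (rule onorm[OF b])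
      also have "\<dots> \<le> onorm (A i j) * vnorm l h"
        using j onorm_pos_le[OF b] by (intro mult_left_mono norm_component_le_vnorm) auto
      finally show "norm (A i j (h j)) \<le> onorm (A i j) * vnorm l h" .
    qed
  qed
  finally show ?thesis by (simp add: sum_distrib_right)
qed

text \<open>The norm is a supremum of real numbers, which says something about the matrix only if the set is bounded.\<close>

lemma opmat_norm_bdd_above:
  fixes A :: "nat \<Rightarrow> nat \<Rightarrow> 'h::real_normed_vector \<Rightarrow> 'h"
  assumes A: "\<And>i j. i < k \<Longrightarrow> j < l \<Longrightarrow> bounded_linear (A i j)"
  shows "bdd_above {vnorm k (\<lambda>i. \<Sum>j<l. A i j (h j)) | h. vnorm l h \<le> 1}"
proof (rule bdd_aboveI)
  fix s assume "s \<in> {vnorm k (\<lambda>i. \<Sum>j<l. A i j (h j)) | h. vnorm l h \<le> 1}"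
  then obtain h where h: "s = vnorm k (\<lambda>i. \<Sum>j<l. A i j (h j))" "vnorm l h \<le> 1" by blast
  have S: "0 \<le> (\<Sum>i<k. \<Sum>j<l. onorm (A i j))"
    using A by (intro sum_nonneg onorm_pos_le) auto
  have "s \<le> (\<Sum>i<k. \<Sum>j<l. onorm (A i j)) * vnorm l h" unfolding h by (rule opmat_bdd[OF A])
  also have "\<dots> \<le> (\<Sum>i<k. \<Sum>j<l. onorm (A i j)) * 1" using S h by (intro mult_left_mono) auto
  finally show "s \<le> (\<Sum>i<k. \<Sum>j<l. onorm (A i j))" by simp
qed

lemma opmat_norm_nonneg:
  fixes A :: "nat \<Rightarrow> nat \<Rightarrow> 'h::real_normed_vector \<Rightarrow> 'h"
  assumes A: "\<And>i j. i < k \<Longrightarrow> j < l \<Longrightarrow> bounded_linear (A i j)"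
  shows "0 \<le> opmat_norm k l A"
proof -
  have "vnorm l (\<lambda>_. 0 :: 'h) \<le> 1" by (simp add: L2_set_def)
  then have "vnorm k (\<lambda>i. \<Sum>j<l. A i j 0) \<le> opmat_norm k l A"
    unfolding opmat_norm_def by (intro cSup_upper opmat_norm_bdd_above[OF A] CollectI exI[of _ "\<lambda>_. 0"]) auto
  from order_trans[OF L2_set_nonneg this] show ?thesis .
qed

lemma opmat_norm_bound:
  fixes A :: "nat \<Rightarrow> nat \<Rightarrow> 'h::real_normed_vector \<Rightarrow> 'h"
  assumes A: "\<And>i j. i < k \<Longrightarrow> j < l \<Longrightarrow> bounded_linear (A i j)"
  shows "vnorm k (\<lambda>i. \<Sum>j<l. A i j (h j)) \<le> opmat_norm k l A * vnorm l h"
proof -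
  show ?thesis
  proof (cases "vnorm l h = 0")
    case True
    have "vnorm k (\<lambda>i. \<Sum>j<l. A i j (h j)) \<le> (\<Sum>i<k. \<Sum>j<l. onorm (A i j)) * vnorm l h"
      by (rule opmat_bdd[OF A])
    then show ?thesis using True by simp
  next
    case False
    then have pos: "0 < vnorm l h" by (metis L2_set_nonneg less_eq_real_def)
    let ?c = "1 / vnorm l h"
    have "vnorm l (\<lambda>j. ?c *\<^sub>R h j) \<le> 1" unfolding vnorm_scale using pos by simp
    then have "vnorm k (\<lambda>i. \<Sum>j<l. A i j (?c *\<^sub>R h j)) \<le> opmat_norm k l A"
      unfolding opmat_norm_def by (intro cSup_upper opmat_norm_bdd_above[OF A]) auto
    moreover have "(\<Sum>j<l. A i j (?c *\<^sub>R h j)) = ?c *\<^sub>R (\<Sum>j<l. A i j (h j))" if "i < k" for i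
      unfolding scaleR_sum_right using that by (intro sum.cong refl linear_scale bounded_linear.linear A) auto
    then have "vnorm k (\<lambda>i. \<Sum>j<l. A i j (?c *\<^sub>R h j)) = vnorm k (\<lambda>i. ?c *\<^sub>R (\<Sum>j<l. A i j (h j)))"
      by (intro L2_set_cong) auto
    ultimately show ?thesis unfolding vnorm_scale using pos by (simp add: field_simps)
  qed
qed

lemma opmat_norm_least:
  assumes "0 \<le> C" and "\<And>h. vnorm k (\<lambda>i. \<Sum>j<l. A i j (h j)) \<le> C * vnorm l h"
  shows "opmat_norm k l A \<le> C"
  unfolding opmat_norm_def
proof (rule cSup_least)
  show "{vnorm k (\<lambda>i. \<Sum>j<l. A i j (h j)) | h. vnorm l h \<le> 1} \<noteq> {}"
    by (auto intro!: exI[of _ "\<lambda>_. 0"] simp: L2_set_def)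
next
  fix s assume "s \<in> {vnorm k (\<lambda>i. \<Sum>j<l. A i j (h j)) | h. vnorm l h \<le> 1}"
  then obtain h where h: "s = vnorm k (\<lambda>i. \<Sum>j<l. A i j (h j))" "vnorm l h \<le> 1" by blast
  then show "s \<le> C" using assms(2)[of h] mult_left_mono[OF h(2) assms(1)] by simp
qed

lemma opmat_norm_le_sum:
  fixes A :: "nat \<Rightarrow> nat \<Rightarrow> 'h::real_normed_vector \<Rightarrow> 'h"
  assumes A: "\<And>i j. i < k \<Longrightarrow> j < l \<Longrightarrow> bounded_linear (A i j)"
  shows "opmat_norm k l A \<le> (\<Sum>i<k. \<Sum>j<l. onorm (A i j))"
  using A by (intro opmat_norm_least opmat_bdd sum_nonneg onorm_pos_le) auto

lemma opmat_norm_entry: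
  fixes A :: "nat \<Rightarrow> nat \<Rightarrow> 'h::real_normed_vector \<Rightarrow> 'h"
  assumes A: "\<And>i j. i < k \<Longrightarrow> j < l \<Longrightarrow> bounded_linear (A i j)" and ij: "i < k" "j < l"
  shows "onorm (A i j) \<le> opmat_norm k l A"
proof (rule onorm_bound[OF opmat_norm_nonneg[OF A]])
  fix h :: 'h
  let ?h = "\<lambda>j'. if j' = j then h else 0"
  have "(\<Sum>j'<l. A i j' (?h j')) = (\<Sum>j'<l. if j' = j then A i j h else 0)"
    using A ij by (intro sum.cong) (auto intro: linear_0 bounded_linear.linear)
  then have "norm (A i j h) = norm (\<Sum>j'<l. A i j' (?h j'))" using ij by simp
  also have "\<dots> \<le> vnorm k (\<lambda>i. \<Sum>j'<l. A i j' (?h j'))"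
    using norm_component_le_vnorm[OF ij(1), of "\<lambda>i. \<Sum>j'<l. A i j' (?h j')"] .
  also have "\<dots> \<le> opmat_norm k l A * vnorm l ?h" by (rule opmat_norm_bound[OF A])
  also have "vnorm l ?h = norm h"
  proof -
    have "(\<Sum>j'<l. (norm (?h j'))\<^sup>2) = (\<Sum>j'<l. if j' = j then (norm h)\<^sup>2 else 0)"
      by (intro sum.cong) auto
    then show ?thesis using ij by (simp add: L2_set_def)
  qed
  finally show "norm (A i j h) \<le> opmat_norm k l A * norm h" .
qed

lemma cmat_norm_nonneg: "0 \<le> cmat_norm k l A"
  unfolding cmat_norm_def by (rule opmat_norm_nonneg) (rule bounded_linear_mult_right)

lemma cmat_norm_bound: "vnorm k (\<lambda>i. \<Sum>j<l. A i j * h j) \<le> cmat_norm k l A * vnorm l h"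
  unfolding cmat_norm_def by (rule opmat_norm_bound) (rule bounded_linear_mult_right)

lemma cmat_norm_bilinear:
  "norm (\<Sum>i<k. \<Sum>j<l. u i * A i j * v j) \<le> cmat_norm k l A * vnorm k u * vnorm l v"
proof -
  have "(\<Sum>i<k. \<Sum>j<l. u i * A i j * v j) = (\<Sum>i<k. u i * (\<Sum>j<l. A i j * v j))"
    by (simp add: sum_distrib_left mult.assoc)
  then have "norm (\<Sum>i<k. \<Sum>j<l. u i * A i j * v j) \<le> vnorm k u * vnorm k (\<lambda>i. \<Sum>j<l. A i j * v j)"
    using cauchy_schwarz_sum by metis
  also have "\<dots> \<le> vnorm k u * (cmat_norm k l A * vnorm l v)"
    by (intro mult_left_mono cmat_norm_bound) auto
  finally show ?thesis by (simp add: mult_ac)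
qed

text \<open>The vectors \<open>u\<close> and \<open>v\<close> are arbitrary, so the bilinear form, which needs no conjugations, determines the norm
just as the sesquilinear one.\<close>

lemma cmat_norm_least:
  assumes C: "0 \<le> C"
    and b: "\<And>u v. norm (\<Sum>i<k. \<Sum>j<l. u i * A i j * v j) \<le> C * vnorm k u * vnorm l v"
  shows "cmat_norm k l A \<le> C"
  unfolding cmat_norm_def
proof (rule opmat_norm_least[OF C])
  fix h :: "nat \<Rightarrow> complex"
  let ?v = "\<lambda>i. \<Sum>j<l. A i j * h j"
  have "(\<Sum>i<k. \<Sum>j<l. cnj (?v i) * A i j * h j) = (\<Sum>i<k. cnj (?v i) * ?v i)"
    unfolding mult.assoc sum_distrib_left[symmetric] ..
  also have "\<dots> = (\<Sum>i<k. complex_of_real ((norm (?v i))\<^sup>2))"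
    by (intro sum.cong refl) (metis complex_norm_square mult.commute)
  also have "\<dots> = complex_of_real ((vnorm k ?v)\<^sup>2)" unfolding vnorm_sq by simp
  finally have eq: "(\<Sum>i<k. \<Sum>j<l. cnj (?v i) * A i j * h j) = complex_of_real ((vnorm k ?v)\<^sup>2)" .
  have "(vnorm k ?v)\<^sup>2 \<le> C * vnorm k (\<lambda>i. cnj (?v i)) * vnorm l h"
    using b[of "\<lambda>i. cnj (?v i)" h] unfolding eq by (simp only: norm_of_real abs_power2 power2_abs abs_of_nonneg zero_le_power2)
  also have "vnorm k (\<lambda>i. cnj (?v i)) = vnorm k ?v" by (simp only: complex_mod_cnj)
  finally have "vnorm k ?v * vnorm k ?v \<le> (C * vnorm l h) * vnorm k ?v"
    by (simp only: power2_eq_square mult_ac)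
  then show "vnorm k ?v \<le> C * vnorm l h"
    using C by (cases "0 < vnorm k ?v") (auto simp: not_less intro: order_trans[of _ 0])
qed

lemma sum_div_mod:
  fixes g :: "nat \<Rightarrow> nat \<Rightarrow> 'a::comm_monoid_add"
  shows "(\<Sum>s<r * n. g (s div n) (s mod n)) = (\<Sum>p<r. \<Sum>i<n. g p i)"
proof (cases "n = 0")
  case False
  have "(\<Sum>s<r * n. g (s div n) (s mod n)) = (\<Sum>p<r. \<Sum>s = p * n..<p * n + n. g (s div n) (s mod n))"
    by (rule sum.nat_group[symmetric])
  also have "\<dots> = (\<Sum>p<r. \<Sum>i<n. g p i)"
  proof (rule sum.cong[OF refl])
    fix p
    have "(\<Sum>s = p * n..<p * n + n. g (s div n) (s mod n))
      = (\<Sum>s = 0 + p * n..<n + p * n. g (s div n) (s mod n))" by (simp add: add.commute)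
    also have "\<dots> = (\<Sum>i = 0..<n. g ((i + p * n) div n) ((i + p * n) mod n))"
      by (rule sum.shift_bounds_nat_ivl)
    also have "\<dots> = (\<Sum>i<n. g p i)" using False by (simp add: atLeast0LessThan)
    finally show "(\<Sum>s = p * n..<p * n + n. g (s div n) (s mod n)) = (\<Sum>i<n. g p i)" .
  qed
  finally show ?thesis .
qed simp

lemma hs_norm_flat: "vnorm (k * m) (\<lambda>s. v (s div m) (s mod m)) = hs_norm k m v"
  unfolding L2_set_def hs_norm_def by (rule arg_cong[of _ _ sqrt]) (rule sum_div_mod)

lemma hs_norm_unflat: "hs_norm k m (\<lambda>p i. v (p * m + i)) = vnorm (k * m) v"
proof -
  have "v s = v (s div m * m + s mod m)" for s by simp
  then show ?thesis
    using hs_norm_flat[where k = k and m = m and v = "\<lambda>p i. v (p * m + i)"] by simp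
qed

lemma flat_form:
  fixes A :: "nat \<Rightarrow> nat \<Rightarrow> nat \<Rightarrow> nat \<Rightarrow> complex"
  shows "(\<Sum>s<k * m. \<Sum>t<k * m. u (s div m) (s mod m) * flat m A s t * v (t div m) (t mod m))
    = block_form k m A u v"
proof -
  have "(\<Sum>t<k * m. u (s div m) (s mod m) * flat m A s t * v (t div m) (t mod m))
      = (\<Sum>q<k. \<Sum>j<m. u (s div m) (s mod m) * A (s div m) q (s mod m) j * v q j)" for s
    unfolding flat_def
    by (rule sum_div_mod[of "\<lambda>q j. u (s div m) (s mod m) * A (s div m) q (s mod m) j * v q j"])
  then show ?thesis
    by (simp only: sum_div_mod[of "\<lambda>p i. \<Sum>q<k. \<Sum>j<m. u p i * A p q i j * v q j"])
qed

lemma flat_norm_bilinear: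
  "norm (block_form k m A u v)
    \<le> cmat_norm (k * m) (k * m) (flat m A) * hs_norm k m u * hs_norm k m v"
  using cmat_norm_bilinear[where u = "\<lambda>s. u (s div m) (s mod m)" and v = "\<lambda>s. v (s div m) (s mod m)"
      and A = "flat m A" and k = "k * m" and l = "k * m"]
  unfolding flat_form hs_norm_flat .

lemma flat_norm_least:
  assumes "0 \<le> C"
    and b: "\<And>u v. norm (block_form k m A u v) \<le> C * hs_norm k m u * hs_norm k m v"
  shows "cmat_norm (k * m) (k * m) (flat m A) \<le> C"
proof (rule cmat_norm_least[OF assms(1)])
  fix u v :: "nat \<Rightarrow> complex"
  have r: "s div m * m + s mod m = s" for s by simp
  show "norm (\<Sum>i<k * m. \<Sum>j<k * m. u i * flat m A i j * v j) \<le> C * vnorm (k * m) u * vnorm (k * m) v"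
    using b[of "\<lambda>p i. u (p * m + i)" "\<lambda>p i. v (p * m + i)"]
    unfolding hs_norm_unflat flat_form[symmetric] r .
qed

section \<open>Norms of matrices of Lipschitz functions and of functionals\<close>

lemma hs_norm_component: "i < n' \<Longrightarrow> p < k \<Longrightarrow> norm (u i p) \<le> hs_norm n' k u"
proof -
  assume ip: "i < n'" "p < k"
  have "(norm (u i p))\<^sup>2 \<le> (\<Sum>p<k. (norm (u i p))\<^sup>2)"
    using ip by (intro member_le_sum) auto
  also have "\<dots> \<le> (\<Sum>i<n'. \<Sum>p<k. (norm (u i p))\<^sup>2)"
    using ip by (intro member_le_sum[of i _ "\<lambda>i. \<Sum>p<k. (norm (u i p))\<^sup>2"]) (auto intro: sum_nonneg)
  finally show ?thesis unfolding hs_norm_def by (rule real_le_rsqrt)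
qed

lemma crude_form_bound:
  fixes A :: "nat \<Rightarrow> nat \<Rightarrow> nat \<Rightarrow> nat \<Rightarrow> complex"
  assumes "\<And>i j p q. i < n' \<Longrightarrow> j < n' \<Longrightarrow> p < k \<Longrightarrow> q < k \<Longrightarrow> norm (A i j p q) \<le> M p q"
  shows "norm (block_form n' k A u v)
    \<le> (\<Sum>i<n'. \<Sum>p<k. \<Sum>j<n'. \<Sum>q<k. M p q) * hs_norm n' k u * hs_norm n' k v"
proof -
  have "norm (block_form n' k A u v)
    \<le> (\<Sum>i<n'. \<Sum>p<k. \<Sum>j<n'. \<Sum>q<k. M p q * hs_norm n' k u * hs_norm n' k v)"
  proof (intro sum_norm_le)
    fix i p j q assume ij: "i \<in> {..<n'}" "p \<in> {..<k}" "j \<in> {..<n'}" "q \<in> {..<k}"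
    have "norm (A i j p q) * norm (u i p) * norm (v j q) \<le> M p q * hs_norm n' k u * hs_norm n' k v"
      using ij assms[of i j p q] order_trans[OF norm_ge_zero assms[of i j p q]]
      by (intro mult_mono hs_norm_component mult_nonneg_nonneg) auto
    then show "norm (u i p * A i j p q * v j q) \<le> M p q * hs_norm n' k u * hs_norm n' k v"
      by (simp only: norm_mult mult_ac)
  qed
  also have "\<dots> = (\<Sum>i<n'. \<Sum>p<k. \<Sum>j<n'. \<Sum>q<k. M p q) * hs_norm n' k u * hs_norm n' k v"
    by (simp only: sum_distrib_right)
  finally show ?thesis .
qed

locale pointed_operators =
  fixes X :: "('h::complex_hilbert_space \<Rightarrow> 'h) set" and x0 :: "'h \<Rightarrow> 'h" and n :: nat
  assumes bounded: "x \<in> X \<Longrightarrow> bounded_linear x" and base: "x0 \<in> X" and size_pos: "1 \<le> n"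
begin

abbreviation opdist :: "('h \<Rightarrow> 'h) \<Rightarrow> ('h \<Rightarrow> 'h) \<Rightarrow> real" where
  "opdist x y \<equiv> onorm (\<lambda>h. x h - y h)"

abbreviation matdist :: "('h \<Rightarrow> 'h) matrix \<Rightarrow> ('h \<Rightarrow> 'h) matrix \<Rightarrow> real" where
  "matdist x y \<equiv> opmat_norm n n (\<lambda>i j h. x i j h - y i j h)"

abbreviation "Lip \<equiv> lip0 X x0"

lemma bounded_diff: "x \<in> X \<Longrightarrow> y \<in> X \<Longrightarrow> bounded_linear (\<lambda>h. x h - y h)"
  by (intro bounded_linear_sub bounded)

lemma opdist_nonneg: "x \<in> X \<Longrightarrow> y \<in> X \<Longrightarrow> 0 \<le> opdist x y"
  by (intro onorm_pos_le bounded_diff)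

lemma bounded_mats_diff:
  "x \<in> mats n X \<Longrightarrow> y \<in> mats n X \<Longrightarrow> i < n \<Longrightarrow> j < n \<Longrightarrow> bounded_linear (\<lambda>h. x i j h - y i j h)"
  by (auto simp: mats_def intro: bounded_diff)

lemma matdist_nonneg: "x \<in> mats n X \<Longrightarrow> y \<in> mats n X \<Longrightarrow> 0 \<le> matdist x y"
  by (rule opmat_norm_nonneg) (rule bounded_mats_diff)

lemma opdist_le_matdist:
  "x \<in> mats n X \<Longrightarrow> y \<in> mats n X \<Longrightarrow> i < n \<Longrightarrow> j < n \<Longrightarrow> opdist (x i j) (y i j) \<le> matdist x y"
  by (rule opmat_norm_entry[where A = "\<lambda>i j h. x i j h - y i j h"]) (rule bounded_mats_diff)

lemma matdist_le_sum:
  "x \<in> mats n X \<Longrightarrow> y \<in> mats n X \<Longrightarrow> matdist x y \<le> (\<Sum>i<n. \<Sum>j<n. opdist (x i j) (y i j))"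
  by (rule opmat_norm_le_sum) (rule bounded_mats_diff)

lemma matdist_eq_0:
  assumes "x \<in> mats n X" "y \<in> mats n X" "matdist x y = 0" "i < n" "j < n"
  shows "x i j = y i j"
proof -
  have "opdist (x i j) (y i j) = 0"
    using opdist_le_matdist[OF assms(1,2,4,5)] onorm_pos_le[OF bounded_mats_diff[OF assms(1,2,4,5)]] assms(3)
    by simp
  then show ?thesis
    using onorm_eq_0[OF bounded_mats_diff[OF assms(1,2,4,5)]] by (auto simp: fun_eq_iff)
qed

text \<open>Places an operator at the corner of a matrix whose other entries are the base point. The difference of
two such matrices has at most one nonzero entry, so that the amplification at matrices of this kind says something about
the points of \<open>X\<close>.\<close>

definition corner :: "('h \<Rightarrow> 'h) \<Rightarrow> nat \<Rightarrow> nat \<Rightarrow> 'h \<Rightarrow> 'h" where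
  "corner x i j = (if i = 0 \<and> j = 0 then x else x0)"

lemma corner_mats: "x \<in> X \<Longrightarrow> corner x \<in> mats n X"
  using base by (auto simp: corner_def mats_def)

lemma matdist_corner:
  assumes "x \<in> X" "y \<in> X"
  shows "matdist (corner x) (corner y) \<le> opdist x y"
proof -
  have z: "opdist (corner x i j) (corner y i j) = (if j = 0 then if i = 0 then opdist x y else 0 else 0)" for i j
    by (simp add: corner_def onorm_zero)
  have "matdist (corner x) (corner y) \<le> (\<Sum>i<n. \<Sum>j<n. opdist (corner x i j) (corner y i j))"
    by (rule matdist_le_sum) (use assms corner_mats in auto)
  also have "\<dots> = opdist x y" unfolding z using size_pos by simp
  finally show ?thesis .
qed

lemma zero_Lip: "(\<lambda>_. 0) \<in> Lip"
  by (auto simp: lip0_def intro!: exI[of _ 0])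

lemma Lip_bound:
  assumes "f \<in> Lip"
  obtains L where "0 \<le> L" "\<And>x y. x \<in> X \<Longrightarrow> y \<in> X \<Longrightarrow> norm (f x - f y) \<le> L * opdist x y"
proof -
  obtain L where L: "\<And>x y. x \<in> X \<Longrightarrow> y \<in> X \<Longrightarrow> norm (f x - f y) \<le> L * opdist x y"
    using assms unfolding lip0_def by blast
  show thesis
  proof (rule that[of "\<bar>L\<bar>"])
    fix x y assume xy: "x \<in> X" "y \<in> X"
    show "norm (f x - f y) \<le> \<bar>L\<bar> * opdist x y"
      using L[OF xy] mult_right_mono[OF abs_ge_self opdist_nonneg[OF xy], of L] by linarith
  qed simp
qed

lemma add_Lip:
  assumes "f \<in> Lip" "g \<in> Lip"
  shows "(\<lambda>x. f x + g x) \<in> Lip"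
proof -
  obtain L M where L: "\<And>x y. x \<in> X \<Longrightarrow> y \<in> X \<Longrightarrow> norm (f x - f y) \<le> L * opdist x y"
    and M: "\<And>x y. x \<in> X \<Longrightarrow> y \<in> X \<Longrightarrow> norm (g x - g y) \<le> M * opdist x y"
    using assms Lip_bound by metis
  have "norm (f x + g x - (f y + g y)) \<le> (L + M) * opdist x y" if "x \<in> X" "y \<in> X" for x y
  proof -
    have eq: "f x + g x - (f y + g y) = (f x - f y) + (g x - g y)" by simp
    have "norm (f x + g x - (f y + g y)) \<le> norm (f x - f y) + norm (g x - g y)"
      unfolding eq by (rule norm_triangle_ineq)
    then show ?thesis using L[OF that] M[OF that] by (simp only: distrib_right)
  qed
  then show ?thesis using assms unfolding lip0_def by auto
qed

lemma scale_Lip: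
  assumes "f \<in> Lip"
  shows "(\<lambda>x. c * f x) \<in> Lip"
proof -
  obtain L where L: "\<And>x y. x \<in> X \<Longrightarrow> y \<in> X \<Longrightarrow> norm (f x - f y) \<le> L * opdist x y"
    using assms Lip_bound by metis
  have "norm (c * f x - c * f y) \<le> (norm c * L) * opdist x y" if "x \<in> X" "y \<in> X" for x y
    using mult_left_mono[OF L[OF that], of "norm c"]
    by (simp add: norm_mult[symmetric] right_diff_distrib mult.assoc)
  then show ?thesis using assms unfolding lip0_def by auto
qed

lemma sum_Lip:
  assumes "\<And>i. i \<in> I \<Longrightarrow> f i \<in> Lip"
  shows "(\<lambda>x. \<Sum>i\<in>I. c i * f i x) \<in> Lip"
  using assms
  by (induction I rule: infinite_finite_induct) (auto intro!: add_Lip scale_Lip zero_Lip)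

lemma lip_mnorm_least:
  assumes "0 \<le> L"
    and "\<And>x y u v. x \<in> mats n X \<Longrightarrow> y \<in> mats n X \<Longrightarrow>
      norm (block_form n k (increment f x y) u v)
        \<le> L * matdist x y * hs_norm n k u * hs_norm n k v"
  shows "lip_mnorm n X k f \<le> L"
  unfolding lip_mnorm_def lip_const_def
proof (rule cInf_lower)
  show "L \<in> {L. 0 \<le> L \<and> (\<forall>x\<in>mats n X. \<forall>y\<in>mats n X.
     cmat_norm (n * k) (n * k) (flat k (\<lambda>i j p q. f p q (x i j) - f p q (y i j))) \<le> L * matdist x y)}"
    using assms by (intro CollectI conjI ballI flat_norm_least mult_nonneg_nonneg matdist_nonneg) auto
  show "bdd_below {L. 0 \<le> L \<and> (\<forall>x\<in>mats n X. \<forall>y\<in>mats n X.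
     cmat_norm (n * k) (n * k) (flat k (\<lambda>i j p q. f p q (x i j) - f p q (y i j))) \<le> L * matdist x y)}"
    by (rule bdd_belowI[of _ 0]) auto
qed

text \<open>A matrix of Lipschitz functions is Lipschitz on every amplification: each entry of \<open>f (x i j) - f (y i j)\<close> is
controlled by \<open>x i j - y i j\<close>, whose norm is at most that of the whole matrix. Without this the infimum in
\<open>lip_const\<close> would be over the empty set.\<close>

lemma lip_mnorm_set_nonempty:
  assumes f: "f \<in> mats k Lip"
  shows "\<exists>L\<ge>0. \<forall>x\<in>mats n X. \<forall>y\<in>mats n X.
     cmat_norm (n * k) (n * k) (flat k (\<lambda>i j p q. f p q (x i j) - f p q (y i j))) \<le> L * matdist x y"
proof -
  have "\<forall>p q. \<exists>L. p < k \<longrightarrow> q < k \<longrightarrow>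
      0 \<le> L \<and> (\<forall>x\<in>X. \<forall>y\<in>X. norm (f p q x - f p q y) \<le> L * opdist x y)"
  proof (intro allI)
    fix p q
    show "\<exists>L. p < k \<longrightarrow> q < k \<longrightarrow>
      0 \<le> L \<and> (\<forall>x\<in>X. \<forall>y\<in>X. norm (f p q x - f p q y) \<le> L * opdist x y)"
    proof (cases "p < k \<and> q < k")
      case True
      then have "f p q \<in> Lip" using f by (simp add: mats_def)
      then obtain L where "0 \<le> L" "\<And>x y. x \<in> X \<Longrightarrow> y \<in> X \<Longrightarrow> norm (f p q x - f p q y) \<le> L * opdist x y"
        by (rule Lip_bound) blast
      then show ?thesis by (intro exI[of _ L]) simp
    qed simp
  qed
  then obtain L where L': "\<forall>p q. p < k \<longrightarrow> q < k \<longrightarrow>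
      0 \<le> L p q \<and> (\<forall>x\<in>X. \<forall>y\<in>X. norm (f p q x - f p q y) \<le> L p q * opdist x y)"
    by (simp only: choice_iff) blast
  then have L0: "\<And>p q. p < k \<Longrightarrow> q < k \<Longrightarrow> 0 \<le> L p q"
    and L: "\<And>p q x y. p < k \<Longrightarrow> q < k \<Longrightarrow> x \<in> X \<Longrightarrow> y \<in> X \<Longrightarrow> norm (f p q x - f p q y) \<le> L p q * opdist x y"
    by blast+
  let ?L = "\<Sum>i<n. \<Sum>p<k. \<Sum>j<n. \<Sum>q<k. L p q"
  have L0': "0 \<le> ?L" using L0 by (intro sum_nonneg) auto
  show ?thesis
  proof (intro exI[of _ ?L] conjI L0' ballI flat_norm_least)
    fix x y assume xy: "x \<in> mats n X" "y \<in> mats n X"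
    show "0 \<le> ?L * matdist x y" using L0' matdist_nonneg xy by simp
    fix u v
    have "norm (f p q (x i j) - f p q (y i j)) \<le> L p q * matdist x y"
      if "i < n" "j < n" "p < k" "q < k" for i j p q
    proof -
      have "x i j \<in> X" "y i j \<in> X" using xy that unfolding mats_def by auto
      then have "norm (f p q (x i j) - f p q (y i j)) \<le> L p q * opdist (x i j) (y i j)"
        using L that by blast
      also have "\<dots> \<le> L p q * matdist x y" using that xy L0 by (intro mult_left_mono opdist_le_matdist)
      finally show ?thesis .
    qed
    then have "norm (block_form n k (increment f x y) u v)
      \<le> (\<Sum>i<n. \<Sum>p<k. \<Sum>j<n. \<Sum>q<k. L p q * matdist x y) * hs_norm n k u * hs_norm n k v"
      by (intro crude_form_bound) auto
    then show "norm (block_form n k (increment f x y) u v)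
      \<le> ?L * matdist x y * hs_norm n k u * hs_norm n k v"
      by (simp only: sum_distrib_right)
  qed
qed

lemma lip_mnorm_nonneg:
  assumes "f \<in> mats k Lip"
  shows "0 \<le> lip_mnorm n X k f"
  unfolding lip_mnorm_def lip_const_def
  using lip_mnorm_set_nonempty[OF assms] by (intro cInf_greatest) auto

text \<open>The infimum in \<open>lip_const\<close> is attained.\<close>

lemma lip_mnorm_bound:
  assumes f: "f \<in> mats k Lip" and xy: "x \<in> mats n X" "y \<in> mats n X"
  shows "cmat_norm (n * k) (n * k) (flat k (\<lambda>i j p q. f p q (x i j) - f p q (y i j)))
    \<le> lip_mnorm n X k f * matdist x y" (is "?c \<le> _")
proof -
  let ?S = "{L. 0 \<le> L \<and> (\<forall>x\<in>mats n X. \<forall>y\<in>mats n X.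
     cmat_norm (n * k) (n * k) (flat k (\<lambda>i j p q. f p q (x i j) - f p q (y i j))) \<le> L * matdist x y)}"
  have ne: "?S \<noteq> {}" using lip_mnorm_set_nonempty[OF f] by blast
  have c: "?c \<le> L * matdist x y" if "L \<in> ?S" for L using that xy by blast
  show ?thesis
  proof (cases "matdist x y = 0")
    case True
    then show ?thesis using ne c by fastforce
  next
    case False
    then have pos: "0 < matdist x y" using matdist_nonneg[OF xy] by simp
    have "?c / matdist x y \<le> lip_mnorm n X k f"
      unfolding lip_mnorm_def lip_const_def
      by (rule cInf_greatest[OF ne]) (use c pos in \<open>simp add: pos_divide_le_eq\<close>)
    then show ?thesis using pos by (simp add: pos_divide_le_eq)
  qed
qed

lemma lip_mnorm_form:
  assumes f: "f \<in> mats k Lip" and xy: "x \<in> mats n X" "y \<in> mats n X"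
  shows "norm (block_form n k (increment f x y) u v)
        \<le> lip_mnorm n X k f * matdist x y * hs_norm n k u * hs_norm n k v"
  by (rule order_trans[OF flat_norm_bilinear]) (intro mult_right_mono lip_mnorm_bound assms; simp)

definition pairing :: "nat \<Rightarrow> nat \<Rightarrow> (nat \<Rightarrow> nat \<Rightarrow> (('h \<Rightarrow> 'h) \<Rightarrow> complex) \<Rightarrow> complex) \<Rightarrow>
    (nat \<Rightarrow> nat \<Rightarrow> ('h \<Rightarrow> 'h) \<Rightarrow> complex) \<Rightarrow> complex matrix \<Rightarrow> complex matrix \<Rightarrow> complex" where
  "pairing k m \<phi> f u v = block_form k m (\<lambda>p q i j. \<phi> i j (f p q)) u v"

text \<open>A norm in the dual is a supremum of real numbers. This predicate says that the supremum is over a set that is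
bounded by \<open>C\<close>; estimates are stated with it, because an inequality for \<open>free_mnorm\<close> alone carries no
information about an unbounded matrix.\<close>

definition dual_bound :: "nat \<Rightarrow> (nat \<Rightarrow> nat \<Rightarrow> (('h \<Rightarrow> 'h) \<Rightarrow> complex) \<Rightarrow> complex) \<Rightarrow> real \<Rightarrow> bool" where
  "dual_bound m \<phi> C \<longleftrightarrow> 0 \<le> C \<and> (\<forall>k f u v. 1 \<le> k \<longrightarrow> f \<in> mats k Lip \<longrightarrow> lip_mnorm n X k f \<le> 1 \<longrightarrow>
     norm (pairing k m \<phi> f u v) \<le> C * hs_norm k m u * hs_norm k m v)"

lemma zero_unit_ball: "(\<lambda>_ _ _. 0) \<in> mats k Lip" "lip_mnorm n X k (\<lambda>_ _ _. 0) \<le> 1"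
proof -
  show "(\<lambda>_ _ _. 0) \<in> mats k Lip" using zero_Lip by (simp add: mats_def)
  have "lip_mnorm n X k (\<lambda>_ _ _. 0) \<le> 0" by (rule lip_mnorm_least) auto
  then show "lip_mnorm n X k (\<lambda>_ _ _. 0) \<le> 1" by simp
qed

lemma free_mnorm_least:
  assumes "dual_bound m \<phi> C"
  shows "free_mnorm n X x0 m \<phi> \<le> C"
  unfolding free_mnorm_def dual_mnorm_def
proof (rule cSup_least)
  show "{cmat_norm (k * m) (k * m) (flat m (\<lambda>p q i j. \<phi> i j (f p q))) | k f.
       1 \<le> k \<and> f \<in> mats k Lip \<and> lip_mnorm n X k f \<le> 1} \<noteq> {}"
    using zero_unit_ball[of 1] by blast
next
  fix s assume "s \<in> {cmat_norm (k * m) (k * m) (flat m (\<lambda>p q i j. \<phi> i j (f p q))) | k f.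
       1 \<le> k \<and> f \<in> mats k Lip \<and> lip_mnorm n X k f \<le> 1}"
  then obtain k f where s: "s = cmat_norm (k * m) (k * m) (flat m (\<lambda>p q i j. \<phi> i j (f p q)))"
    and f: "1 \<le> k" "f \<in> mats k Lip" "lip_mnorm n X k f \<le> 1" by blast
  show "s \<le> C" unfolding s
    using assms f unfolding dual_bound_def pairing_def by (intro flat_norm_least) auto
qed

lemma dual_bound_free_mnorm:
  assumes "dual_bound m \<phi> C"
  shows "dual_bound m \<phi> (free_mnorm n X x0 m \<phi>)"
proof -
  let ?S = "{cmat_norm (k * m) (k * m) (flat m (\<lambda>p q i j. \<phi> i j (f p q))) | k f.
       1 \<le> k \<and> f \<in> mats k Lip \<and> lip_mnorm n X k f \<le> 1}"
  have "bdd_above ?S"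
  proof (rule bdd_aboveI)
    fix s assume "s \<in> ?S"
    then obtain k f where s: "s = cmat_norm (k * m) (k * m) (flat m (\<lambda>p q i j. \<phi> i j (f p q)))"
      and f: "1 \<le> k" "f \<in> mats k Lip" "lip_mnorm n X k f \<le> 1" by blast
    show "s \<le> C" unfolding s
      using assms f unfolding dual_bound_def pairing_def by (intro flat_norm_least) auto
  qed
  then have up: "cmat_norm (k * m) (k * m) (flat m (\<lambda>p q i j. \<phi> i j (f p q))) \<le> free_mnorm n X x0 m \<phi>"
    if "1 \<le> k" "f \<in> mats k Lip" "lip_mnorm n X k f \<le> 1" for k f
    unfolding free_mnorm_def dual_mnorm_def using that by (intro cSup_upper) blast+
  show ?thesis unfolding dual_bound_def
  proof (intro conjI allI impI)
    show "0 \<le> free_mnorm n X x0 m \<phi>"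
      by (rule order_trans[OF cmat_norm_nonneg up[OF order_refl zero_unit_ball]])
    fix k f u v assume f: "1 \<le> k" "f \<in> mats k Lip" "lip_mnorm n X k f \<le> 1"
    show "norm (pairing k m \<phi> f u v) \<le> free_mnorm n X x0 m \<phi> * hs_norm k m u * hs_norm k m v"
      unfolding pairing_def
      by (rule order_trans[OF flat_norm_bilinear]) (intro mult_right_mono up f; simp)
  qed
qed

lemma dual_bound_add:
  assumes "dual_bound m \<phi> C" "dual_bound m \<psi> D"
  shows "dual_bound m (\<lambda>i j f. \<phi> i j f + \<psi> i j f) (C + D)"
proof -
  have "pairing k m (\<lambda>i j f. \<phi> i j f + \<psi> i j f) f u v = pairing k m \<phi> f u v + pairing k m \<psi> f u v" for k f u v
    unfolding pairing_def by (simp add: distrib_left distrib_right sum.distrib)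
  then show ?thesis
    using assms unfolding dual_bound_def
    by (auto simp: distrib_right intro!: order_trans[OF norm_triangle_ineq] add_mono)
qed

lemma dual_bound_uminus:
  assumes "dual_bound m \<phi> C"
  shows "dual_bound m (\<lambda>i j f. - \<phi> i j f) C"
proof -
  have "pairing k m (\<lambda>i j f. - \<phi> i j f) f u v = - pairing k m \<phi> f u v" for k f u v
    unfolding pairing_def by (simp add: sum_negf)
  then show ?thesis using assms unfolding dual_bound_def by simp
qed

lemma dual_bound_diff:
  assumes "dual_bound m \<phi> C" "dual_bound m \<psi> D"
  shows "dual_bound m (\<lambda>i j f. \<phi> i j f - \<psi> i j f) (C + D)"
  using dual_bound_add[OF assms(1) dual_bound_uminus[OF assms(2)]] by simp

lemma dual_bound_mono: "dual_bound m \<phi> C \<Longrightarrow> C \<le> D \<Longrightarrow> dual_bound m \<phi> D"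
  unfolding dual_bound_def by (meson mult_right_mono order_trans hs_norm_nonneg)

lemma dual_bound_cong:
  assumes "\<And>i j f. i < m \<Longrightarrow> j < m \<Longrightarrow> f \<in> Lip \<Longrightarrow> \<phi> i j f = \<psi> i j f"
  shows "dual_bound m \<phi> C \<longleftrightarrow> dual_bound m \<psi> C"
proof -
  have "pairing k m \<phi> f u v = pairing k m \<psi> f u v" if "f \<in> mats k Lip" for k f u v
    unfolding pairing_def using assms that by (intro sum.cong refl) (auto simp: mats_def)
  then show ?thesis unfolding dual_bound_def by auto
qed

text \<open>For a fixed size \<open>m\<close> the entries control the matrix, and the constant does not matter where this is used: it
gives boundedness, and approximations with an arbitrarily small error.\<close>

lemma dual_bound_entries:
  assumes "\<And>i j. i < m \<Longrightarrow> j < m \<Longrightarrow> dual_bound 1 (\<lambda>_ _. \<phi> i j) (C i j)"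
  shows "dual_bound m \<phi> (\<Sum>i<m. \<Sum>j<m. C i j)"
  unfolding dual_bound_def
proof (intro conjI allI impI)
  show "0 \<le> (\<Sum>i<m. \<Sum>j<m. C i j)" using assms unfolding dual_bound_def by (intro sum_nonneg) auto
  fix k f u v assume f: "1 \<le> k" "f \<in> mats k Lip" "lip_mnorm n X k f \<le> 1"
  have "pairing k m \<phi> f u v = (\<Sum>i<m. \<Sum>p<k. \<Sum>q<k. \<Sum>j<m. u p i * \<phi> i j (f p q) * v q j)"
    unfolding pairing_def by (rule sum.swap)
  also have "\<dots> = (\<Sum>i<m. \<Sum>p<k. \<Sum>j<m. \<Sum>q<k. u p i * \<phi> i j (f p q) * v q j)"
    by (rule sum.cong[OF refl], rule sum.cong[OF refl], rule sum.swap)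
  also have "\<dots> = (\<Sum>i<m. \<Sum>j<m. \<Sum>p<k. \<Sum>q<k. u p i * \<phi> i j (f p q) * v q j)"
    by (rule sum.cong[OF refl], rule sum.swap)
  also have "\<dots> = (\<Sum>i<m. \<Sum>j<m. pairing k 1 (\<lambda>_ _. \<phi> i j) f (\<lambda>p _. u p i) (\<lambda>q _. v q j))"
    unfolding pairing_def by simp
  finally have "norm (pairing k m \<phi> f u v)
      \<le> (\<Sum>i<m. \<Sum>j<m. norm (pairing k 1 (\<lambda>_ _. \<phi> i j) f (\<lambda>p _. u p i) (\<lambda>q _. v q j)))"
    by (simp only:) (intro sum_norm_le order_refl)
  also have "\<dots> \<le> (\<Sum>i<m. \<Sum>j<m. C i j * hs_norm k m u * hs_norm k m v)"
  proof (intro sum_mono)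
    fix i j assume ij: "i \<in> {..<m}" "j \<in> {..<m}"
    have b: "dual_bound 1 (\<lambda>_ _. \<phi> i j) (C i j)" using assms ij by simp
    then have "norm (pairing k 1 (\<lambda>_ _. \<phi> i j) f (\<lambda>p _. u p i) (\<lambda>q _. v q j))
      \<le> C i j * hs_norm k 1 (\<lambda>p _. u p i) * hs_norm k 1 (\<lambda>q _. v q j)"
      using f unfolding dual_bound_def by blast
    also have "\<dots> \<le> C i j * hs_norm k m u * hs_norm k m v"
      using b ij unfolding dual_bound_def by (intro mult_mono hs_norm_column_le mult_nonneg_nonneg) auto
    finally show "norm (pairing k 1 (\<lambda>_ _. \<phi> i j) f (\<lambda>p _. u p i) (\<lambda>q _. v q j))
      \<le> C i j * hs_norm k m u * hs_norm k m v" .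
  qed
  finally show "norm (pairing k m \<phi> f u v) \<le> (\<Sum>i<m. \<Sum>j<m. C i j) * hs_norm k m u * hs_norm k m v"
    by (simp only: sum_distrib_right)
qed

lemma cdual_sum:
  assumes \<phi>: "\<phi> \<in> cdual Lip N" and "finite I" and "\<And>i. i \<in> I \<Longrightarrow> f i \<in> Lip"
  shows "\<phi> (\<lambda>x. \<Sum>i\<in>I. c i * f i x) = (\<Sum>i\<in>I. c i * \<phi> (f i))"
  using assms(2,3)
proof (induction I rule: finite_induct)
  case empty
  have "\<And>c f. f \<in> Lip \<Longrightarrow> \<phi> (\<lambda>x. c * f x) = c * \<phi> f"
    using \<phi> unfolding cdual_def by blast
  from this[OF zero_Lip, of 0] show ?case by simp
next
  case (insert i I)
  have "\<phi> (\<lambda>x. c i * f i x + (\<Sum>i\<in>I. c i * f i x)) = \<phi> (\<lambda>x. c i * f i x) + \<phi> (\<lambda>x. \<Sum>i\<in>I. c i * f i x)"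
    using \<phi> insert.prems scale_Lip sum_Lip[of I f c] unfolding cdual_def by simp
  also have "\<phi> (\<lambda>x. c i * f i x) = c i * \<phi> (f i)"
    using \<phi> insert.prems unfolding cdual_def by simp
  finally show ?case using insert by simp
qed

text \<open>Compressing with two vectors amounts to testing the amplification on the product vectors \<open>u i * a p\<close>
and \<open>b q * v j\<close>, so it does not increase the Lipschitz norm.\<close>

lemma lip_mnorm_compress:
  assumes f: "f \<in> mats k Lip" and f1: "lip_mnorm n X k f \<le> 1"
  shows "lip_mnorm n X 1 (\<lambda>_ _ x. \<Sum>p<k. \<Sum>q<k. a p * f p q x * b q) \<le> vnorm k a * vnorm k b"
proof (rule lip_mnorm_least)
  show "0 \<le> vnorm k a * vnorm k b" by simp
  fix x y and u v :: "complex matrix" assume xy: "x \<in> mats n X" "y \<in> mats n X"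
  let ?u = "\<lambda>(i::nat) p. u i 0 * a p" let ?v = "\<lambda>(j::nat) q. b q * v j 0"
  have "(\<Sum>i<n. \<Sum>p<1. \<Sum>j<n. \<Sum>q<1. u i p * ((\<Sum>p<k. \<Sum>q<k. a p * f p q (x i j) * b q)
        - (\<Sum>p<k. \<Sum>q<k. a p * f p q (y i j) * b q)) * v j q)
      = (\<Sum>i<n. \<Sum>j<n. \<Sum>p<k. \<Sum>q<k. ?u i p * (f p q (x i j) - f p q (y i j)) * ?v j q)"
    by (simp add: sum_subtractf[symmetric] sum_distrib_left sum_distrib_right algebra_simps)
  also have "\<dots> = block_form n k (increment f x y) ?u ?v"
    by (rule sum.cong[OF refl], rule sum.swap)
  finally have eq: "(\<Sum>i<n. \<Sum>p<1. \<Sum>j<n. \<Sum>q<1. u i p * ((\<Sum>p<k. \<Sum>q<k. a p * f p q (x i j) * b q)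
        - (\<Sum>p<k. \<Sum>q<k. a p * f p q (y i j) * b q)) * v j q)
      = block_form n k (increment f x y) ?u ?v" .
  have "norm (block_form n k (increment f x y) ?u ?v)
      \<le> lip_mnorm n X k f * matdist x y * hs_norm n k ?u * hs_norm n k ?v"
    by (rule lip_mnorm_form[OF f xy])
  also have "\<dots> \<le> 1 * matdist x y * hs_norm n k ?u * hs_norm n k ?v"
    using f1 matdist_nonneg[OF xy] by (intro mult_right_mono) auto
  also have "hs_norm n k ?u = vnorm k a * hs_norm n 1 u"
  proof -
    have "(\<Sum>i<n. \<Sum>p<k. (norm (u i 0 * a p))\<^sup>2) = sqnorm k a * (\<Sum>i<n. \<Sum>p<1. (norm (u i p))\<^sup>2)"
      by (simp add: norm_mult power_mult_distrib sum_product sum.swap[of _ "{..<k}"] mult.commute)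
    then show ?thesis by (simp only: hs_norm_def L2_set_def real_sqrt_mult)
  qed
  also have "hs_norm n k ?v = vnorm k b * hs_norm n 1 v"
  proof -
    have "(\<Sum>i<n. \<Sum>p<k. (norm (b p * v i 0))\<^sup>2) = sqnorm k b * (\<Sum>i<n. \<Sum>p<1. (norm (v i p))\<^sup>2)"
      by (simp add: norm_mult power_mult_distrib sum_product sum.swap[of _ "{..<k}"] mult.commute)
    then show ?thesis by (simp only: hs_norm_def L2_set_def real_sqrt_mult)
  qed
  finally show "norm (\<Sum>i<n. \<Sum>p<1. \<Sum>j<n. \<Sum>q<1. u i p * ((\<Sum>p<k. \<Sum>q<k. a p * f p q (x i j) * b q)
        - (\<Sum>p<k. \<Sum>q<k. a p * f p q (y i j) * b q)) * v j q)
      \<le> vnorm k a * vnorm k b * matdist x y * hs_norm n 1 u * hs_norm n 1 v"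
    unfolding eq by (simp only: mult_ac mult_1_left)
qed

text \<open>A bounded functional is completely bounded: \<open>\<phi>\<close> applied to a matrix of functions and then paired with two
vectors is \<open>\<phi>\<close> of the compression of the matrix.\<close>

lemma cdual_dual_bound:
  assumes \<phi>: "\<phi> \<in> cdual Lip (lip_mnorm n X)"
  shows "\<exists>C. dual_bound 1 (\<lambda>_ _. \<phi>) C"
proof -
  obtain K where K: "\<And>f. f \<in> Lip \<Longrightarrow> norm (\<phi> f) \<le> K * lip_mnorm n X 1 (\<lambda>_ _. f)"
    using \<phi> unfolding cdual_def by blast
  have "dual_bound 1 (\<lambda>_ _. \<phi>) \<bar>K\<bar>"
    unfolding dual_bound_def
  proof (intro conjI allI impI)
    fix k f and u v :: "complex matrix" assume f: "1 \<le> k" "f \<in> mats k Lip" "lip_mnorm n X k f \<le> 1"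
    let ?g = "\<lambda>x. \<Sum>p<k. \<Sum>q<k. u p 0 * f p q x * v q 0"
    let ?I = "{..<k} \<times> {..<k}"
    have g: "?g = (\<lambda>x. \<Sum>z\<in>?I. (u (fst z) 0 * v (snd z) 0) * f (fst z) (snd z) x)"
      by (simp add: sum.cartesian_product case_prod_beta mult_ac)
    have fI: "f (fst z) (snd z) \<in> Lip" if "z \<in> ?I" for z using f that by (auto simp: mats_def)
    have gL: "?g \<in> Lip" unfolding g by (rule sum_Lip) (rule fI)
    have "\<phi> ?g = (\<Sum>z\<in>?I. (u (fst z) 0 * v (snd z) 0) * \<phi> (f (fst z) (snd z)))"
      unfolding g by (rule cdual_sum[OF \<phi>]) (use fI in auto)
    also have "\<dots> = (\<Sum>p<k. \<Sum>q<k. u p 0 * \<phi> (f p q) * v q 0)"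
      by (simp add: sum.cartesian_product case_prod_beta mult_ac)
    finally have eq: "pairing k 1 (\<lambda>_ _. \<phi>) f u v = \<phi> ?g"
      unfolding pairing_def by simp
    have t: "hs_norm k 1 w = vnorm k (\<lambda>p. w p 0)" for w by (simp add: hs_norm_def L2_set_def)
    have gn: "0 \<le> lip_mnorm n X 1 (\<lambda>_ _. ?g)" by (rule lip_mnorm_nonneg) (use gL in \<open>simp add: mats_def\<close>)
    have "norm (\<phi> ?g) \<le> K * lip_mnorm n X 1 (\<lambda>_ _. ?g)" by (rule K[OF gL])
    also have "\<dots> \<le> \<bar>K\<bar> * lip_mnorm n X 1 (\<lambda>_ _. ?g)" using gn by (intro mult_right_mono) auto
    also have "\<dots> \<le> \<bar>K\<bar> * (vnorm k (\<lambda>p. u p 0) * vnorm k (\<lambda>q. v q 0))"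
      by (intro mult_left_mono lip_mnorm_compress f) auto
    finally show "norm (pairing k 1 (\<lambda>_ _. \<phi>) f u v) \<le> \<bar>K\<bar> * hs_norm k 1 u * hs_norm k 1 v"
      unfolding eq t by (simp only: mult.assoc)
  qed simp
  then show ?thesis by blast
qed

lemma mats_cdual_dual_bound:
  assumes "\<phi> \<in> mats m (cdual Lip (lip_mnorm n X))"
  shows "\<exists>C. dual_bound m \<phi> C"
proof -
  have "\<exists>C. dual_bound 1 (\<lambda>_ _. \<phi> i j) C" if "i < m" "j < m" for i j
    by (rule cdual_dual_bound) (use assms that in \<open>simp add: mats_def\<close>)
  then have "\<forall>i j. \<exists>C. i < m \<longrightarrow> j < m \<longrightarrow> dual_bound 1 (\<lambda>_ _. \<phi> i j) C" by blast
  then obtain C where "\<forall>i j. i < m \<longrightarrow> j < m \<longrightarrow> dual_bound 1 (\<lambda>_ _. \<phi> i j) (C i j)"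
    by (simp only: choice_iff) blast
  then show ?thesis by (intro exI[of _ "\<Sum>i<m. \<Sum>j<m. C i j"] dual_bound_entries) simp
qed

end

section \<open>Products with delta diagonal matrices\<close>

lemma bilinear_expand:
  fixes \<xi> \<eta> :: "nat \<Rightarrow> complex"
  shows "(\<Sum>i\<in>S. \<Sum>j\<in>T. \<xi> i * (\<Sum>z\<in>Z. A i z * D z * B j z) * \<eta> j)
    = (\<Sum>z\<in>Z. (\<Sum>i\<in>S. \<xi> i * A i z) * D z * (\<Sum>j\<in>T. \<eta> j * B j z))"
proof -
  have "(\<Sum>i\<in>S. \<Sum>j\<in>T. \<xi> i * (\<Sum>z\<in>Z. A i z * D z * B j z) * \<eta> j)
    = (\<Sum>i\<in>S. \<Sum>j\<in>T. \<Sum>z\<in>Z. (\<xi> i * A i z) * D z * (\<eta> j * B j z))"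
    unfolding sum_distrib_left sum_distrib_right by (intro sum.cong refl) (simp only: mult_ac)
  also have "\<dots> = (\<Sum>i\<in>S. \<Sum>z\<in>Z. \<Sum>j\<in>T. (\<xi> i * A i z) * D z * (\<eta> j * B j z))"
    by (rule sum.cong[OF refl], rule sum.swap)
  also have "\<dots> = (\<Sum>z\<in>Z. \<Sum>i\<in>S. \<Sum>j\<in>T. (\<xi> i * A i z) * D z * (\<eta> j * B j z))"
    by (rule sum.swap)
  also have "\<dots> = (\<Sum>z\<in>Z. (\<Sum>i\<in>S. \<xi> i * A i z) * D z * (\<Sum>j\<in>T. \<eta> j * B j z))"
    unfolding sum_distrib_left[symmetric] sum_distrib_right[symmetric] ..
  finally show ?thesis .
qed

text \<open>The scalar matrices can be moved from the product to the vectors that test it.\<close>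

lemma bilinear_expand3:
  fixes \<xi> \<eta> :: "nat \<Rightarrow> complex"
  shows "(\<Sum>i\<in>S. \<Sum>j\<in>T. \<xi> i * (\<Sum>l\<in>I. \<Sum>s<n. \<Sum>t<n. a l i s * D l s t * b l j t) * \<eta> j)
    = (\<Sum>l\<in>I. \<Sum>s<n. \<Sum>t<n. (\<Sum>i\<in>S. \<xi> i * a l i s) * D l s t * (\<Sum>j\<in>T. \<eta> j * b l j t))"
  using bilinear_expand[where Z = "I \<times> {..<n} \<times> {..<n}" and A = "\<lambda>i z. a (fst z) i (fst (snd z))"
      and D = "\<lambda>z. D (fst z) (fst (snd z)) (snd (snd z))" and B = "\<lambda>j z. b (fst z) j (snd (snd z))"
      and S = S and T = T and \<xi> = \<xi> and \<eta> = \<eta>]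
  by (simp only: sum.cartesian_product split_def fst_conv snd_conv)

context pointed_operators
begin

definition block_term :: "('l \<Rightarrow> nat \<Rightarrow> nat \<Rightarrow> complex) \<Rightarrow> ('l \<Rightarrow> nat \<Rightarrow> nat \<Rightarrow> complex) \<Rightarrow> ('l \<Rightarrow> complex) \<Rightarrow>
    ('l \<Rightarrow> nat \<Rightarrow> nat \<Rightarrow> 'h \<Rightarrow> 'h) \<Rightarrow> ('l \<Rightarrow> nat \<Rightarrow> nat \<Rightarrow> 'h \<Rightarrow> 'h) \<Rightarrow> 'l \<Rightarrow> nat \<Rightarrow> nat \<Rightarrow>
    (('h \<Rightarrow> 'h) \<Rightarrow> complex) \<Rightarrow> complex" where
  "block_term a b c x y l i j f = (\<Sum>s<n. \<Sum>t<n. a l i s * (c l * (f (x l s t) - f (y l s t))) * b l j t)"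

text \<open>Testing with vectors \<open>u\<close>, \<open>v\<close> turns the \<open>l\<close>-th term into the block \<open>c l * (f (x l) - f (y l))\<close> tested with
\<open>U l\<close>, \<open>V l\<close>, the images of \<open>u\<close> and \<open>v\<close> under the \<open>l\<close>-th parts of \<open>a\<close> and \<open>b\<close>. Each block has norm at most \<open>\<sigma>\<close>, and the
Cauchy-Schwarz inequality in \<open>l\<close> leaves the norms of \<open>U\<close> and \<open>V\<close>, which \<open>a\<close> and \<open>b\<close> control. The terms may be indexed by
any type, and \<open>b\<close> is stored transposed so that both sides have the same shape.\<close>

lemma product_bound:
  assumes x: "\<And>l. l \<in> I \<Longrightarrow> x l \<in> mats n X" and y: "\<And>l. l \<in> I \<Longrightarrow> y l \<in> mats n X"
    and \<sigma>: "\<And>l. l \<in> I \<Longrightarrow> norm (c l) * matdist (x l) (y l) \<le> \<sigma>"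
    and pos: "0 \<le> \<sigma>" "0 \<le> A" "0 \<le> B"
    and a: "\<And>\<xi>. frame n m I a \<xi> \<le> A\<^sup>2 * sqnorm m \<xi>"
    and b: "\<And>\<xi>. frame n m I b \<xi> \<le> B\<^sup>2 * sqnorm m \<xi>"
  shows "dual_bound m (\<lambda>i j f. \<Sum>l\<in>I. block_term a b c x y l i j f) (\<sigma> * A * B)"
  unfolding dual_bound_def
proof (intro conjI allI impI)
  show "0 \<le> \<sigma> * A * B" using pos by simp
  fix k f and u v :: "complex matrix"
  assume f: "1 \<le> k" "f \<in> mats k Lip" "lip_mnorm n X k f \<le> 1"
  define U where "U l s p = (\<Sum>i<m. u p i * a l i s)" for l s p
  define V where "V l t q = (\<Sum>j<m. v q j * b l j t)" for l t q
  define d where "d l s t p q = f p q (x l s t) - f p q (y l s t)" for l s t p q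
  have "pairing k m (\<lambda>i j f. \<Sum>l\<in>I. block_term a b c x y l i j f) f u v
    = (\<Sum>p<k. \<Sum>q<k. \<Sum>i<m. \<Sum>j<m. u p i * (\<Sum>l\<in>I. \<Sum>s<n. \<Sum>t<n. a l i s * (c l * d l s t p q) * b l j t) * v q j)"
    unfolding pairing_def block_term_def d_def by (rule sum.cong[OF refl], rule sum.swap)
  also have "\<dots> = (\<Sum>p<k. \<Sum>q<k. \<Sum>l\<in>I. \<Sum>s<n. \<Sum>t<n. U l s p * (c l * d l s t p q) * V l t q)"
    unfolding bilinear_expand3 U_def V_def ..
  also have "\<dots> = (\<Sum>p<k. \<Sum>l\<in>I. \<Sum>q<k. \<Sum>s<n. \<Sum>t<n. U l s p * (c l * d l s t p q) * V l t q)"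
    by (rule sum.cong[OF refl], rule sum.swap)
  also have "\<dots> = (\<Sum>l\<in>I. \<Sum>p<k. \<Sum>q<k. \<Sum>s<n. \<Sum>t<n. U l s p * (c l * d l s t p q) * V l t q)"
    by (rule sum.swap)
  also have "\<dots> = (\<Sum>l\<in>I. \<Sum>p<k. \<Sum>s<n. \<Sum>q<k. \<Sum>t<n. U l s p * (c l * d l s t p q) * V l t q)"
    by (rule sum.cong[OF refl], rule sum.cong[OF refl], rule sum.swap)
  also have "\<dots> = (\<Sum>l\<in>I. \<Sum>s<n. \<Sum>p<k. \<Sum>q<k. \<Sum>t<n. U l s p * (c l * d l s t p q) * V l t q)"
    by (rule sum.cong[OF refl], rule sum.swap)
  also have "\<dots> = (\<Sum>l\<in>I. \<Sum>s<n. \<Sum>p<k. \<Sum>t<n. \<Sum>q<k. U l s p * (c l * d l s t p q) * V l t q)"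
    by (rule sum.cong[OF refl], rule sum.cong[OF refl], rule sum.cong[OF refl], rule sum.swap)
  also have "\<dots> = (\<Sum>l\<in>I. c l * (\<Sum>s<n. \<Sum>p<k. \<Sum>t<n. \<Sum>q<k. U l s p * d l s t p q * V l t q))"
    by (simp only: sum_distrib_left mult_ac)
  finally have eq: "pairing k m (\<lambda>i j f. \<Sum>l\<in>I. block_term a b c x y l i j f) f u v
    = (\<Sum>l\<in>I. c l * (\<Sum>s<n. \<Sum>p<k. \<Sum>t<n. \<Sum>q<k. U l s p * d l s t p q * V l t q))" .
  have "norm (\<Sum>l\<in>I. c l * (\<Sum>s<n. \<Sum>p<k. \<Sum>t<n. \<Sum>q<k. U l s p * d l s t p q * V l t q))
    \<le> (\<Sum>l\<in>I. \<sigma> * (\<bar>hs_norm n k (U l)\<bar> * \<bar>hs_norm n k (V l)\<bar>))"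
  proof (rule sum_norm_le)
    fix l assume l: "l \<in> I"
    have "norm (\<Sum>s<n. \<Sum>p<k. \<Sum>t<n. \<Sum>q<k. U l s p * d l s t p q * V l t q)
      \<le> lip_mnorm n X k f * matdist (x l) (y l) * hs_norm n k (U l) * hs_norm n k (V l)"
      unfolding d_def by (rule lip_mnorm_form[OF f(2) x[OF l] y[OF l]])
    also have "\<dots> \<le> 1 * matdist (x l) (y l) * hs_norm n k (U l) * hs_norm n k (V l)"
      using f(3) matdist_nonneg[OF x[OF l] y[OF l]] by (intro mult_right_mono) auto
    finally have "norm (c l) * norm (\<Sum>s<n. \<Sum>p<k. \<Sum>t<n. \<Sum>q<k. U l s p * d l s t p q * V l t q)
      \<le> norm (c l) * (matdist (x l) (y l) * hs_norm n k (U l) * hs_norm n k (V l))"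
      by (intro mult_left_mono) auto
    also have "\<dots> = (norm (c l) * matdist (x l) (y l)) * (hs_norm n k (U l) * hs_norm n k (V l))"
      by (simp only: mult_ac)
    also have "\<dots> \<le> \<sigma> * (hs_norm n k (U l) * hs_norm n k (V l))"
      using \<sigma>[OF l] by (intro mult_right_mono) auto
    finally show "norm (c l * (\<Sum>s<n. \<Sum>p<k. \<Sum>t<n. \<Sum>q<k. U l s p * d l s t p q * V l t q))
      \<le> \<sigma> * (\<bar>hs_norm n k (U l)\<bar> * \<bar>hs_norm n k (V l)\<bar>)"
      by (simp add: norm_mult)
  qed
  also have "\<dots> \<le> \<sigma> * (L2_set (\<lambda>l. hs_norm n k (U l)) I * L2_set (\<lambda>l. hs_norm n k (V l)) I)"
    unfolding sum_distrib_left[symmetric] by (intro mult_left_mono L2_set_mult_ineq pos)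
  also have "\<dots> \<le> \<sigma> * ((A * hs_norm k m u) * (B * hs_norm k m v))"
  proof -
    have gen: "L2_set (\<lambda>l. hs_norm n k (\<lambda>s p. \<Sum>i<m. w p i * g l i s)) I \<le> G * hs_norm k m w"
      if G: "0 \<le> G" and g: "\<And>\<xi>. frame n m I g \<xi> \<le> G\<^sup>2 * sqnorm m \<xi>"
      for w :: "complex matrix" and g G
    proof -
      have "(\<Sum>l\<in>I. (hs_norm n k (\<lambda>s p. \<Sum>i<m. w p i * g l i s))\<^sup>2)
        = (\<Sum>l\<in>I. \<Sum>s<n. \<Sum>p<k. (norm (\<Sum>i<m. w p i * g l i s))\<^sup>2)" unfolding hs_norm_sq ..
      also have "\<dots> = (\<Sum>l\<in>I. \<Sum>p<k. \<Sum>s<n. (norm (\<Sum>i<m. w p i * g l i s))\<^sup>2)"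
        by (rule sum.cong[OF refl], rule sum.swap)
      also have "\<dots> = (\<Sum>p<k. \<Sum>l\<in>I. \<Sum>s<n. (norm (\<Sum>i<m. w p i * g l i s))\<^sup>2)" by (rule sum.swap)
      also have "\<dots> \<le> (\<Sum>p<k. G\<^sup>2 * (\<Sum>i<m. (norm (w p i))\<^sup>2))" by (intro sum_mono g)
      also have "\<dots> = (G * hs_norm k m w)\<^sup>2" by (simp only: power_mult_distrib hs_norm_sq sum_distrib_left)
      finally show ?thesis unfolding L2_set_def using G by (intro real_le_lsqrt) (auto intro: sum_nonneg)
    qed
    show ?thesis unfolding U_def V_def using pos
      by (intro mult_left_mono mult_mono gen a b) auto
  qed
  also have "\<dots> = \<sigma> * A * B * hs_norm k m u * hs_norm k m v" by (simp only: mult_ac)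
  finally show "norm (pairing k m (\<lambda>i j f. \<Sum>l\<in>I. block_term a b c x y l i j f) f u v)
    \<le> \<sigma> * A * B * hs_norm k m u * hs_norm k m v" unfolding eq .
qed

text \<open>Off-diagonal blocks vanish, so a truncated product is a sum of block terms.\<close>

lemma trunc_prod_eq:
  assumes D: "is_delta_diagonal n X x0 D c x y" and f: "f \<in> Lip"
  shows "trunc_prod n r \<alpha> D \<beta> i j f
    = (\<Sum>l<r. \<Sum>s<n. \<Sum>t<n. \<alpha> i (l * n + s) * (c l * (f (x l s t) - f (y l s t))) * \<beta> (l * n + t) j)"
proof -
  have "trunc_prod n r \<alpha> D \<beta> i j f = (\<Sum>s<r * n. \<Sum>t<r * n. \<alpha> i (s div n * n + s mod n) *
      D (s div n) (t div n) (s mod n) (t mod n) f * \<beta> (t div n * n + t mod n) j)"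
    unfolding trunc_prod_def flat_def by simp
  also have "\<dots> = (\<Sum>s<r * n. \<Sum>q<r. \<Sum>t<n. \<alpha> i (s div n * n + s mod n) *
      D (s div n) q (s mod n) t f * \<beta> (q * n + t) j)"
    by (rule sum.cong[OF refl], rule sum_div_mod)
  also have "\<dots> = (\<Sum>l<r. \<Sum>s<n. \<Sum>q<r. \<Sum>t<n. \<alpha> i (l * n + s) * D l q s t f * \<beta> (q * n + t) j)"
    by (rule sum_div_mod[of "\<lambda>l s. \<Sum>q<r. \<Sum>t<n. \<alpha> i (l * n + s) * D l q s t f * \<beta> (q * n + t) j"])
  also have "\<dots> = (\<Sum>l<r. \<Sum>s<n. \<Sum>q<r. if q = l then
      \<Sum>t<n. \<alpha> i (l * n + s) * (c l * (f (x l s t) - f (y l s t))) * \<beta> (l * n + t) j else 0)"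
    using D f unfolding is_delta_diagonal_def delta_def by (intro sum.cong refl) (auto intro!: sum.neutral)
  also have "\<dots> = (\<Sum>l<r. \<Sum>s<n. \<Sum>t<n. \<alpha> i (l * n + s) * (c l * (f (x l s t) - f (y l s t))) * \<beta> (l * n + t) j)"
    by (rule sum.cong[OF refl], rule sum.cong[OF refl]) simp
  finally show ?thesis .
qed

lemma trunc_prod_bound:
  assumes D: "is_delta_diagonal n X x0 D c x y"
    and \<sigma>: "\<And>l. l < r \<Longrightarrow> norm (c l) * matdist (x l) (y l) \<le> \<sigma>"
    and pos: "0 \<le> \<sigma>" "0 \<le> A" "0 \<le> B"
    and a: "\<And>\<xi>. vnorm (r * n) (\<lambda>s. \<Sum>i<m. \<xi> i * \<alpha> i s) \<le> A * vnorm m \<xi>"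
    and b: "\<And>\<xi>. vnorm (r * n) (\<lambda>s. \<Sum>i<m. \<xi> i * \<beta> s i) \<le> B * vnorm m \<xi>"
  shows "dual_bound m (trunc_prod n r \<alpha> D \<beta>) (\<sigma> * A * B)"
proof -
  have sq: "(\<Sum>l\<in>{..<r}. \<Sum>s<n. (norm (\<Sum>i<m. \<xi> i * g i (l * n + s)))\<^sup>2) \<le> G\<^sup>2 * sqnorm m \<xi>"
    if g: "\<And>\<xi>. vnorm (r * n) (\<lambda>s. \<Sum>i<m. \<xi> i * g i s) \<le> G * vnorm m \<xi>" for g G and \<xi> :: "nat \<Rightarrow> complex"
  proof -
    have "(\<Sum>l\<in>{..<r}. \<Sum>s<n. (norm (\<Sum>i<m. \<xi> i * g i (l * n + s)))\<^sup>2)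
      = (\<Sum>s<r * n. (norm (\<Sum>i<m. \<xi> i * g i (s div n * n + s mod n)))\<^sup>2)"
      by (rule sum_div_mod[symmetric])
    also have "\<dots> = (vnorm (r * n) (\<lambda>s. \<Sum>i<m. \<xi> i * g i s))\<^sup>2" unfolding vnorm_sq by simp
    also have "\<dots> \<le> (G * vnorm m \<xi>)\<^sup>2" by (intro power_mono g) simp
    finally show ?thesis unfolding power_mult_distrib vnorm_sq .
  qed
  have "dual_bound m (\<lambda>i j f. \<Sum>l<r. block_term (\<lambda>l i s. \<alpha> i (l * n + s)) (\<lambda>l j t. \<beta> (l * n + t) j) c x y l i j f)
    (\<sigma> * A * B)"
  proof (rule product_bound)
    show "x l \<in> mats n X" "y l \<in> mats n X" for l using D unfolding is_delta_diagonal_def by auto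
    show "norm (c l) * matdist (x l) (y l) \<le> \<sigma>" if "l \<in> {..<r}" for l using \<sigma> that by simp
    show "(\<Sum>l<r. \<Sum>s<n. (norm (\<Sum>i<m. \<xi> i * \<alpha> i (l * n + s)))\<^sup>2) \<le> A\<^sup>2 * sqnorm m \<xi>" for \<xi>
      by (rule sq[OF a])
    show "(\<Sum>l<r. \<Sum>s<n. (norm (\<Sum>i<m. \<xi> i * \<beta> (l * n + s) i))\<^sup>2) \<le> B\<^sup>2 * sqnorm m \<xi>" for \<xi>
      by (rule sq[OF b])
  qed (fact pos)+
  then show ?thesis
    by (rule iffD1[OF dual_bound_cong, rotated]) (simp add: trunc_prod_eq[OF D] block_term_def)
qed

text \<open>A matrix and its transpose have the same norm; a row matrix \<open>\<alpha>\<close> acts on the testing vector from the left.\<close>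

lemma row_bound:
  "vnorm N (\<lambda>s. \<Sum>i<k. \<xi> i * A i s) \<le> cmat_norm k N A * vnorm k \<xi>"
proof -
  let ?w = "\<lambda>s. \<Sum>i<k. \<xi> i * A i s"
  have "complex_of_real ((vnorm N ?w)\<^sup>2) = (\<Sum>s<N. ?w s * cnj (?w s))"
    unfolding vnorm_sq of_real_sum by (intro sum.cong refl complex_norm_square)
  also have "\<dots> = (\<Sum>i<k. \<Sum>s<N. \<xi> i * A i s * cnj (?w s))"
    unfolding sum_distrib_right by (rule sum.swap)
  finally have eq: "complex_of_real ((vnorm N ?w)\<^sup>2) = (\<Sum>i<k. \<Sum>s<N. \<xi> i * A i s * cnj (?w s))" .
  have "(vnorm N ?w)\<^sup>2 = norm (\<Sum>i<k. \<Sum>s<N. \<xi> i * A i s * cnj (?w s))"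
    unfolding eq[symmetric] norm_of_real by simp
  also have "\<dots> \<le> cmat_norm k N A * vnorm k \<xi> * vnorm N (\<lambda>s. cnj (?w s))" by (rule cmat_norm_bilinear)
  also have "vnorm N (\<lambda>s. cnj (?w s)) = vnorm N ?w" by (simp only: complex_mod_cnj)
  finally have "vnorm N ?w * vnorm N ?w \<le> (cmat_norm k N A * vnorm k \<xi>) * vnorm N ?w"
    by (simp only: power2_eq_square)
  then show ?thesis
    using cmat_norm_nonneg[of k N A] by (cases "0 < vnorm N ?w") (auto simp: not_less intro: order_trans[of _ 0])
qed

lemma row_norm_least:
  assumes "0 \<le> C" and "\<And>\<xi>. vnorm N (\<lambda>s. \<Sum>i<k. \<xi> i * A i s) \<le> C * vnorm k \<xi>"
  shows "cmat_norm k N A \<le> C"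
proof (rule cmat_norm_least[OF assms(1)])
  fix u v
  have "(\<Sum>i<k. \<Sum>j<N. u i * A i j * v j) = (\<Sum>j<N. (\<Sum>i<k. u i * A i j) * v j)"
    unfolding sum_distrib_right by (rule sum.swap)
  also have "norm \<dots> \<le> vnorm N (\<lambda>j. \<Sum>i<k. u i * A i j) * vnorm N v" by (rule cauchy_schwarz_sum)
  also have "\<dots> \<le> (C * vnorm k u) * vnorm N v" by (intro mult_right_mono assms) simp
  finally show "norm (\<Sum>i<k. \<Sum>j<N. u i * A i j * v j) \<le> C * vnorm k u * vnorm N v" .
qed

lemma col_norm_least:
  assumes "0 \<le> C" and "\<And>\<xi>. vnorm N (\<lambda>s. \<Sum>i<k. \<xi> i * A s i) \<le> C * vnorm k \<xi>"
  shows "cmat_norm N k A \<le> C"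
  unfolding cmat_norm_def
  by (rule opmat_norm_least[OF assms(1)]) (use assms(2) in \<open>simp add: mult.commute\<close>)

lemma delta_span_delta: "x \<in> X \<Longrightarrow> delta X x0 x \<in> delta_span X x0"
  unfolding delta_span_def by (intro CollectI exI[of _ "{x}"] exI[of _ "\<lambda>_. 1"]) auto

lemma delta_span_zero: "(\<lambda>_. 0) \<in> delta_span X x0"
  unfolding delta_span_def by (intro CollectI exI[of _ "{}"]) auto

lemma delta_span_scale: "\<phi> \<in> delta_span X x0 \<Longrightarrow> (\<lambda>f. c * \<phi> f) \<in> delta_span X x0"
proof -
  assume "\<phi> \<in> delta_span X x0"
  then obtain S a where "\<phi> = (\<lambda>f. \<Sum>x\<in>S. a x * delta X x0 x f)" "finite S" "S \<subseteq> X"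
    unfolding delta_span_def by blast
  then show ?thesis unfolding delta_span_def
    by (intro CollectI exI[of _ S] exI[of _ "\<lambda>x. c * a x"]) (auto simp: sum_distrib_left mult.assoc)
qed

lemma delta_span_add:
  assumes "\<phi> \<in> delta_span X x0" "\<psi> \<in> delta_span X x0"
  shows "(\<lambda>f. \<phi> f + \<psi> f) \<in> delta_span X x0"
proof -
  obtain S a where 1: "\<phi> = (\<lambda>f. \<Sum>x\<in>S. a x * delta X x0 x f)" "finite S" "S \<subseteq> X"
    using assms(1) unfolding delta_span_def by blast
  obtain T b where 2: "\<psi> = (\<lambda>f. \<Sum>x\<in>T. b x * delta X x0 x f)" "finite T" "T \<subseteq> X"
    using assms(2) unfolding delta_span_def by blast
  let ?a = "\<lambda>x. if x \<in> S then a x else 0" and ?b = "\<lambda>x. if x \<in> T then b x else 0"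
  have "(\<Sum>x\<in>S. a x * delta X x0 x f) = (\<Sum>x\<in>S \<union> T. ?a x * delta X x0 x f)" for f
    using 1 2 by (intro sum.mono_neutral_cong_left) auto
  moreover have "(\<Sum>x\<in>T. b x * delta X x0 x f) = (\<Sum>x\<in>S \<union> T. ?b x * delta X x0 x f)" for f
    using 1 2 by (intro sum.mono_neutral_cong_left) auto
  ultimately have "(\<lambda>f. \<phi> f + \<psi> f) = (\<lambda>f. \<Sum>x\<in>S \<union> T. (?a x + ?b x) * delta X x0 x f)"
    unfolding 1 2 by (simp only: sum.distrib distrib_right)
  then show ?thesis unfolding delta_span_def using 1 2
    by (intro CollectI exI[of _ "S \<union> T"] exI[of _ "\<lambda>x. ?a x + ?b x"]) auto
qed

lemma delta_span_sum:
  "(\<And>i. i \<in> I \<Longrightarrow> \<phi> i \<in> delta_span X x0) \<Longrightarrow> (\<lambda>f. \<Sum>i\<in>I. \<phi> i f) \<in> delta_span X x0"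
  by (induction I rule: infinite_finite_induct) (auto intro: delta_span_zero delta_span_add)

lemma delta_span_diff:
  assumes "\<phi> \<in> delta_span X x0" "\<psi> \<in> delta_span X x0"
  shows "(\<lambda>f. \<phi> f - \<psi> f) \<in> delta_span X x0"
  using delta_span_add[OF assms(1) delta_span_scale[OF assms(2), of "- 1"]] by simp

text \<open>Evaluation at \<open>x\<close> is bounded because \<open>f x = f x - f x0\<close>; the corner embedding compares this difference with the
\<open>n\<close>-th amplification.\<close>

lemma Lip_eval_bound:
  assumes f: "f \<in> Lip" and x: "x \<in> X"
  shows "norm (f x) \<le> opdist x x0 * lip_mnorm n X 1 (\<lambda>_ _. f)"
proof -
  let ?e = "\<lambda>(i::nat) (p::nat). if i = 0 \<and> p = 0 then 1 else 0 :: complex"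
  have fm: "(\<lambda>_ _. f) \<in> mats 1 Lip" using f by (simp add: mats_def)
  have t: "hs_norm n 1 ?e = 1"
  proof -
    have "(\<Sum>i<n. \<Sum>p<1. (norm (?e i p))\<^sup>2) = (\<Sum>i<n. (norm (?e i 0))\<^sup>2)" by simp
    also have "\<dots> = (\<Sum>i<n. if i = 0 then 1 else 0)" by (intro sum.cong) auto
    finally show ?thesis using size_pos by (simp add: hs_norm_def)
  qed
  have inner: "(\<Sum>j<n. ?e i 0 * (f (corner x i j) - f (corner x0 i j)) * ?e j 0)
      = (if i = 0 then f x - f x0 else 0)" for i
  proof -
    have "(\<Sum>j<n. ?e i 0 * (f (corner x i j) - f (corner x0 i j)) * ?e j 0)
      = (\<Sum>j<n. if j = 0 then (if i = 0 then f x - f x0 else 0) else 0)"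
      by (intro sum.cong) (auto simp: corner_def)
    then show ?thesis using size_pos by simp
  qed
  have "(\<Sum>i<n. \<Sum>p<1. \<Sum>j<n. \<Sum>q<1. ?e i p * (f (corner x i j) - f (corner x0 i j)) * ?e j q)
      = (\<Sum>i<n. \<Sum>j<n. ?e i 0 * (f (corner x i j) - f (corner x0 i j)) * ?e j 0)" by simp
  also have "\<dots> = (\<Sum>i<n. if i = 0 then f x - f x0 else 0)" unfolding inner ..
  also have "\<dots> = f x" using size_pos f by (simp add: lip0_def)
  finally have "norm (f x) \<le> lip_mnorm n X 1 (\<lambda>_ _. f) * matdist (corner x) (corner x0) * hs_norm n 1 ?e * hs_norm n 1 ?e"
    using lip_mnorm_form[OF fm corner_mats[OF x] corner_mats[OF base], of ?e ?e] by simp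
  also have "\<dots> \<le> lip_mnorm n X 1 (\<lambda>_ _. f) * opdist x x0"
    unfolding t using matdist_corner[OF x base] lip_mnorm_nonneg[OF fm] by (simp add: mult_left_mono)
  finally show ?thesis by (simp add: mult.commute)
qed

lemma delta_cdual:
  assumes "x \<in> X"
  shows "delta X x0 x \<in> cdual Lip (lip_mnorm n X)"
  unfolding cdual_def
  using Lip_eval_bound assms by (auto simp: delta_def add_Lip scale_Lip intro!: exI[of _ "opdist x x0"])

lemma delta_span_cdual:
  assumes "\<phi> \<in> delta_span X x0"
  shows "\<phi> \<in> cdual Lip (lip_mnorm n X)"
proof -
  obtain S a where \<phi>: "\<phi> = (\<lambda>f. \<Sum>x\<in>S. a x * delta X x0 x f)" "finite S" "S \<subseteq> X"
    using assms unfolding delta_span_def by blast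
  have d: "delta X x0 x \<in> cdual Lip (lip_mnorm n X)" if "x \<in> S" for x using \<phi> that by (auto intro: delta_cdual)
  show ?thesis unfolding cdual_def
  proof (intro CollectI conjI ballI allI impI)
    fix f g assume "f \<in> Lip" "g \<in> Lip"
    then show "\<phi> (\<lambda>x. f x + g x) = \<phi> f + \<phi> g"
      unfolding \<phi> by (simp add: delta_def add_Lip sum.distrib distrib_left)
  next
    fix c f assume "f \<in> Lip"
    then show "\<phi> (\<lambda>x. c * f x) = c * \<phi> f"
      unfolding \<phi> by (simp add: delta_def scale_Lip sum_distrib_left mult_ac)
  next
    have "norm (\<phi> f) \<le> (\<Sum>x\<in>S. norm (a x) * opdist x x0) * lip_mnorm n X 1 (\<lambda>_ _. f)" if f: "f \<in> Lip" for f
      unfolding \<phi> sum_distrib_right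
    proof (rule sum_norm_le)
      fix x assume "x \<in> S"
      then have "norm (f x) \<le> opdist x x0 * lip_mnorm n X 1 (\<lambda>_ _. f)" using Lip_eval_bound f \<phi> by blast
      then have "norm (a x) * norm (f x) \<le> norm (a x) * (opdist x x0 * lip_mnorm n X 1 (\<lambda>_ _. f))"
        by (intro mult_left_mono) auto
      then show "norm (a x * delta X x0 x f) \<le> norm (a x) * opdist x x0 * lip_mnorm n X 1 (\<lambda>_ _. f)"
        using f by (simp add: delta_def norm_mult mult.assoc)
    qed
    then show "\<exists>K. \<forall>f\<in>Lip. norm (\<phi> f) \<le> K * lip_mnorm n X 1 (\<lambda>_ _. f)" by blast
  next
    fix f assume "f \<notin> Lip"
    then show "\<phi> f = 0" unfolding \<phi> by (simp add: delta_def)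
  qed
qed

end

section \<open>The norm is at most the cost of a representation\<close>

context pointed_operators
begin

lemma opdist_triangle:
  assumes "x \<in> X" "y \<in> X" "z \<in> X"
  shows "opdist x z \<le> opdist x y + opdist y z"
  using onorm_triangle[OF bounded_diff[OF assms(1,2)] bounded_diff[OF assms(2,3)]] by simp

lemma opdist_commute: "opdist x y = opdist y x"
  by (simp add: onorm_def norm_minus_commute)

text \<open>The distance from \<open>y\<close> is a function in the unit ball, up to the factor by which \<open>n\<close>-th amplification can
increase a Lipschitz constant, and it detects the distance of \<open>x\<close> and \<open>y\<close>.\<close>

lemma distance_function:
  assumes x: "x \<in> X" and y: "y \<in> X"
  obtains f where "f \<in> Lip" "lip_mnorm n X 1 (\<lambda>_ _. f) \<le> 1" "norm (f x - f y) = opdist x y / (real n * real n)"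
proof -
  define N where "N = real n * real n"
  have N: "0 < N" using size_pos by (simp add: N_def)
  \<comment> \<open>the distance from \<open>y\<close>, shifted to vanish at the base point; there are \<open>n * n\<close> entries\<close>
  define f where "f w = (if w \<in> X then complex_of_real ((opdist w y - opdist x0 y) / N) else 0)" for w
  have diff: "norm (f w - f w') \<le> 1 / N * opdist w w'" if w: "w \<in> X" "w' \<in> X" for w w'
  proof -
    have "f w - f w' = complex_of_real ((opdist w y - opdist w' y) / N)"
      using w by (simp add: f_def diff_divide_distrib)
    moreover have "\<bar>opdist w y - opdist w' y\<bar> \<le> opdist w w'"
      using opdist_triangle[of w w' y] opdist_triangle[of w' w y] opdist_commute[of w w'] w y by simp
    ultimately show ?thesis using N by (simp add: norm_of_real divide_right_mono del: of_real_divide of_real_diff)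
  qed
  have fL: "f \<in> Lip"
    unfolding lip0_def using diff base by (auto simp: f_def intro!: exI[of _ "1 / N"])
  have "lip_mnorm n X 1 (\<lambda>_ _. f) \<le> 1"
  proof (rule lip_mnorm_least)
    fix x y and u v :: "complex matrix" assume xy: "x \<in> mats n X" "y \<in> mats n X"
    have "norm (f (x i j) - f (y i j)) \<le> matdist x y / N" if "i < n" "j < n" for i j
    proof -
      have "norm (f (x i j) - f (y i j)) \<le> 1 / N * opdist (x i j) (y i j)"
        by (rule diff) (use xy that in \<open>auto simp: mats_def\<close>)
      also have "\<dots> \<le> 1 / N * matdist x y"
        using N xy that by (intro mult_left_mono opdist_le_matdist) auto
      finally show ?thesis by simp
    qed
    then have "norm (\<Sum>i<n. \<Sum>p<1. \<Sum>j<n. \<Sum>q<1. u i p * (f (x i j) - f (y i j)) * v j q)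
      \<le> (\<Sum>i<n. \<Sum>p<1::nat. \<Sum>j<n. \<Sum>q<1::nat. matdist x y / N) * hs_norm n 1 u * hs_norm n 1 v"
      by (intro crude_form_bound) auto
    also have "(\<Sum>i<n. \<Sum>p<1::nat. \<Sum>j<n. \<Sum>q<1::nat. matdist x y / N) = 1 * matdist x y"
      using size_pos by (simp add: N_def)
    finally show "norm (\<Sum>i<n. \<Sum>p<1. \<Sum>j<n. \<Sum>q<1. u i p * (f (x i j) - f (y i j)) * v j q)
      \<le> 1 * matdist x y * hs_norm n 1 u * hs_norm n 1 v" .
  qed simp
  moreover have "norm (f x - f y) = opdist x y / N"
  proof -
    have "f x - f y = complex_of_real (opdist x y / N)"
      using x y by (simp add: f_def diff_divide_distrib onorm_zero)
    then show ?thesis using opdist_nonneg[OF x y] N by (simp add: norm_of_real del: of_real_divide)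
  qed
  ultimately show thesis using that[of f] fL by (simp only: N_def)
qed

lemma mats_delta_span_bounded:
  assumes "\<And>i j. i < m \<Longrightarrow> j < m \<Longrightarrow> \<phi> i j \<in> delta_span X x0"
  shows "\<exists>C. dual_bound m \<phi> C"
  by (rule mats_cdual_dual_bound) (use assms delta_span_cdual in \<open>auto simp: mats_def\<close>)

lemma flat_delta_span:
  assumes "\<And>p q. D p q \<in> mats n (delta_span X x0)"
  shows "flat n D s t \<in> delta_span X x0"
  using assms[of "s div n" "t div n"] size_pos by (auto simp: flat_def mats_def)

lemma dual_bound_entry:
  assumes \<phi>: "dual_bound m \<phi> C" and ij: "i < m" "j < m" and f: "f \<in> Lip" "lip_mnorm n X 1 (\<lambda>_ _. f) \<le> 1"
  shows "norm (\<phi> i j f) \<le> C"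
proof -
  let ?e = "\<lambda>i (p::nat) i'. if i' = i then 1 else 0 :: complex"
  have t: "hs_norm 1 m (?e i) = 1" if "i < m" for i :: nat
  proof -
    have "(\<Sum>i'<m. (norm (?e i 0 i'))\<^sup>2) = (\<Sum>i'<m. if i' = i then 1 else 0)" by (intro sum.cong) auto
    then show ?thesis using that by (simp add: hs_norm_def)
  qed
  have inner: "(\<Sum>j'<m. ?e i 0 i' * \<phi> i' j' f * ?e j 0 j') = (if i' = i then \<phi> i j f else 0)" for i'
  proof -
    have "(\<Sum>j'<m. ?e i 0 i' * \<phi> i' j' f * ?e j 0 j')
      = (\<Sum>j'<m. if j' = j then (if i' = i then \<phi> i j f else 0) else 0)" by (intro sum.cong) auto
    then show ?thesis using ij by simp
  qed
  have "pairing 1 m \<phi> (\<lambda>_ _. f) (?e i) (?e j) = (\<Sum>i'<m. \<Sum>j'<m. ?e i 0 i' * \<phi> i' j' f * ?e j 0 j')"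
    unfolding pairing_def by simp
  also have "\<dots> = \<phi> i j f" unfolding inner using ij by simp
  finally have eq: "pairing 1 m \<phi> (\<lambda>_ _. f) (?e i) (?e j) = \<phi> i j f" .
  have "norm (pairing 1 m \<phi> (\<lambda>_ _. f) (?e i) (?e j)) \<le> C * hs_norm 1 m (?e i) * hs_norm 1 m (?e j)"
    using \<phi> f unfolding dual_bound_def by (auto simp: mats_def)
  then show ?thesis unfolding eq t[OF ij(1)] t[OF ij(2)] by simp
qed

text \<open>The supremum in the cost is a supremum of reals, so it has to be known that the set is bounded. This follows from
the boundedness of \<open>D\<close>, with a constant depending on \<open>n\<close>: testing an entry of a block with the distance
function bounds the distances of the entries of \<open>x l\<close> and \<open>y l\<close>.\<close>

lemma diagonal_entries_bounded:
  assumes D: "D \<in> block_mats_inf n X x0" and diag: "is_delta_diagonal n X x0 D c x y"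
  shows "bdd_above (range (\<lambda>l. norm (c l) * matdist (x l) (y l)))"
proof -
  have Dm: "\<And>p q. D p q \<in> mats n (delta_span X x0)" using D unfolding block_mats_inf_def by blast
  obtain K where K: "\<And>r. free_mnorm n X x0 (r * n) (flat n D) \<le> K"
    using D unfolding block_mats_inf_def bdd_above_def by blast
  define N where "N = real n * real n"
  have N: "0 < N" using size_pos by (simp add: N_def)
  have xy: "x l \<in> mats n X" "y l \<in> mats n X" for l using diag unfolding is_delta_diagonal_def by auto
  have entry: "norm (c l) * opdist (x l i j) (y l i j) \<le> N * K" if ij: "i < n" "j < n" for l i j
  proof -
    have X: "x l i j \<in> X" "y l i j \<in> X" using xy[of l] ij by (auto simp: mats_def)
    obtain f where f: "f \<in> Lip" "lip_mnorm n X 1 (\<lambda>_ _. f) \<le> 1"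
      "norm (f (x l i j) - f (y l i j)) = opdist (x l i j) (y l i j) / N"
      unfolding N_def by (rule distance_function[OF X]) blast
    have "\<exists>C. dual_bound (Suc l * n) (flat n D) C"
      by (rule mats_delta_span_bounded) (rule flat_delta_span[OF Dm])
    then have "dual_bound (Suc l * n) (flat n D) (free_mnorm n X x0 (Suc l * n) (flat n D))"
      using dual_bound_free_mnorm by blast
    then have b: "dual_bound (Suc l * n) (flat n D) K" by (rule dual_bound_mono) (rule K)
    have "flat n D (l * n + i) (l * n + j) f = c l * (f (x l i j) - f (y l i j))"
      using diag ij f unfolding is_delta_diagonal_def by (simp add: flat_def delta_def)
    then have "norm (c l) * norm (f (x l i j) - f (y l i j)) \<le> K"
      using dual_bound_entry[OF b _ _ f(1,2), of "l * n + i" "l * n + j"] ij by (simp add: norm_mult)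
    then show ?thesis unfolding f(3) using N by (simp add: field_simps)
  qed
  show ?thesis
  proof (rule bdd_aboveI2)
    fix l
    have "norm (c l) * matdist (x l) (y l) \<le> norm (c l) * (\<Sum>i<n. \<Sum>j<n. opdist (x l i j) (y l i j))"
      by (intro mult_left_mono matdist_le_sum xy) simp
    also have "\<dots> \<le> (\<Sum>i<n. \<Sum>j<n. N * K)"
      unfolding sum_distrib_left by (intro sum_mono entry) auto
    finally show "norm (c l) * matdist (x l) (y l) \<le> (\<Sum>i<n. \<Sum>j<n. N * K)" .
  qed
qed

text \<open>The truncations of \<open>D\<close> are products of \<open>D\<close> with two identity matrices.\<close>

lemma block_mats_of_diagonal:
  assumes diag: "is_delta_diagonal n X x0 D c x y"
    and \<sigma>: "\<And>l. norm (c l) * matdist (x l) (y l) \<le> \<sigma>"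
  shows "D \<in> block_mats_inf n X x0"
proof -
  have xy: "x l \<in> mats n X" "y l \<in> mats n X" for l using diag unfolding is_delta_diagonal_def by auto
  have 0: "0 \<le> \<sigma>" using order_trans[OF mult_nonneg_nonneg[OF norm_ge_zero matdist_nonneg[OF xy]] \<sigma>] .
  have "D p q \<in> mats n (delta_span X x0)" for p q
  proof -
    have "D p q i j \<in> delta_span X x0" if ij: "i < n" "j < n" for i j
    proof -
      have "x p i j \<in> X" "y p i j \<in> X" using xy[of p] ij by (auto simp: mats_def)
      then have "(\<lambda>f. c p * (delta X x0 (x p i j) f - delta X x0 (y p i j) f)) \<in> delta_span X x0"
        by (intro delta_span_scale delta_span_diff delta_span_delta)
      then show ?thesis using diag ij delta_span_zero unfolding is_delta_diagonal_def by (cases "p = q") simp_all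
    qed
    then show ?thesis by (simp add: mats_def)
  qed
  moreover have "free_mnorm n X x0 (r * n) (flat n D) \<le> \<sigma>" for r
  proof -
    let ?I = "\<lambda>i s. if i = s then 1 else 0 :: complex"
    have vI: "vnorm (r * n) (\<lambda>s. \<Sum>i<r * n. \<xi> i * ?I i s) \<le> 1 * vnorm (r * n) \<xi>" for \<xi>
    proof -
      have "(\<Sum>i<r * n. \<xi> i * ?I i s) = \<xi> s" if "s < r * n" for s
      proof -
        have "(\<Sum>i<r * n. \<xi> i * ?I i s) = (\<Sum>i<r * n. if i = s then \<xi> s else 0)" by (intro sum.cong) auto
        then show ?thesis using that by simp
      qed
      then have "vnorm (r * n) (\<lambda>s. \<Sum>i<r * n. \<xi> i * ?I i s) = vnorm (r * n) \<xi>"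
        by (intro L2_set_cong refl) (simp only: lessThan_iff)
      then show ?thesis by simp
    qed
    have vI': "vnorm (r * n) (\<lambda>s. \<Sum>i<r * n. \<xi> i * ?I s i) \<le> 1 * vnorm (r * n) \<xi>" for \<xi>
      using vI[of \<xi>] by (simp only: eq_commute)
    have eq: "trunc_prod n r ?I D ?I i j f = flat n D i j f" if ij: "i < r * n" "j < r * n" for i j f
    proof -
      have "trunc_prod n r ?I D ?I i j f
        = (\<Sum>s<r * n. if s = i then (\<Sum>t<r * n. flat n D i t f * ?I t j) else 0)"
        unfolding trunc_prod_def by (rule sum.cong[OF refl]) simp
      also have "\<dots> = (\<Sum>t<r * n. flat n D i t f * ?I t j)" using ij by simp
      also have "\<dots> = (\<Sum>t<r * n. if t = j then flat n D i j f else 0)"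
        by (rule sum.cong[OF refl]) simp
      also have "\<dots> = flat n D i j f" using ij by simp
      finally show ?thesis .
    qed
    have "dual_bound (r * n) (trunc_prod n r ?I D ?I) (\<sigma> * 1 * 1)"
      by (rule trunc_prod_bound[OF diag \<sigma> 0 zero_le_one zero_le_one vI vI'])
    then have "dual_bound (r * n) (flat n D) (\<sigma> * 1 * 1)"
      by (rule iffD1[OF dual_bound_cong, rotated]) (rule eq)
    from free_mnorm_least[OF this] show ?thesis by simp
  qed
  ultimately show ?thesis unfolding block_mats_inf_def by (auto intro!: bdd_aboveI2)
qed

text \<open>The norms of the truncated products are at most the cost, and the truncated products converge to \<open>\<mu>\<close>.\<close>

lemma free_mnorm_le_cost:
  assumes \<mu>: "\<mu> \<in> mats m (lip_free n X x0)" and \<alpha>: "\<alpha> \<in> row_mats_inf m" and \<beta>: "\<beta> \<in> col_mats_inf m"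
    and D: "D \<in> block_mats_inf n X x0" and diag: "is_delta_diagonal n X x0 D c x y"
    and prod: "is_product n X x0 m \<mu> \<alpha> D \<beta>"
  shows "free_mnorm n X x0 m \<mu> \<le> row_norm_inf m \<alpha> * col_norm_inf m \<beta> * (SUP l. norm (c l) * matdist (x l) (y l))"
proof -
  let ?\<sigma> = "SUP l. norm (c l) * matdist (x l) (y l)"
  have xy: "x l \<in> mats n X" "y l \<in> mats n X" for l using diag unfolding is_delta_diagonal_def by auto
  have \<sigma>: "norm (c l) * matdist (x l) (y l) \<le> ?\<sigma>" for l
    by (rule cSUP_upper[OF UNIV_I diagonal_entries_bounded[OF D diag]])
  have \<sigma>0: "0 \<le> ?\<sigma>" using order_trans[OF mult_nonneg_nonneg[OF norm_ge_zero matdist_nonneg[OF xy]] \<sigma>] .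
  have A: "cmat_norm m N \<alpha> \<le> row_norm_inf m \<alpha>" for N
    unfolding row_norm_inf_def using \<alpha> by (intro cSUP_upper) (auto simp: row_mats_inf_def)
  have B: "cmat_norm N m \<beta> \<le> col_norm_inf m \<beta>" for N
    unfolding col_norm_inf_def using \<beta> by (intro cSUP_upper) (auto simp: col_mats_inf_def)
  have A0: "0 \<le> row_norm_inf m \<alpha>" and B0: "0 \<le> col_norm_inf m \<beta>"
    using order_trans[OF cmat_norm_nonneg A] order_trans[OF cmat_norm_nonneg B] by auto
  have a: "vnorm N (\<lambda>s. \<Sum>i<m. \<xi> i * \<alpha> i s) \<le> row_norm_inf m \<alpha> * vnorm m \<xi>" for N \<xi>
    by (rule order_trans[OF row_bound]) (intro mult_right_mono A; simp)
  have b: "vnorm N (\<lambda>s. \<Sum>i<m. \<xi> i * \<beta> s i) \<le> col_norm_inf m \<beta> * vnorm m \<xi>" for N \<xi>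
  proof -
    have "vnorm N (\<lambda>s. \<Sum>i<m. \<xi> i * \<beta> s i) = vnorm N (\<lambda>s. \<Sum>i<m. \<beta> s i * \<xi> i)" by (simp only: mult.commute)
    also have "\<dots> \<le> cmat_norm N m \<beta> * vnorm m \<xi>" by (rule cmat_norm_bound)
    also have "\<dots> \<le> col_norm_inf m \<beta> * vnorm m \<xi>" by (intro mult_right_mono B) simp
    finally show ?thesis .
  qed
  define T where "T r = trunc_prod n r \<alpha> D \<beta>" for r
  define e where "e r = free_mnorm n X x0 m (\<lambda>i j f. \<mu> i j f - T r i j f)" for r
  have T: "dual_bound m (T r) (?\<sigma> * row_norm_inf m \<alpha> * col_norm_inf m \<beta>)" for r
    unfolding T_def by (rule trunc_prod_bound[OF diag \<sigma> \<sigma>0 A0 B0 a b])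
  have "\<mu> \<in> mats m (cdual Lip (lip_mnorm n X))" using \<mu> unfolding mats_def lip_free_def by blast
  then obtain M where M: "dual_bound m \<mu> M" using mats_cdual_dual_bound by blast
  have "free_mnorm n X x0 m \<mu> \<le> ?\<sigma> * row_norm_inf m \<alpha> * col_norm_inf m \<beta> + e r" for r
  proof -
    have "dual_bound m (\<lambda>i j f. \<mu> i j f - T r i j f) (e r)"
      unfolding e_def by (rule dual_bound_free_mnorm[OF dual_bound_diff[OF M T]])
    from free_mnorm_least[OF dual_bound_add[OF T[of r] this]] show ?thesis by simp
  qed
  moreover have "(\<lambda>r. ?\<sigma> * row_norm_inf m \<alpha> * col_norm_inf m \<beta> + e r) \<longlonglongrightarrow> ?\<sigma> * row_norm_inf m \<alpha> * col_norm_inf m \<beta> + 0"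
    using prod unfolding is_product_def e_def T_def by (intro tendsto_add tendsto_const)
  ultimately have "free_mnorm n X x0 m \<mu> \<le> ?\<sigma> * row_norm_inf m \<alpha> * col_norm_inf m \<beta> + 0"
    by (intro LIMSEQ_le_const[where X = "\<lambda>r. ?\<sigma> * row_norm_inf m \<alpha> * col_norm_inf m \<beta> + e r"]) auto
  then show ?thesis by (simp add: mult_ac)
qed

end

section \<open>From positive forms to matrix-valued Lipschitz maps\<close>

text \<open>Only the hermitian part of \<open>A\<close> enters, so that positivity makes sense for any \<open>A\<close>.\<close>

definition qform :: "nat \<Rightarrow> complex matrix \<Rightarrow> (nat \<Rightarrow> complex) \<Rightarrow> real" where
  "qform m A a = Re (\<Sum>i<m. \<Sum>j<m. A i j * (a i * cnj (a j)))"

lemma unit_phase: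
  obtains \<theta> where "norm \<theta> = 1" "\<theta> * z = complex_of_real (norm z)"
proof (cases "z = 0")
  case True
  then show thesis using that[of 1] by simp
next
  case False
  have "cnj z * z = complex_of_real (norm z) * complex_of_real (norm z)"
    by (metis complex_norm_square mult.commute of_real_mult power2_eq_square)
  then show thesis using that[of "cnj z / norm z"] False by (simp add: norm_divide)
qed

text \<open>Multiplying \<open>u\<close> by a phase and rescaling \<open>u\<close> and \<open>v\<close> to the same norm turns the arithmetic mean into the
geometric one.\<close>

lemma Re_bilinear_bound:
  fixes A :: "nat \<Rightarrow> nat \<Rightarrow> nat \<Rightarrow> nat \<Rightarrow> complex"
  assumes M: "0 \<le> M"
    and re: "\<And>u v. Re (block_form n m A u v)
      \<le> M * ((hs_norm n m u)\<^sup>2 + (hs_norm n m v)\<^sup>2)"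
  shows "norm (block_form n m A u v) \<le> 2 * M * hs_norm n m u * hs_norm n m v"
proof -
  let ?b = "\<lambda>u v. block_form n m A u v"
  have zero: "w s p = 0" if "hs_norm n m w = 0" "s < n" "p < m" for w :: "complex matrix" and s p
    using hs_norm_component[of s n p m w] that by simp
  have scale: "?b (\<lambda>s p. a * u s p) (\<lambda>t q. b * v t q) = a * b * ?b u v" for a b
    unfolding sum_distrib_left by (intro sum.cong refl) simp
  have tn: "hs_norm n m (\<lambda>s p. a * w s p) = norm a * hs_norm n m w" for a w
    unfolding hs_norm_def norm_mult power_mult_distrib sum_distrib_left[symmetric] real_sqrt_mult by simp
  consider "hs_norm n m u = 0 \<or> hs_norm n m v = 0" | "0 < hs_norm n m u" "0 < hs_norm n m v"
    by (metis less_eq_real_def hs_norm_nonneg)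
  then show ?thesis
  proof cases
    case 1
    then have "?b u v = 0" using zero by (auto intro!: sum.neutral)
    then show ?thesis using 1 by auto
  next
    case 2
    define z where "z = ?b u v"
    obtain \<theta> where \<theta>: "norm \<theta> = 1" "\<theta> * z = complex_of_real (norm z)" by (rule unit_phase)
    let ?U = "hs_norm n m u" and ?V = "hs_norm n m v"
    \<comment> \<open>both vectors now have the norm \<open>?U * ?V\<close>\<close>
    have "?b (\<lambda>s p. (\<theta> * of_real ?V) * u s p) (\<lambda>t q. of_real ?U * v t q) = of_real (?U * ?V * norm z)"
      unfolding scale z_def[symmetric] using \<theta>(2) by (simp add: mult_ac)
    then have "?U * ?V * norm z \<le> M * ((hs_norm n m (\<lambda>s p. (\<theta> * of_real ?V) * u s p))\<^sup>2 + (hs_norm n m (\<lambda>t q. of_real ?U * v t q))\<^sup>2)"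
      using re[of "\<lambda>s p. (\<theta> * of_real ?V) * u s p" "\<lambda>t q. of_real ?U * v t q"] by (metis Re_complex_of_real)
    also have "\<dots> = (?U * ?V) * (2 * M * ?U * ?V)"
      unfolding tn norm_mult \<theta> by (simp add: power2_eq_square algebra_simps)
    finally have "norm z \<le> 2 * M * ?U * ?V" using 2 by (simp add: mult_le_cancel_left_pos)
    then show ?thesis unfolding z_def .
  qed
qed

text \<open>Applying the hypothesis on \<open>S\<close> to the columns of \<open>R\<close> evaluates \<open>P\<close> on the unit vectors.\<close>

lemma hs_norm_of_factor:
  assumes SR: "\<And>i k. i < m \<Longrightarrow> k < m \<Longrightarrow> (\<Sum>l<m. S i l * R l k) = (if i = k then 1 else 0 :: complex)"
    and S: "\<And>c. qform m P (\<lambda>i. \<Sum>k<m. S i k * c k) = sqnorm m c"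
  shows "(hs_norm m m R)\<^sup>2 = Re (\<Sum>i<m. P i i)"
proof -
  have "(\<Sum>k<m. (norm (R k i))\<^sup>2) = Re (P i i)" if i: "i < m" for i
  proof -
    have "(\<Sum>k<m. (norm (R k i))\<^sup>2) = qform m P (\<lambda>i'. \<Sum>k<m. S i' k * R k i)" using S ..
    also have "\<dots> = Re (\<Sum>i'<m. \<Sum>j<m. P i' j * ((if i' = i then 1 else 0) * cnj (if j = i then 1 else 0)))"
      unfolding qform_def using SR i by (intro arg_cong[of _ _ Re] sum.cong refl) simp
    also have "(\<Sum>i'<m. \<Sum>j<m. P i' j * ((if i' = i then 1 else 0) * cnj (if j = i then 1 else 0)))
      = (\<Sum>i'<m. if i' = i then P i i else 0)"
    proof (rule sum.cong[OF refl])
      fix i'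
      have "(\<Sum>j<m. P i' j * ((if i' = i then 1 else 0) * cnj (if j = i then 1 else 0)))
        = (\<Sum>j<m. if j = i then (if i' = i then P i i else 0) else 0)" by (rule sum.cong[OF refl]) auto
      then show "(\<Sum>j<m. P i' j * ((if i' = i then 1 else 0) * cnj (if j = i then 1 else 0)))
        = (if i' = i then P i i else 0)" using i by simp
    qed
    finally show ?thesis using i by simp
  qed
  then have "(\<Sum>i<m. \<Sum>k<m. (norm (R k i))\<^sup>2) = (\<Sum>i<m. Re (P i i))" by simp
  moreover have "(hs_norm m m R)\<^sup>2 = (\<Sum>i<m. \<Sum>k<m. (norm (R k i))\<^sup>2)" unfolding hs_norm_sq by (rule sum.swap)
  ultimately show ?thesis by simp
qed

context pointed_operators
begin

text \<open>The pairing of \<open>g\<close> with \<open>a (\<delta>(x) - \<delta>(y)) b\<close>.\<close>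

abbreviation sandwich :: "nat \<Rightarrow> complex matrix \<Rightarrow> (nat \<Rightarrow> nat \<Rightarrow> ('h \<Rightarrow> 'h) \<Rightarrow> complex) \<Rightarrow>
    ('h \<Rightarrow> 'h) matrix \<Rightarrow> ('h \<Rightarrow> 'h) matrix \<Rightarrow> complex matrix \<Rightarrow> complex" where
  "sandwich m a g x y b \<equiv> \<Sum>s<n. \<Sum>t<n. \<Sum>i<m. \<Sum>j<m. a i s * (g i j (x s t) - g i j (y s t)) * b j t"

abbreviation energy :: "nat \<Rightarrow> complex matrix \<Rightarrow> complex matrix \<Rightarrow> real" where
  "energy m P a \<equiv> \<Sum>s<n. qform m P (\<lambda>i. a i s)"

text \<open>The construction of the representing map in Ruan's theorem. With \<open>S\<close>, \<open>S'\<close> and inverses \<open>R\<close>, \<open>R'\<close> that bring \<open>P\<close>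
and \<open>Q\<close> to the standard form, \<open>f = S\<^sup>T g S'\<close> has Lipschitz constant at most 2, and \<open>g = R\<^sup>T f R'\<close> shows that the pairing of \<open>\<nu>\<close>
with \<open>g\<close> is the value of \<open>f\<close> on \<open>\<nu>\<close> between the vectors \<open>R\<close> and \<open>R'\<close>, whose squared norms are the traces of \<open>P\<close>
and \<open>Q\<close>.\<close>

lemma Lip_matrix_of_functional:
  assumes g: "\<And>i j. i < m \<Longrightarrow> j < m \<Longrightarrow> g i j \<in> Lip"
    and P: "\<And>a. (\<exists>i<m. a i \<noteq> 0) \<Longrightarrow> 0 < qform m P a" and Q: "\<And>a. (\<exists>i<m. a i \<noteq> 0) \<Longrightarrow> 0 < qform m Q a"
    and dom: "\<And>a b x y. x \<in> mats n X \<Longrightarrow> y \<in> mats n X \<Longrightarrow>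
      Re (sandwich m a g x y b)
        \<le> matdist x y * (energy m P a + energy m Q b)"
    and \<nu>: "\<And>i j. i < m \<Longrightarrow> j < m \<Longrightarrow> \<nu> i j \<in> delta_span X x0" and C: "dual_bound m \<nu> C" and m: "1 \<le> m"
  shows "Re (\<Sum>i<m. \<Sum>j<m. \<nu> i j (g i j)) \<le> C * (Re (\<Sum>i<m. P i i) + Re (\<Sum>i<m. Q i i))"
proof -
  obtain S R where SR: "\<And>i k. i < m \<Longrightarrow> k < m \<Longrightarrow> (\<Sum>l<m. S i l * R l k) = (if i = k then 1 else 0)"
    and S: "\<And>c. qform m P (\<lambda>i. \<Sum>k<m. S i k * c k) = sqnorm m c"
    using posdef_cholesky[of m P, folded qform_def, OF P] by blast
  obtain S' R' where SR': "\<And>i k. i < m \<Longrightarrow> k < m \<Longrightarrow> (\<Sum>l<m. S' i l * R' l k) = (if i = k then 1 else 0)"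
    and S': "\<And>c. qform m Q (\<lambda>i. \<Sum>k<m. S' i k * c k) = sqnorm m c"
    using posdef_cholesky[of m Q, folded qform_def, OF Q] by blast
  let ?Z = "{..<m} \<times> {..<m}"
  define f where "f k l x = (\<Sum>i<m. \<Sum>j<m. S i k * g i j x * S' j l)" for k l x
  have f_Z: "f k l = (\<lambda>x. \<Sum>z\<in>?Z. (S (fst z) k * S' (snd z) l) * g (fst z) (snd z) x)" for k l
    by (rule ext) (simp add: f_def sum.cartesian_product split_def mult_ac)
  have fL: "f k l \<in> Lip" for k l
    unfolding f_Z by (rule sum_Lip) (use g in auto)
  \<comment> \<open>The factor 1/2 compensates for the sum of two squares in the hypothesis.\<close>
  have fhm: "(\<lambda>p q x. (1 / 2) * f p q x) \<in> mats m Lip"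
    unfolding mats_def by (intro CollectI allI impI scale_Lip fL)
  have f_form: "norm (block_form n m (increment f x y) u v)
      \<le> 2 * matdist x y * hs_norm n m u * hs_norm n m v" if xy: "x \<in> mats n X" "y \<in> mats n X" for x y u v
  proof (rule Re_bilinear_bound[OF matdist_nonneg[OF xy]])
    fix u v :: "complex matrix"
    define d where "d i j s t = g i j (x s t) - g i j (y s t)" for i j s t
    have fd: "f p q (x s t) - f p q (y s t) = (\<Sum>z\<in>?Z. S (fst z) p * d (fst z) (snd z) s t * S' (snd z) q)" for p q s t
      unfolding f_Z d_def sum_subtractf[symmetric] by (rule sum.cong[OF refl]) (simp add: algebra_simps)
    have "block_form n m (increment f x y) u v
      = (\<Sum>s<n. \<Sum>t<n. \<Sum>p<m. \<Sum>q<m. u s p * (f p q (x s t) - f p q (y s t)) * v t q)"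
      by (rule sum.cong[OF refl], rule sum.swap)
    also have "\<dots> = (\<Sum>s<n. \<Sum>t<n. \<Sum>z\<in>?Z. (\<Sum>p<m. u s p * S (fst z) p) * d (fst z) (snd z) s t * (\<Sum>q<m. v t q * S' (snd z) q))"
      unfolding fd bilinear_expand ..
    also have "\<dots> = (\<Sum>s<n. \<Sum>t<n. \<Sum>i<m. \<Sum>j<m. (\<Sum>k<m. S i k * u s k) * (g i j (x s t) - g i j (y s t)) * (\<Sum>k<m. S' j k * v t k))"
      by (simp only: sum.cartesian_product split_def d_def mult.commute[of "u _ _"] mult.commute[of "v _ _"])
    finally have "Re (block_form n m (increment f x y) u v)
      \<le> matdist x y * ((\<Sum>s<n. qform m P (\<lambda>i. \<Sum>k<m. S i k * u s k)) + (\<Sum>t<n. qform m Q (\<lambda>j. \<Sum>k<m. S' j k * v t k)))"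
      using dom[OF xy, of "\<lambda>i s. \<Sum>k<m. S i k * u s k" "\<lambda>j t. \<Sum>k<m. S' j k * v t k"] by (simp only:)
    also have "\<dots> = matdist x y * ((hs_norm n m u)\<^sup>2 + (hs_norm n m v)\<^sup>2)" unfolding S S' hs_norm_sq ..
    finally show "Re (block_form n m (increment f x y) u v)
      \<le> matdist x y * ((hs_norm n m u)\<^sup>2 + (hs_norm n m v)\<^sup>2)" .
  qed
  have fh1: "lip_mnorm n X m (\<lambda>p q x. (1 / 2) * f p q x) \<le> 1"
  proof (rule lip_mnorm_least)
    fix x y and u v :: "complex matrix" assume xy: "x \<in> mats n X" "y \<in> mats n X"
    have "(\<Sum>i<n. \<Sum>p<m. \<Sum>j<n. \<Sum>q<m. u i p * ((1 / 2) * f p q (x i j) - (1 / 2) * f p q (y i j)) * v j q)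
      = (1 / 2) * block_form n m (increment f x y) u v"
      unfolding sum_distrib_left by (intro sum.cong refl) (simp add: algebra_simps)
    then have "norm (\<Sum>i<n. \<Sum>p<m. \<Sum>j<n. \<Sum>q<m. u i p * ((1 / 2) * f p q (x i j) - (1 / 2) * f p q (y i j)) * v j q)
      = (1 / 2) * norm (block_form n m (increment f x y) u v)"
      by (simp only: norm_mult) simp
    then show "norm (\<Sum>i<n. \<Sum>p<m. \<Sum>j<n. \<Sum>q<m. u i p * ((1 / 2) * f p q (x i j) - (1 / 2) * f p q (y i j)) * v j q)
      \<le> 1 * matdist x y * hs_norm n m u * hs_norm n m v"
      using f_form[OF xy, of u v] by simp
  qed simp
  have lin: "\<nu> i j (\<lambda>x. \<Sum>z\<in>I. c z * h z x) = (\<Sum>z\<in>I. c z * \<nu> i j (h z))"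
    if "i < m" "j < m" "finite I" "\<And>z. z \<in> I \<Longrightarrow> h z \<in> Lip" for i j I c and h :: "nat \<times> nat \<Rightarrow> ('h \<Rightarrow> 'h) \<Rightarrow> complex"
    by (rule cdual_sum[OF delta_span_cdual[OF \<nu>]]) (use that in auto)
  have half: "\<nu> i j (\<lambda>x. (1 / 2) * f p q x) = (1 / 2) * \<nu> i j (f p q)" if "i < m" "j < m" for i j p q
    using lin[OF that, of "{(0,0)}" "\<lambda>_. f p q" "\<lambda>_. 1 / 2"] fL by simp
  have expand: "\<nu> i j (g i j) = (\<Sum>p<m. \<Sum>q<m. R p i * \<nu> i j (f p q) * R' q j)" if ij: "i < m" "j < m" for i j
  proof -
    have "(\<Sum>p<m. \<Sum>q<m. R p i * \<nu> i j (f p q) * R' q j)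
      = (\<Sum>p<m. \<Sum>q<m. R p i * (\<Sum>z\<in>?Z. S (fst z) p * \<nu> i j (g (fst z) (snd z)) * S' (snd z) q) * R' q j)"
    proof (rule sum.cong[OF refl], rule sum.cong[OF refl])
      fix p q
      have "\<nu> i j (f p q) = (\<Sum>z\<in>?Z. (S (fst z) p * S' (snd z) q) * \<nu> i j (g (fst z) (snd z)))"
        unfolding f_Z by (rule lin[OF ij]) (use g in auto)
      also have "\<dots> = (\<Sum>z\<in>?Z. S (fst z) p * \<nu> i j (g (fst z) (snd z)) * S' (snd z) q)"
        by (rule sum.cong[OF refl]) (simp only: mult_ac)
      finally show "R p i * \<nu> i j (f p q) * R' q j
        = R p i * (\<Sum>z\<in>?Z. S (fst z) p * \<nu> i j (g (fst z) (snd z)) * S' (snd z) q) * R' q j" by (simp only:)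
    qed
    also have "\<dots> = (\<Sum>z\<in>?Z. (\<Sum>p<m. R p i * S (fst z) p) * \<nu> i j (g (fst z) (snd z)) * (\<Sum>q<m. R' q j * S' (snd z) q))"
      by (rule bilinear_expand)
    also have "\<dots> = (\<Sum>z\<in>?Z. if z = (i, j) then \<nu> i j (g i j) else 0)"
    proof (rule sum.cong[OF refl])
      fix z assume "z \<in> ?Z"
      then have z: "fst z < m" "snd z < m" by auto
      have "(\<Sum>p<m. R p i * S (fst z) p) = (if fst z = i then 1 else 0)"
        using SR[OF z(1) ij(1)] by (simp only: mult.commute[of "S _ _"])
      moreover have "(\<Sum>q<m. R' q j * S' (snd z) q) = (if snd z = j then 1 else 0)"
        using SR'[OF z(2) ij(2)] by (simp only: mult.commute[of "S' _ _"])
      ultimately show "(\<Sum>p<m. R p i * S (fst z) p) * \<nu> i j (g (fst z) (snd z)) * (\<Sum>q<m. R' q j * S' (snd z) q)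
        = (if z = (i, j) then \<nu> i j (g i j) else 0)" by (cases z) auto
    qed
    also have "\<dots> = \<nu> i j (g i j)" using ij by (subst sum.delta) auto
    finally show ?thesis ..
  qed
  have "pairing m m \<nu> (\<lambda>p q x. (1 / 2) * f p q x) R R'
    = (\<Sum>p<m. \<Sum>i<m. \<Sum>q<m. \<Sum>j<m. (1 / 2) * (R p i * \<nu> i j (f p q) * R' q j))"
    unfolding pairing_def by (intro sum.cong refl) (simp only: half lessThan_iff, simp only: mult_ac)
  also have "\<dots> = (\<Sum>i<m. \<Sum>p<m. \<Sum>q<m. \<Sum>j<m. (1 / 2) * (R p i * \<nu> i j (f p q) * R' q j))" by (rule sum.swap)
  also have "\<dots> = (\<Sum>i<m. \<Sum>p<m. \<Sum>j<m. \<Sum>q<m. (1 / 2) * (R p i * \<nu> i j (f p q) * R' q j))"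
    by (rule sum.cong[OF refl], rule sum.cong[OF refl], rule sum.swap)
  also have "\<dots> = (\<Sum>i<m. \<Sum>j<m. \<Sum>p<m. \<Sum>q<m. (1 / 2) * (R p i * \<nu> i j (f p q) * R' q j))"
    by (rule sum.cong[OF refl], rule sum.swap)
  also have "\<dots> = (1 / 2) * (\<Sum>i<m. \<Sum>j<m. \<nu> i j (g i j))"
    unfolding sum_distrib_left by (rule sum.cong[OF refl], rule sum.cong[OF refl]) (simp add: expand sum_distrib_left)
  finally have eq: "pairing m m \<nu> (\<lambda>p q x. (1 / 2) * f p q x) R R' = (1 / 2) * (\<Sum>i<m. \<Sum>j<m. \<nu> i j (g i j))" .
  have C0: "0 \<le> C" using C unfolding dual_bound_def by blast
  have "Re (\<Sum>i<m. \<Sum>j<m. \<nu> i j (g i j)) \<le> norm (\<Sum>i<m. \<Sum>j<m. \<nu> i j (g i j))" by (rule complex_Re_le_cmod)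
  also have "\<dots> = 2 * norm (pairing m m \<nu> (\<lambda>p q x. (1 / 2) * f p q x) R R')" unfolding eq norm_mult by simp
  also have "\<dots> \<le> 2 * (C * hs_norm m m R * hs_norm m m R')"
    using C m fhm fh1 unfolding dual_bound_def by (intro mult_left_mono) auto
  also have "\<dots> = C * (2 * hs_norm m m R * hs_norm m m R')" by simp
  also have "\<dots> \<le> C * ((hs_norm m m R)\<^sup>2 + (hs_norm m m R')\<^sup>2)"
    by (intro mult_left_mono sum_squares_bound C0)
  also have "(hs_norm m m R)\<^sup>2 = Re (\<Sum>i<m. P i i)"
    by (rule hs_norm_of_factor[where S = S]) (fact SR S)+
  also have "(hs_norm m m R')\<^sup>2 = Re (\<Sum>i<m. Q i i)"
    by (rule hs_norm_of_factor[where S = S']) (fact SR' S')+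
  finally show ?thesis .
qed

end

section \<open>The cone of representations\<close>

lemma qform_add: "qform m (A + B) \<xi> = qform m A \<xi> + qform m B \<xi>"
  by (simp add: qform_def distrib_right sum.distrib)

lemma qform_scaleR: "qform m (r *\<^sub>R A) \<xi> = r * qform m A \<xi>"
proof -
  have "(\<Sum>i<m. \<Sum>j<m. (r *\<^sub>R A) i j * (\<xi> i * cnj (\<xi> j))) = r *\<^sub>R (\<Sum>i<m. \<Sum>j<m. A i j * (\<xi> i * cnj (\<xi> j)))"
    unfolding scaleR_sum_right by (intro sum.cong refl) simp
  then show ?thesis unfolding qform_def by (simp only: scaleR_complex.sel)
qed

lemma qform_zero [simp]: "qform m 0 \<xi> = 0"
  by (simp add: qform_def)

text \<open>The form of \<open>a a\<^sup>*\<close>. It is here that the order in which \<open>qform\<close> conjugates matters: the right-hand side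
is the bilinear pairing with \<open>\<xi>\<close> that occurs in the norms of rows.\<close>

lemma qform_rank_one: "qform m (\<lambda>i j. a i * cnj (a j)) \<xi> = (norm (\<Sum>i<m. \<xi> i * a i))\<^sup>2"
proof -
  have "(\<Sum>i<m. \<Sum>j<m. a i * cnj (a j) * (\<xi> i * cnj (\<xi> j))) = (\<Sum>i<m. \<xi> i * a i) * cnj (\<Sum>i<m. \<xi> i * a i)"
    unfolding cnj_sum sum_product by (intro sum.cong refl) simp
  also have "\<dots> = complex_of_real ((norm (\<Sum>i<m. \<xi> i * a i))\<^sup>2)" by (rule complex_norm_square[symmetric])
  finally show ?thesis unfolding qform_def by (simp only: Re_complex_of_real)
qed

definition id_mat :: "complex matrix" where
  "id_mat i j = (if i = j then 1 else 0)"

lemma sum_id_mat: "(\<Sum>i<m. \<Sum>j<m. P i j * id_mat i j) = (\<Sum>i<m. P i i)" for P :: "complex matrix"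
proof -
  have "(\<Sum>j<m. P i j * id_mat i j) = P i i" if "i < m" for i
  proof -
    have "(\<Sum>j<m. P i j * id_mat i j) = (\<Sum>j<m. if j = i then P i i else 0)"
      by (rule sum.cong[OF refl]) (simp add: id_mat_def)
    then show ?thesis using that by simp
  qed
  then show ?thesis by (intro sum.cong refl) simp
qed

lemma qform_id_mat: "qform m id_mat \<xi> = sqnorm m \<xi>"
proof -
  have "(\<Sum>i<m. \<Sum>j<m. id_mat i j * (\<xi> i * cnj (\<xi> j))) = (\<Sum>i<m. \<xi> i * cnj (\<xi> i))"
    using sum_id_mat[where P = "\<lambda>i j. \<xi> i * cnj (\<xi> j)"] by (simp only: mult.commute[of "id_mat _ _"])
  also have "\<dots> = complex_of_real (sqnorm m \<xi>)"
    unfolding of_real_sum by (intro sum.cong refl complex_norm_square[symmetric])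
  finally show ?thesis unfolding qform_def by (simp only: Re_complex_of_real)
qed

lemma qform_lower_bound: "\<exists>t. \<forall>\<xi>. - t * sqnorm m \<xi> \<le> qform m A \<xi>"
proof (intro exI allI)
  fix \<xi> :: "nat \<Rightarrow> complex"
  have "norm (\<Sum>i<m. \<Sum>j<m. A i j * (\<xi> i * cnj (\<xi> j))) \<le> (\<Sum>i<m. \<Sum>j<m. norm (A i j) * (vnorm m \<xi> * vnorm m \<xi>))"
  proof (intro sum_norm_le)
    fix i j assume ij: "i \<in> {..<m}" "j \<in> {..<m}"
    have "norm (\<xi> i) * norm (\<xi> j) \<le> vnorm m \<xi> * vnorm m \<xi>"
      using ij by (intro mult_mono norm_component_le_vnorm) auto
    then show "norm (A i j * (\<xi> i * cnj (\<xi> j))) \<le> norm (A i j) * (vnorm m \<xi> * vnorm m \<xi>)"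
      by (simp add: norm_mult mult_left_mono)
  qed
  also have "\<dots> = (\<Sum>i<m. \<Sum>j<m. norm (A i j)) * (vnorm m \<xi> * vnorm m \<xi>)"
    by (simp only: sum_distrib_right)
  also have "vnorm m \<xi> * vnorm m \<xi> = sqnorm m \<xi>"
    using vnorm_sq[where m = m and v = \<xi>] by (simp only: power2_eq_square)
  finally have "norm (\<Sum>i<m. \<Sum>j<m. A i j * (\<xi> i * cnj (\<xi> j))) \<le> (\<Sum>i<m. \<Sum>j<m. norm (A i j)) * sqnorm m \<xi>" .
  then show "- (\<Sum>i<m. \<Sum>j<m. norm (A i j)) * sqnorm m \<xi> \<le> qform m A \<xi>"
    unfolding qform_def using abs_Re_le_cmod[of "\<Sum>i<m. \<Sum>j<m. A i j * (\<xi> i * cnj (\<xi> j))"] by linarith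
qed

definition unit_entry :: "nat \<Rightarrow> nat \<Rightarrow> 'a::zero \<Rightarrow> nat \<Rightarrow> nat \<Rightarrow> 'a" where
  "unit_entry i0 j0 c i j = (if i = i0 \<and> j = j0 then c else 0)"

lemma sum_unit_entry:
  fixes c :: "nat \<Rightarrow> nat \<Rightarrow> 'a::comm_monoid_add"
  assumes "i < m" "j < m"
  shows "(\<Sum>i0<m. \<Sum>j0<m. unit_entry i0 j0 (c i0 j0) i j) = c i j"
proof -
  have "(\<Sum>i0<m. \<Sum>j0<m. unit_entry i0 j0 (c i0 j0) i j)
    = (\<Sum>i0<m. if i0 = i then (\<Sum>j0<m. if j0 = j then c i j else 0) else 0)"
    by (rule sum.cong[OF refl]) (auto simp: unit_entry_def intro!: sum.cong sum.neutral)
  then show ?thesis using assms by simp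
qed

lemma additive_sum:
  assumes W: "subspace W" and add: "\<And>u v. u \<in> W \<Longrightarrow> v \<in> W \<Longrightarrow> F (u + v) = F u + F v"
    and scale: "\<And>r u. u \<in> W \<Longrightarrow> F (r *\<^sub>R u) = r * (F u :: real)" and u: "\<And>z. z \<in> Z \<Longrightarrow> u z \<in> W"
  shows "F (\<Sum>z\<in>Z. u z) = (\<Sum>z\<in>Z. F (u z))"
proof -
  have F0: "F 0 = 0" using scale[OF subspace_0[OF W], of 0] by simp
  show ?thesis using u
    by (induction Z rule: infinite_finite_induct) (simp_all add: F0 add subspace_sum[OF W])
qed

text \<open>A real-linear functional on the complex numbers is the real part of a complex-linear one.\<close>

lemma real_linear_complex_form:
  assumes add: "\<And>u v. F (u + v) = F u + F v" and scale: "\<And>r u. F (r *\<^sub>R u) = r * (F u :: real)"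
  shows "F z = Re (Complex (F 1) (- F \<i>) * z)"
proof -
  have "F z = F (Re z *\<^sub>R 1 + Im z *\<^sub>R \<i>)" by (intro arg_cong[of _ _ F]) (simp add: complex_eq_iff)
  also have "\<dots> = Re z * F 1 + Im z * F \<i>" by (simp only: add scale)
  finally show ?thesis by simp
qed

lemma matrix_functional:
  fixes F :: "complex matrix \<Rightarrow> real"
  assumes add: "\<And>A B. F (A + B) = F A + F B" and scale: "\<And>r A. F (r *\<^sub>R A) = r * F A"
    and local: "\<And>A B. (\<And>i j. i < m \<Longrightarrow> j < m \<Longrightarrow> A i j = B i j) \<Longrightarrow> F A = F B"
  shows "\<exists>P. \<forall>A. F A = Re (\<Sum>i<m. \<Sum>j<m. P i j * A i j)"
proof (intro exI allI)
  fix A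
  have ue: "F (unit_entry i j z) = Re (Complex (F (unit_entry i j 1)) (- F (unit_entry i j \<i>)) * z)" for i j z
  proof (rule real_linear_complex_form)
    fix u v :: complex and r :: real
    have "unit_entry i j (u + v) = unit_entry i j u + unit_entry i j v" by (auto simp: unit_entry_def fun_eq_iff)
    then show "F (unit_entry i j (u + v)) = F (unit_entry i j u) + F (unit_entry i j v)" using add by simp
    have "unit_entry i j (r *\<^sub>R u) = r *\<^sub>R unit_entry i j u" by (auto simp: unit_entry_def fun_eq_iff)
    then show "F (unit_entry i j (r *\<^sub>R u)) = r * F (unit_entry i j u)" using scale by simp
  qed
  have sums: "F (\<Sum>z\<in>Z. u z) = (\<Sum>z\<in>Z. F (u z))" for Z :: "nat set" and u
    by (rule additive_sum[where W = UNIV and F = F]) (auto simp: add scale subspace_def)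
  have "F A = F (\<Sum>i<m. \<Sum>j<m. unit_entry i j (A i j))"
    by (rule local) (simp only: sum_fun_apply sum_unit_entry)
  also have "\<dots> = (\<Sum>i<m. \<Sum>j<m. F (unit_entry i j (A i j)))"
    by (simp only: sums)
  also have "\<dots> = Re (\<Sum>i<m. \<Sum>j<m. Complex (F (unit_entry i j 1)) (- F (unit_entry i j \<i>)) * A i j)"
    unfolding Re_sum by (intro sum.cong refl ue)
  finally show "F A = Re (\<Sum>i<m. \<Sum>j<m. Complex (F (unit_entry i j 1)) (- F (unit_entry i j \<i>)) * A i j)" .
qed

context pointed_operators
begin

abbreviation "Deltas \<equiv> {\<nu>. \<forall>(i::nat) (j::nat). \<nu> i j \<in> delta_span X x0}"

lemma subspace_Deltas: "subspace Deltas"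
  unfolding subspace_def
proof (intro conjI ballI allI CollectI)
  fix i j :: nat
  show "0 i j \<in> delta_span X x0" using delta_span_zero by (simp add: zero_fun_def)
next
  fix \<nu> \<nu>' :: "nat \<Rightarrow> nat \<Rightarrow> (('h \<Rightarrow> 'h) \<Rightarrow> complex) \<Rightarrow> complex" and i j
  assume "\<nu> \<in> Deltas" "\<nu>' \<in> Deltas"
  then show "(\<nu> + \<nu>') i j \<in> delta_span X x0"
    using delta_span_add[of "\<nu> i j" "\<nu>' i j"] by (simp add: plus_fun_def)
next
  fix \<nu> :: "nat \<Rightarrow> nat \<Rightarrow> (('h \<Rightarrow> 'h) \<Rightarrow> complex) \<Rightarrow> complex" and i j and r :: real
  assume "\<nu> \<in> Deltas"
  then show "(r *\<^sub>R \<nu>) i j \<in> delta_span X x0"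
    using delta_span_scale[of "\<nu> i j" "of_real r"] by (simp add: scaleR_fun_def scaleR_conv_of_real)
qed

lemma unit_entry_Deltas: "\<phi> \<in> delta_span X x0 \<Longrightarrow> unit_entry i j \<phi> \<in> Deltas"
  using delta_span_zero by (auto simp: unit_entry_def zero_fun_def)

text \<open>A real-linear functional on matrices over the span of the deltas is the real part of the pairing with a matrix \<open>g\<close>
of functions on \<open>X\<close>, namely its complexified values on the matrices with the single entry \<open>\<delta>(x)\<close>. The
coefficients and points in the hypothesis depend on a representation of \<open>\<nu>\<close>, the conclusion holds for all of them, and
so linear relations between deltas need no attention.\<close>

lemma delta_functional:
  assumes add: "\<And>u v. u \<in> Deltas \<Longrightarrow> v \<in> Deltas \<Longrightarrow> G (u + v) = G u + G v"
    and scale: "\<And>r u. u \<in> Deltas \<Longrightarrow> G (r *\<^sub>R u) = r * (G u :: real)"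
    and local: "\<And>u v. u \<in> Deltas \<Longrightarrow> v \<in> Deltas \<Longrightarrow> (\<And>i j. i < m \<Longrightarrow> j < m \<Longrightarrow> u i j = v i j) \<Longrightarrow> G u = G v"
  defines "g \<equiv> \<lambda>i j x. if x \<in> X then Complex (G (unit_entry i j (delta X x0 x)))
    (- G (unit_entry i j (\<lambda>f. \<i> * delta X x0 x f))) else 0"
  assumes \<nu>: "\<nu> \<in> Deltas" and eq: "\<And>i j f. i < m \<Longrightarrow> j < m \<Longrightarrow> \<nu> i j f = (\<Sum>z\<in>Z i j. c i j z * delta X x0 (pt i j z) f)"
    and pt: "\<And>i j z. z \<in> Z i j \<Longrightarrow> pt i j z \<in> X"
  shows "G \<nu> = Re (\<Sum>i<m. \<Sum>j<m. \<Sum>z\<in>Z i j. c i j z * g i j (pt i j z))"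
proof -
  let ?t = "\<lambda>i j x c. unit_entry i j (\<lambda>f. c * delta X x0 x f)"
  have tD: "?t i j x c \<in> Deltas" if "x \<in> X" for i j x c
    by (rule unit_entry_Deltas[OF delta_span_scale[OF delta_span_delta[OF that]]])
  have Gt: "G (?t i j x c) = Re (c * g i j x)" if x: "x \<in> X" for i j x c
  proof -
    have "G (?t i j x c) = Re (Complex (G (?t i j x 1)) (- G (?t i j x \<i>)) * c)"
    proof (rule real_linear_complex_form)
      fix u v :: complex and r :: real
      have "?t i j x (u + v) = ?t i j x u + ?t i j x v" by (auto simp: unit_entry_def fun_eq_iff distrib_right)
      then show "G (?t i j x (u + v)) = G (?t i j x u) + G (?t i j x v)" using add tD[OF x] by simp
      have "?t i j x (r *\<^sub>R u) = r *\<^sub>R ?t i j x u" by (auto simp: unit_entry_def fun_eq_iff)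
      then show "G (?t i j x (r *\<^sub>R u)) = r * G (?t i j x u)" using scale tD[OF x] by simp
    qed
    then show ?thesis using x unfolding g_def by (simp only: mult_1_left if_True mult.commute[of c])
  qed
  let ?T = "\<Sum>i<m. \<Sum>j<m. \<Sum>z\<in>Z i j. ?t i j (pt i j z) (c i j z)"
  have inner: "(\<Sum>z\<in>Z i j. ?t i j (pt i j z) (c i j z)) \<in> Deltas" for i j
    by (rule subspace_sum[OF subspace_Deltas tD[OF pt]])
  have inner2: "(\<Sum>j<m. \<Sum>z\<in>Z i j. ?t i j (pt i j z) (c i j z)) \<in> Deltas" for i
    by (rule subspace_sum[OF subspace_Deltas inner])
  have TD: "?T \<in> Deltas"
    by (rule subspace_sum[OF subspace_Deltas inner2])
  have "\<nu> i j = ?T i j" if ij: "i < m" "j < m" for i j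
  proof (rule ext)
    fix f
    have ue: "unit_entry i0 j0 (\<lambda>f. c i0 j0 z * delta X x0 (pt i0 j0 z) f) i j f
      = unit_entry i0 j0 (c i0 j0 z * delta X x0 (pt i0 j0 z) f) i j" for i0 j0 z
      by (simp add: unit_entry_def)
    have us: "(\<Sum>z\<in>Z i0 j0. unit_entry i0 j0 (c i0 j0 z * delta X x0 (pt i0 j0 z) f) i j)
      = unit_entry i0 j0 (\<Sum>z\<in>Z i0 j0. c i0 j0 z * delta X x0 (pt i0 j0 z) f) i j" for i0 j0
      by (cases "i = i0 \<and> j = j0") (auto simp: unit_entry_def)
    have "?T i j f = (\<Sum>i0<m. \<Sum>j0<m. unit_entry i0 j0 (\<Sum>z\<in>Z i0 j0. c i0 j0 z * delta X x0 (pt i0 j0 z) f) i j)"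
      by (simp only: sum_fun_apply ue us)
    also have "\<dots> = \<nu> i j f" unfolding sum_unit_entry[OF ij] using eq[OF ij] by simp
    finally show "\<nu> i j f = ?T i j f" ..
  qed
  then have "G \<nu> = G ?T" by (rule local[OF \<nu> TD])
  also have "\<dots> = (\<Sum>i<m. G (\<Sum>j<m. \<Sum>z\<in>Z i j. ?t i j (pt i j z) (c i j z)))"
    by (rule additive_sum[OF subspace_Deltas add scale inner2])
  also have "\<dots> = (\<Sum>i<m. \<Sum>j<m. G (\<Sum>z\<in>Z i j. ?t i j (pt i j z) (c i j z)))"
    by (rule sum.cong[OF refl], rule additive_sum[OF subspace_Deltas add scale inner])
  also have "\<dots> = (\<Sum>i<m. \<Sum>j<m. \<Sum>z\<in>Z i j. G (?t i j (pt i j z) (c i j z)))"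
    by (rule sum.cong[OF refl], rule sum.cong[OF refl], rule additive_sum[OF subspace_Deltas add scale tD[OF pt]])
  also have "\<dots> = (\<Sum>i<m. \<Sum>j<m. \<Sum>z\<in>Z i j. Re (c i j z * g i j (pt i j z)))"
    by (intro sum.cong refl Gt pt)
  finally show ?thesis by (simp only: Re_sum)
qed

text \<open>The matrix \<open>a (\<delta>(x) - \<delta>(y)) b\<close>, with \<open>b\<close> stored transposed.\<close>

definition summand :: "complex matrix \<times> complex matrix \<times>
    ('h \<Rightarrow> 'h) matrix \<times> ('h \<Rightarrow> 'h) matrix \<Rightarrow>
    nat \<Rightarrow> nat \<Rightarrow> (('h \<Rightarrow> 'h) \<Rightarrow> complex) \<Rightarrow> complex" where
  "summand g i j f = (case g of (a, b, x, y) \<Rightarrow>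
     \<Sum>s<n. \<Sum>t<n. a i s * (delta X x0 (x s t) f - delta X x0 (y s t) f) * b j t)"

text \<open>The form of \<open>\<parallel>x - y\<parallel> a a\<^sup>*\<close> at \<open>\<xi>\<close>, the amount by which the term uses up the row matrix; the next definition does
the same for the columns.\<close>

definition row_weight :: "nat \<Rightarrow> complex matrix \<times> complex matrix \<times>
    ('h \<Rightarrow> 'h) matrix \<times> ('h \<Rightarrow> 'h) matrix \<Rightarrow> (nat \<Rightarrow> complex) \<Rightarrow> real" where
  "row_weight m g \<xi> = (case g of (a, b, x, y) \<Rightarrow> matdist x y * (\<Sum>s<n. (norm (\<Sum>i<m. \<xi> i * a i s))\<^sup>2))"

definition col_weight :: "nat \<Rightarrow> complex matrix \<times> complex matrix \<times>
    ('h \<Rightarrow> 'h) matrix \<times> ('h \<Rightarrow> 'h) matrix \<Rightarrow> (nat \<Rightarrow> complex) \<Rightarrow> real" where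
  "col_weight m g \<xi> = (case g of (a, b, x, y) \<Rightarrow> matdist x y * (\<Sum>s<n. (norm (\<Sum>i<m. \<xi> i * b i s))\<^sup>2))"

definition admissible :: "(complex matrix \<times> complex matrix \<times>
    ('h \<Rightarrow> 'h) matrix \<times> ('h \<Rightarrow> 'h) matrix) list \<Rightarrow> bool" where
  "admissible ts \<longleftrightarrow> (\<forall>(a, b, x, y)\<in>set ts. x \<in> mats n X \<and> y \<in> mats n X)"

definition represents where
  "represents m ts \<nu> \<longleftrightarrow> admissible ts \<and> (\<forall>i<m. \<forall>j<m. \<forall>f. \<nu> i j f = (\<Sum>g\<leftarrow>ts. summand g i j f))"

lemma represents_add:
  "represents m ts \<nu> \<Longrightarrow> represents m ts' \<nu>' \<Longrightarrow> represents m (ts @ ts') (\<nu> + \<nu>')"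
  by (auto simp: represents_def admissible_def)

lemma represents_scale:
  assumes "represents m ts \<nu>" "0 \<le> r"
  defines "ts' \<equiv> map (\<lambda>(a, b, x, y). (\<lambda>i s. of_real (sqrt r) * a i s, \<lambda>i s. of_real (sqrt r) * b i s, x, y)) ts"
  shows "represents m ts' (r *\<^sub>R \<nu>)"
    and "(\<Sum>g\<leftarrow>ts'. row_weight m g \<xi>) = r * (\<Sum>g\<leftarrow>ts. row_weight m g \<xi>)"
    and "(\<Sum>g\<leftarrow>ts'. col_weight m g \<xi>) = r * (\<Sum>g\<leftarrow>ts. col_weight m g \<xi>)"
proof -
  have sq: "complex_of_real (sqrt r) * complex_of_real (sqrt r) = of_real r"
    using assms(2) by (metis of_real_mult real_sqrt_mult_self abs_of_nonneg)
  have e: "summand (\<lambda>i s. of_real (sqrt r) * a i s, \<lambda>i s. of_real (sqrt r) * b i s, x, y) i j f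
      = of_real r * summand (a, b, x, y) i j f" for a b x y i j f
    unfolding summand_def prod.case sum_distrib_left sq[symmetric] by (intro sum.cong refl) (simp only: mult_ac)
  have e': "summand (\<lambda>i s. of_real (sqrt r) * fst g i s, \<lambda>i s. of_real (sqrt r) * fst (snd g) i s, snd (snd g)) i j f
      = of_real r * summand g i j f" for g i j f
    by (cases g) (simp only: fst_conv snd_conv e)
  have n: "(norm (\<Sum>i<m. \<xi> i * (of_real (sqrt r) * a i)))\<^sup>2 = r * (norm (\<Sum>i<m. \<xi> i * a i))\<^sup>2" for a :: "nat \<Rightarrow> complex"
  proof -
    have "(\<Sum>i<m. \<xi> i * (of_real (sqrt r) * a i)) = of_real (sqrt r) * (\<Sum>i<m. \<xi> i * a i)"
      unfolding sum_distrib_left by (intro sum.cong refl) (simp only: mult_ac)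
    then show ?thesis using assms(2) by (simp add: norm_mult power_mult_distrib)
  qed
  show "represents m ts' (r *\<^sub>R \<nu>)"
    using assms(1) unfolding represents_def admissible_def ts'_def
    by (auto simp: split_def scaleR_conv_of_real sum_list_const_mult[symmetric] o_def e')
  show "(\<Sum>g\<leftarrow>ts'. row_weight m g \<xi>) = r * (\<Sum>g\<leftarrow>ts. row_weight m g \<xi>)"
    unfolding ts'_def by (simp add: split_def row_weight_def n sum_list_const_mult[symmetric] o_def sum_distrib_left mult_ac)
  show "(\<Sum>g\<leftarrow>ts'. col_weight m g \<xi>) = r * (\<Sum>g\<leftarrow>ts. col_weight m g \<xi>)"
    unfolding ts'_def by (simp add: split_def col_weight_def n sum_list_const_mult[symmetric] o_def sum_distrib_left mult_ac)
qed

text \<open>Since \<open>\<delta>(x0) = 0\<close>, a matrix with the single entry \<open>c \<delta>(x)\<close> is a summand: take scalar matrices with one entry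
and the corner matrices of \<open>x\<close> and \<open>x0\<close>. Sums are concatenations.\<close>

lemma represents_exists:
  assumes "\<And>i j. i < m \<Longrightarrow> j < m \<Longrightarrow> \<nu> i j \<in> delta_span X x0"
  shows "\<exists>ts. represents m ts \<nu>"
proof -
  let ?ok = "\<lambda>\<nu>. \<exists>ts. represents m ts \<nu>"
  have zero: "?ok 0" by (rule exI[of _ "[]"]) (simp add: represents_def admissible_def)
  have add: "?ok (\<nu> + \<nu>')" if "?ok \<nu>" "?ok \<nu>'" for \<nu> \<nu>' using that represents_add by blast
  have sums: "?ok (\<Sum>z\<in>Z. u z)" if "\<And>z. z \<in> Z \<Longrightarrow> ?ok (u z)" for Z :: "'z set" and u
    using that by (induction Z rule: infinite_finite_induct) (simp_all add: zero add)
  have single: "?ok (unit_entry i0 j0 (\<lambda>f. c * delta X x0 x f))" if x: "x \<in> X" for i0 j0 c x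
  proof -
    let ?a = "unit_entry i0 0 c" and ?b = "unit_entry j0 0 1"
    have "unit_entry i0 j0 (\<lambda>f. c * delta X x0 x f) i j f = summand (?a, ?b, corner x, corner x0) i j f" for i j f
    proof -
      have d0: "delta X x0 x0 f = 0" by (simp add: delta_def lip0_def)
      have "summand (?a, ?b, corner x, corner x0) i j f = (\<Sum>s<n. \<Sum>t<n.
        if s = 0 then (if t = 0 then (if i = i0 \<and> j = j0 then c * delta X x0 x f else 0) else 0) else 0)"
        unfolding summand_def prod.case by (intro sum.cong refl) (auto simp: unit_entry_def corner_def d0)
      also have "\<dots> = (\<Sum>s<n. if s = 0 then (\<Sum>t<n. if t = 0 then (if i = i0 \<and> j = j0 then c * delta X x0 x f else 0) else 0) else 0)"
        by (rule sum.cong[OF refl]) auto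
      also have "\<dots> = (if i = i0 \<and> j = j0 then c * delta X x0 x f else 0)" using size_pos by simp
      finally show ?thesis by (simp add: unit_entry_def)
    qed
    then show ?thesis
      using corner_mats[OF x] corner_mats[OF base]
      by (intro exI[of _ "[(?a, ?b, corner x, corner x0)]"]) (simp add: represents_def admissible_def)
  qed
  have "\<forall>i j. \<exists>S a. i < m \<longrightarrow> j < m \<longrightarrow> finite S \<and> S \<subseteq> X \<and> \<nu> i j = (\<lambda>f. \<Sum>x\<in>S. a x * delta X x0 x f)"
  proof (intro allI)
    fix i j
    show "\<exists>S a. i < m \<longrightarrow> j < m \<longrightarrow> finite S \<and> S \<subseteq> X \<and> \<nu> i j = (\<lambda>f. \<Sum>x\<in>S. a x * delta X x0 x f)"
    proof (cases "i < m \<and> j < m")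
      case True
      then have "\<nu> i j \<in> delta_span X x0" using assms by simp
      then obtain S a where "\<nu> i j = (\<lambda>f. \<Sum>x\<in>S. a x * delta X x0 x f)" "finite S" "S \<subseteq> X"
        unfolding delta_span_def by blast
      then show ?thesis by (intro exI[of _ S] exI[of _ a]) simp
    qed simp
  qed
  then obtain S a where Sa: "\<forall>i j. i < m \<longrightarrow> j < m \<longrightarrow> finite (S i j) \<and> S i j \<subseteq> X \<and>
      \<nu> i j = (\<lambda>f. \<Sum>x\<in>S i j. a i j x * delta X x0 x f)"
    by (simp only: choice_iff) blast
  let ?T = "\<Sum>i<m. \<Sum>j<m. \<Sum>x\<in>S i j. unit_entry i j (\<lambda>f. a i j x * delta X x0 x f)"
  have "?ok ?T"
    by (intro sums single) (use Sa in auto)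
  then obtain ts where ts: "represents m ts ?T" by blast
  have "?T i j f = \<nu> i j f" if ij: "i < m" "j < m" for i j f
  proof -
    have ue: "unit_entry i0 j0 (\<lambda>f. a i0 j0 x * delta X x0 x f) i j f
      = unit_entry i0 j0 (a i0 j0 x * delta X x0 x f) i j" for i0 j0 x
      by (simp add: unit_entry_def)
    have us: "(\<Sum>x\<in>S i0 j0. unit_entry i0 j0 (a i0 j0 x * delta X x0 x f) i j)
      = unit_entry i0 j0 (\<Sum>x\<in>S i0 j0. a i0 j0 x * delta X x0 x f) i j" for i0 j0
      by (cases "i = i0 \<and> j = j0") (auto simp: unit_entry_def)
    show ?thesis using Sa ij by (simp only: sum_fun_apply ue us sum_unit_entry)
  qed
  then have "represents m ts \<nu>" using ts unfolding represents_def by simp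
  then show ?thesis by blast
qed

lemma weight_bound:
  assumes "admissible ts"
  shows "\<exists>t. \<forall>\<xi>. (\<Sum>g\<leftarrow>ts. row_weight m g \<xi>) \<le> t * sqnorm m \<xi> \<and>
    (\<Sum>g\<leftarrow>ts. col_weight m g \<xi>) \<le> t * sqnorm m \<xi>"
proof -
  define w where "w a x y = matdist x y * (\<Sum>s<n. (vnorm m (\<lambda>i. a i s))\<^sup>2)" for a :: "complex matrix" and x y
  have one: "matdist x y * (\<Sum>s<n. (norm (\<Sum>i<m. \<xi> i * a i s))\<^sup>2) \<le> w a x y * sqnorm m \<xi>"
    if "x \<in> mats n X" "y \<in> mats n X" for x y and a :: "complex matrix" and \<xi>
  proof -
    have "(norm (\<Sum>i<m. \<xi> i * a i s))\<^sup>2 \<le> (vnorm m \<xi> * vnorm m (\<lambda>i. a i s))\<^sup>2" for s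
      by (intro power_mono cauchy_schwarz_sum) simp
    then have "(\<Sum>s<n. (norm (\<Sum>i<m. \<xi> i * a i s))\<^sup>2) \<le> (\<Sum>s<n. (vnorm m (\<lambda>i. a i s))\<^sup>2 * (vnorm m \<xi>)\<^sup>2)"
      by (intro sum_mono) (simp add: power_mult_distrib mult.commute)
    then have "matdist x y * (\<Sum>s<n. (norm (\<Sum>i<m. \<xi> i * a i s))\<^sup>2) \<le> matdist x y * (\<Sum>s<n. (vnorm m (\<lambda>i. a i s))\<^sup>2 * (vnorm m \<xi>)\<^sup>2)"
      by (rule mult_left_mono) (rule matdist_nonneg[OF that])
    then show ?thesis unfolding w_def vnorm_sq[where m = m and v = \<xi>] sum_distrib_right[symmetric] by (simp only: mult.assoc)
  qed
  show ?thesis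
    using assms
  proof (induction ts)
    case Nil
    show ?case by (auto intro!: exI[of _ 0])
  next
    case (Cons g ts)
    obtain a b x y where g: "g = (a, b, x, y)" by (cases g)
    have xy: "x \<in> mats n X" "y \<in> mats n X" and "admissible ts" using Cons.prems g by (auto simp: admissible_def)
    with Cons.IH obtain t where t: "\<And>\<xi>. (\<Sum>g\<leftarrow>ts. row_weight m g \<xi>) \<le> t * sqnorm m \<xi>"
      "\<And>\<xi>. (\<Sum>g\<leftarrow>ts. col_weight m g \<xi>) \<le> t * sqnorm m \<xi>" by blast
    have w: "0 \<le> w h x y" for h
      unfolding w_def by (intro mult_nonneg_nonneg matdist_nonneg xy sum_nonneg) simp
    have step: "W + V \<le> (w a x y + w b x y + t) * N" if "W \<le> w h x y * N" "V \<le> t * N" "0 \<le> N" "h = a \<or> h = b" for W V N h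
    proof -
      have "w h x y * N \<le> (w a x y + w b x y) * N" using that w[of a] w[of b] by (intro mult_right_mono) auto
      then show ?thesis using that by (simp add: distrib_right)
    qed
    show ?case
    proof (intro exI[of _ "w a x y + w b x y + t"] allI conjI)
      fix \<xi> :: "nat \<Rightarrow> complex"
      have N: "0 \<le> sqnorm m \<xi>" by (simp add: sum_nonneg)
      show "(\<Sum>g\<leftarrow>g # ts. row_weight m g \<xi>) \<le> (w a x y + w b x y + t) * sqnorm m \<xi>"
        using step[OF one[OF xy] t(1) N] by (simp add: g row_weight_def)
      show "(\<Sum>g\<leftarrow>g # ts. col_weight m g \<xi>) \<le> (w a x y + w b x y + t) * sqnorm m \<xi>"
        using step[OF one[OF xy] t(2) N] by (simp add: g col_weight_def)
    qed
  qed
qed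

text \<open>Entries beyond the first \<open>m\<close> rows and columns do not enter \<open>represents\<close> and \<open>qform\<close>, so the cone does not see
them; but all entries of \<open>\<nu>\<close> are in the span, which makes the ambient set of triples a subspace.\<close>

definition rep_cone where
  "rep_cone m = {(A, B, \<nu>). \<nu> \<in> Deltas \<and> (\<exists>ts. represents m ts \<nu> \<and>
     (\<forall>\<xi>. (\<Sum>g\<leftarrow>ts. row_weight m g \<xi>) \<le> qform m A \<xi> \<and> (\<Sum>g\<leftarrow>ts. col_weight m g \<xi>) \<le> qform m B \<xi>))}"

lemma rep_coneI:
  assumes "\<nu> \<in> Deltas" "represents m ts \<nu>" "\<And>\<xi>. (\<Sum>g\<leftarrow>ts. row_weight m g \<xi>) \<le> qform m A \<xi>"
    "\<And>\<xi>. (\<Sum>g\<leftarrow>ts. col_weight m g \<xi>) \<le> qform m B \<xi>"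
  shows "(A, B, \<nu>) \<in> rep_cone m"
  using assms unfolding rep_cone_def by blast

lemma represents_Nil: "(\<And>i j. i < m \<Longrightarrow> j < m \<Longrightarrow> \<nu> i j = (\<lambda>_. 0)) \<Longrightarrow> represents m [] \<nu>"
  by (simp add: represents_def admissible_def)

text \<open>Concatenation of lists gives sums, and scaling the scalar matrices by \<open>sqrt r\<close> gives multiples.\<close>

lemma convex_cone_rep_cone: "convex_cone (rep_cone m)"
  unfolding convex_cone_iff
proof (intro conjI ballI allI impI)
  show "0 \<in> rep_cone m"
    unfolding zero_prod_def
  proof (rule rep_coneI[where ts = "[]"])
    show "0 \<in> Deltas" by (rule subspace_0[OF subspace_Deltas])
    show "represents m [] 0" by (rule represents_Nil) (simp add: zero_fun_def)
  qed simp_all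
next
  fix u v assume "u \<in> rep_cone m" "v \<in> rep_cone m"
  then obtain A B \<nu> ts A' B' \<nu>' ts' where u: "u = (A, B, \<nu>)" "\<nu> \<in> Deltas" "represents m ts \<nu>"
      "\<And>\<xi>. (\<Sum>g\<leftarrow>ts. row_weight m g \<xi>) \<le> qform m A \<xi>" "\<And>\<xi>. (\<Sum>g\<leftarrow>ts. col_weight m g \<xi>) \<le> qform m B \<xi>"
    and v: "v = (A', B', \<nu>')" "\<nu>' \<in> Deltas" "represents m ts' \<nu>'"
      "\<And>\<xi>. (\<Sum>g\<leftarrow>ts'. row_weight m g \<xi>) \<le> qform m A' \<xi>" "\<And>\<xi>. (\<Sum>g\<leftarrow>ts'. col_weight m g \<xi>) \<le> qform m B' \<xi>"
    unfolding rep_cone_def by blast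
  show "u + v \<in> rep_cone m"
    unfolding u(1) v(1) add_Pair
  proof (rule rep_coneI[where ts = "ts @ ts'"])
    show "\<nu> + \<nu>' \<in> Deltas" by (rule subspace_add[OF subspace_Deltas u(2) v(2)])
    show "represents m (ts @ ts') (\<nu> + \<nu>')" by (rule represents_add[OF u(3) v(3)])
    fix \<xi>
    show "(\<Sum>g\<leftarrow>ts @ ts'. row_weight m g \<xi>) \<le> qform m (A + A') \<xi>"
      unfolding qform_add using u(4)[of \<xi>] v(4)[of \<xi>] by simp
    show "(\<Sum>g\<leftarrow>ts @ ts'. col_weight m g \<xi>) \<le> qform m (B + B') \<xi>"
      unfolding qform_add using u(5)[of \<xi>] v(5)[of \<xi>] by simp
  qed
next
  fix u and r :: real assume "u \<in> rep_cone m" and r: "0 \<le> r"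
  then obtain A B \<nu> ts where u: "u = (A, B, \<nu>)" "\<nu> \<in> Deltas" "represents m ts \<nu>"
      "\<And>\<xi>. (\<Sum>g\<leftarrow>ts. row_weight m g \<xi>) \<le> qform m A \<xi>" "\<And>\<xi>. (\<Sum>g\<leftarrow>ts. col_weight m g \<xi>) \<le> qform m B \<xi>"
    unfolding rep_cone_def by blast
  show "r *\<^sub>R u \<in> rep_cone m"
    unfolding u(1) scaleR_Pair
    by (rule rep_coneI[OF subspace_scale[OF subspace_Deltas u(2)] represents_scale(1)[OF u(3) r]])
      (simp_all only: represents_scale(2,3)[OF u(3) r] qform_scaleR mult_left_mono[OF u(4) r] mult_left_mono[OF u(5) r])
qed

end

section \<open>Separating functionals on the cone\<close>

context pointed_operators
begin

text \<open>Every \<open>\<nu>\<close> has some representation, whose weights are bounded by a multiple of the identity.\<close>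

lemma rep_cone_order_unit:
  assumes \<nu>: "\<nu> \<in> Deltas"
  shows "\<exists>t. (A, B, \<nu>) + t *\<^sub>R (id_mat, id_mat, 0) \<in> rep_cone m"
proof -
  obtain ts where ts: "represents m ts \<nu>" using represents_exists[of m \<nu>] \<nu> by blast
  then have adm: "admissible ts" by (simp add: represents_def)
  obtain tw where tw: "\<And>\<xi>. (\<Sum>g\<leftarrow>ts. row_weight m g \<xi>) \<le> tw * sqnorm m \<xi>"
    "\<And>\<xi>. (\<Sum>g\<leftarrow>ts. col_weight m g \<xi>) \<le> tw * sqnorm m \<xi>"
    using weight_bound[OF adm] by blast
  obtain tA where tA: "\<And>\<xi>. - tA * sqnorm m \<xi> \<le> qform m A \<xi>" using qform_lower_bound by blast
  obtain tB where tB: "\<And>\<xi>. - tB * sqnorm m \<xi> \<le> qform m B \<xi>" using qform_lower_bound by blast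
  define t where "t = \<bar>tw\<bar> + \<bar>tA\<bar> + \<bar>tB\<bar>"
  have "(A + t *\<^sub>R id_mat, B + t *\<^sub>R id_mat, \<nu>) \<in> rep_cone m"
  proof (rule rep_coneI[OF \<nu> ts])
    fix \<xi> :: "nat \<Rightarrow> complex"
    let ?N = "\<Sum>i<m. (norm (\<xi> i))\<^sup>2"
    have N: "0 \<le> ?N" by (simp add: sum_nonneg)
    have "tw * ?N \<le> (t - tA) * ?N" "tw * ?N \<le> (t - tB) * ?N"
      using N by (auto intro!: mult_right_mono simp: t_def)
    then show "(\<Sum>g\<leftarrow>ts. row_weight m g \<xi>) \<le> qform m (A + t *\<^sub>R id_mat) \<xi>"
      and "(\<Sum>g\<leftarrow>ts. col_weight m g \<xi>) \<le> qform m (B + t *\<^sub>R id_mat) \<xi>"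
      unfolding qform_add qform_scaleR qform_id_mat
      using tw[of \<xi>] tA[of \<xi>] tB[of \<xi>] by (auto simp: left_diff_distrib)
  qed
  then show ?thesis by (intro exI[of _ t]) simp
qed

lemma neg_unit_not_in_rep_cone:
  assumes "1 \<le> m"
  shows "- (id_mat, id_mat, 0) \<notin> rep_cone m"
proof
  assume "- (id_mat, id_mat, 0) \<in> rep_cone m"
  then obtain ts where adm: "admissible ts" and le: "\<And>\<xi>. (\<Sum>g\<leftarrow>ts. row_weight m g \<xi>) \<le> qform m (- id_mat) \<xi>"
    unfolding rep_cone_def represents_def by auto
  let ?\<xi> = "\<lambda>i. if i = 0 then 1 else 0 :: complex"
  have "qform m (- id_mat) ?\<xi> = - qform m id_mat ?\<xi>"
    using qform_scaleR[of m "- 1" id_mat ?\<xi>] by simp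
  also have "\<dots> = - (\<Sum>i<m. if i = 0 then 1 else 0)"
    unfolding qform_id_mat by (intro arg_cong[of _ _ uminus] sum.cong) auto
  also have "\<dots> = - 1" using assms by simp
  finally have "qform m (- id_mat) ?\<xi> = - 1" .
  moreover have "0 \<le> (\<Sum>g\<leftarrow>ts. row_weight m g ?\<xi>)"
    using adm unfolding admissible_def
    by (intro sum_list_nonneg) (auto simp: row_weight_def intro!: mult_nonneg_nonneg matdist_nonneg sum_nonneg)
  ultimately show False using le[of ?\<xi>] by simp
qed

lemma rep_cone_psd:
  assumes "\<And>\<xi>. 0 \<le> qform m A \<xi>" "\<And>\<xi>. 0 \<le> qform m B \<xi>"
  shows "(A, B, 0) \<in> rep_cone m"
proof (rule rep_coneI[where ts = "[]"])
  show "0 \<in> Deltas" by (rule subspace_0[OF subspace_Deltas])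
  show "represents m [] 0" by (rule represents_Nil) (simp add: zero_fun_def)
qed (use assms in simp_all)

lemma rep_cone_null:
  assumes "\<nu> \<in> Deltas" "\<And>i j. i < m \<Longrightarrow> j < m \<Longrightarrow> \<nu> i j = (\<lambda>_. 0)"
  shows "(0, 0, \<nu>) \<in> rep_cone m"
  by (rule rep_coneI[OF assms(1) represents_Nil[OF assms(2)]]) simp_all

text \<open>The matrix \<open>w a a\<^sup>*\<close> for a matrix \<open>a\<close> with \<open>r\<close> columns.\<close>

definition gram :: "nat \<Rightarrow> real \<Rightarrow> (nat \<Rightarrow> nat \<Rightarrow> complex) \<Rightarrow> nat \<Rightarrow> nat \<Rightarrow> complex" where
  "gram r w a i j = of_real w * (\<Sum>s<r. a i s * cnj (a j s))"

lemma qform_gram: "qform m (gram r w a) \<xi> = w * (\<Sum>s<r. (norm (\<Sum>i<m. \<xi> i * a i s))\<^sup>2)"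
proof -
  have "gram r w a = w *\<^sub>R (\<Sum>s<r. (\<lambda>i j. a i s * cnj (a j s)))"
    by (auto simp: fun_eq_iff gram_def sum_fun_apply scaleR_conv_of_real)
  moreover have "qform m (\<Sum>s\<in>S. M s) \<xi> = (\<Sum>s\<in>S. qform m (M s) \<xi>)" for S :: "nat set" and M
    by (induction S rule: infinite_finite_induct)
      (simp_all only: sum.infinite sum.empty sum.insert qform_add qform_zero not_False_eq_True)
  ultimately show ?thesis by (simp only: qform_scaleR qform_rank_one)
qed

lemma rep_cone_summand:
  assumes xy: "x \<in> mats n X" "y \<in> mats n X" and E: "summand (a, b, x, y) \<in> Deltas"
  shows "(gram n (matdist x y) a, gram n (matdist x y) b, summand (a, b, x, y)) \<in> rep_cone m"
  by (rule rep_coneI[where ts = "[(a, b, x, y)]", OF E])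
    (simp_all add: represents_def admissible_def xy row_weight_def col_weight_def qform_gram)

lemma pairing_gram:
  "Re (\<Sum>i<m. \<Sum>j<m. P i j * gram r w a i j) = w * (\<Sum>s<r. qform m P (\<lambda>i. a i s))"
proof -
  have "(\<Sum>i<m. \<Sum>j<m. P i j * gram r w a i j) = (\<Sum>i<m. \<Sum>j<m. \<Sum>s<r. of_real w * (P i j * (a i s * cnj (a j s))))"
    unfolding gram_def sum_distrib_left by (intro sum.cong refl) (simp only: mult_ac)
  also have "\<dots> = (\<Sum>i<m. \<Sum>s<r. \<Sum>j<m. of_real w * (P i j * (a i s * cnj (a j s))))"
    by (rule sum.cong[OF refl], rule sum.swap)
  also have "\<dots> = (\<Sum>s<r. \<Sum>i<m. \<Sum>j<m. of_real w * (P i j * (a i s * cnj (a j s))))" by (rule sum.swap)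
  also have "\<dots> = of_real w * (\<Sum>s<r. \<Sum>i<m. \<Sum>j<m. P i j * (a i s * cnj (a j s)))"
    unfolding sum_distrib_left ..
  finally show ?thesis unfolding qform_def by simp
qed

lemma summand_delta_sum:
  "summand (a, b, x, y) i j f = (\<Sum>z\<in>{..<n} \<times> {..<n} \<times> UNIV.
      (if snd (snd z) then 1 else - 1) * a i (fst z) * b j (fst (snd z)) *
      delta X x0 ((if snd (snd z) then x else y) (fst z) (fst (snd z))) f)"
proof -
  have "summand (a, b, x, y) i j f = (\<Sum>s<n. \<Sum>t<n. \<Sum>c\<in>UNIV.
      (if c then 1 else - 1) * a i s * b j t * delta X x0 ((if c then x else y) s t) f)"
    unfolding summand_def prod.case by (intro sum.cong refl) (simp add: UNIV_bool algebra_simps)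
  then show ?thesis by (simp only: sum.cartesian_product split_def fst_conv snd_conv)
qed

lemma summand_Deltas:
  assumes xy: "x \<in> mats n X" "y \<in> mats n X"
  shows "summand (a, b, x, y) \<in> Deltas"
proof (intro CollectI allI)
  fix i j
  have "(\<lambda>f. \<Sum>z\<in>{..<n} \<times> {..<n} \<times> UNIV. (if snd (snd z) then 1 else - 1) * a i (fst z) * b j (fst (snd z)) *
      delta X x0 ((if snd (snd z) then x else y) (fst z) (fst (snd z))) f) \<in> delta_span X x0"
    using xy by (intro delta_span_sum delta_span_scale delta_span_delta) (auto simp: mats_def)
  then show "summand (a, b, x, y) i j \<in> delta_span X x0" by (simp only: summand_delta_sum[symmetric])
qed

text \<open>What a separating functional says, spelled out. Its values on triples \<open>(A, 0, 0)\<close>, \<open>(0, B, 0)\<close> and \<open>(0, 0, \<nu>)\<close>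
are given by \<open>P\<close>, \<open>Q\<close> and \<open>- g\<close>. Positivity on rank one matrices makes \<open>P\<close> and \<open>Q\<close> positive, positivity on the triple of a
single summand is the domination of \<open>g\<close>, and the same inequality for summands with one entry shows that the
entries of \<open>g\<close> are Lipschitz. The value 1 at the order unit is the sum of the two traces.\<close>

lemma separating_data:
  assumes m: "1 \<le> m" and \<nu>: "\<nu> \<in> Deltas" and out: "(s *\<^sub>R id_mat, s *\<^sub>R id_mat, \<nu>) \<notin> rep_cone m"
  obtains P Q g where "\<And>a. 0 \<le> qform m P a" and "\<And>a. 0 \<le> qform m Q a"
    and "\<And>i j. i < m \<Longrightarrow> j < m \<Longrightarrow> g i j \<in> Lip"
    and "Re (\<Sum>i<m. P i i) + Re (\<Sum>i<m. Q i i) = 1"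
    and "\<And>a b x y. x \<in> mats n X \<Longrightarrow> y \<in> mats n X \<Longrightarrow>
      Re (sandwich m a g x y b)
        \<le> matdist x y * (energy m P a + energy m Q b)"
    and "s \<le> Re (\<Sum>i<m. \<Sum>j<m. \<nu> i j (g i j))"
proof -
  let ?K = "rep_cone m" and ?e = "(id_mat, id_mat, 0) :: _ \<times> _ \<times> (nat \<Rightarrow> nat \<Rightarrow> (('h \<Rightarrow> 'h) \<Rightarrow> complex) \<Rightarrow> complex)"
  let ?V = "UNIV \<times> UNIV \<times> Deltas"
  have V: "subspace ?V"
    using subspace_Deltas unfolding subspace_def by (auto simp: zero_prod_def)
  have KV: "?K \<subseteq> ?V" unfolding rep_cone_def by auto
  have eK: "?e \<in> ?K" by (rule rep_cone_psd) (simp_all add: qform_id_mat sum_nonneg)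
  have unit: "\<exists>t. v + t *\<^sub>R ?e \<in> ?K" if v: "v \<in> ?V" for v
  proof -
    obtain A B \<nu>' where "v = (A, B, \<nu>')" "\<nu>' \<in> Deltas" using v by (cases v) auto
    then show ?thesis using rep_cone_order_unit by blast
  qed
  have wV: "(s *\<^sub>R id_mat, s *\<^sub>R id_mat, \<nu>) \<in> ?V" using \<nu> by simp
  obtain F where Fadd: "\<And>u v. u \<in> ?V \<Longrightarrow> v \<in> ?V \<Longrightarrow> F (u + v) = F u + F v"
    and Fsc: "\<And>t v. v \<in> ?V \<Longrightarrow> F (t *\<^sub>R v) = t * F v"
    and Fpos: "\<And>v. v \<in> ?K \<Longrightarrow> 0 \<le> F v" and Fe: "F ?e = 1"
    and Fw: "F (s *\<^sub>R id_mat, s *\<^sub>R id_mat, \<nu>) \<le> 0"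
    by (rule cone_separation[OF V KV convex_cone_rep_cone eK wV unit neg_unit_not_in_rep_cone[OF m] out]) blast+
  define FA where "FA A = F (A, 0, 0)" for A
  define FB where "FB B = F (0, B, 0)" for B
  define G where "G \<nu>' = - F (0, 0, \<nu>')" for \<nu>'
  have D0: "0 \<in> Deltas" by (rule subspace_0[OF subspace_Deltas])
  have split: "F (A, B, \<nu>') = FA A + FB B - G \<nu>'" if "\<nu>' \<in> Deltas" for A B \<nu>'
  proof -
    have "F ((A, 0, 0) + ((0, B, 0) + (0, 0, \<nu>'))) = FA A + (FB B + F (0, 0, \<nu>'))"
      unfolding FA_def FB_def using that D0 by (subst Fadd, simp, simp, subst Fadd) simp_all
    then show ?thesis by (simp add: G_def)
  qed
  have FAadd: "FA (A + B) = FA A + FA B" for A B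
    using Fadd[of "(A, 0, 0)" "(B, 0, 0)"] D0 by (simp add: FA_def)
  have FBadd: "FB (A + B) = FB A + FB B" for A B
    using Fadd[of "(0, A, 0)" "(0, B, 0)"] D0 by (simp add: FB_def)
  have FAsc: "FA (r *\<^sub>R A) = r * FA A" for r A
    using Fsc[of "(A, 0, 0)" r] D0 by (simp add: FA_def)
  have FBsc: "FB (r *\<^sub>R A) = r * FB A" for r A
    using Fsc[of "(0, A, 0)" r] D0 by (simp add: FB_def)
  have Gadd: "G (u + v) = G u + G v" if "u \<in> Deltas" "v \<in> Deltas" for u v
    using Fadd[of "(0, 0, u)" "(0, 0, v)"] that by (simp add: G_def)
  have Gsc: "G (r *\<^sub>R u) = r * G u" if "u \<in> Deltas" for r u
    using Fsc[of "(0, 0, u)" r] that by (simp add: G_def)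
  have q0: "qform m (A - B) \<xi> = 0" if "\<And>i j. i < m \<Longrightarrow> j < m \<Longrightarrow> A i j = B i j" for A B \<xi>
    unfolding qform_def using that by simp
  have FAloc: "FA A = FA B" if ab: "\<And>i j. i < m \<Longrightarrow> j < m \<Longrightarrow> A i j = B i j" for A B
  proof -
    have "0 \<le> FA (A - B)" unfolding FA_def by (intro Fpos rep_cone_psd) (use q0[of A B, OF ab] in simp_all)
    moreover have "0 \<le> FA (B - A)" unfolding FA_def by (intro Fpos rep_cone_psd) (use q0[of B A] ab in simp_all)
    ultimately show ?thesis using FAadd[of "A - B" B] FAadd[of "B - A" A] by simp
  qed
  have FBloc: "FB A = FB B" if ab: "\<And>i j. i < m \<Longrightarrow> j < m \<Longrightarrow> A i j = B i j" for A B
  proof -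
    have "0 \<le> FB (A - B)" unfolding FB_def by (intro Fpos rep_cone_psd) (use q0[of A B, OF ab] in simp_all)
    moreover have "0 \<le> FB (B - A)" unfolding FB_def by (intro Fpos rep_cone_psd) (use q0[of B A] ab in simp_all)
    ultimately show ?thesis using FBadd[of "A - B" B] FBadd[of "B - A" A] by simp
  qed
  have Gloc: "G u = G v" if uv: "u \<in> Deltas" "v \<in> Deltas" and eq: "\<And>i j. i < m \<Longrightarrow> j < m \<Longrightarrow> u i j = v i j" for u v
  proof -
    have D: "u - v \<in> Deltas" "v - u \<in> Deltas" using subspace_diff[OF subspace_Deltas] uv by auto
    have "0 \<le> - G (u - v)" unfolding G_def minus_minus
      by (intro Fpos rep_cone_null D) (simp add: eq zero_fun_def)
    moreover have "0 \<le> - G (v - u)" unfolding G_def minus_minus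
      by (intro Fpos rep_cone_null D) (simp add: eq zero_fun_def)
    ultimately show ?thesis using Gadd[of "u - v" v] Gadd[of "v - u" u] uv D by simp
  qed
  obtain P where P: "\<And>A. FA A = Re (\<Sum>i<m. \<Sum>j<m. P i j * A i j)"
    using matrix_functional[OF FAadd FAsc FAloc] by blast
  obtain Q where Q: "\<And>A. FB A = Re (\<Sum>i<m. \<Sum>j<m. Q i j * A i j)"
    using matrix_functional[OF FBadd FBsc FBloc] by blast
  define g where "g = (\<lambda>i j x. if x \<in> X then Complex (G (unit_entry i j (delta X x0 x)))
    (- G (unit_entry i j (\<lambda>f. \<i> * delta X x0 x f))) else 0)"
  have Ppos: "0 \<le> qform m P a" for a
  proof -
    have "0 \<le> FA (\<lambda>i j. a i * cnj (a j))"
      unfolding FA_def by (intro Fpos rep_cone_psd) (simp_all only: qform_rank_one qform_zero zero_le_power2 order_refl)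
    then show ?thesis unfolding P qform_def .
  qed
  have Qpos: "0 \<le> qform m Q a" for a
  proof -
    have "0 \<le> FB (\<lambda>i j. a i * cnj (a j))"
      unfolding FB_def by (intro Fpos rep_cone_psd) (simp_all only: qform_rank_one qform_zero zero_le_power2 order_refl)
    then show ?thesis unfolding Q qform_def .
  qed
  have dom: "Re (sandwich m a g x y b)
        \<le> matdist x y * (energy m P a + energy m Q b)"
    if xy: "x \<in> mats n X" "y \<in> mats n X" for a b x y
  proof -
    let ?T = "\<lambda>i j s t. a i s * (g i j (x s t) - g i j (y s t)) * b j t"
    have "G (summand (a, b, x, y)) = Re (\<Sum>i<m. \<Sum>j<m. \<Sum>z\<in>{..<n} \<times> {..<n} \<times> UNIV.
      ((if snd (snd z) then 1 else - 1) * a i (fst z) * b j (fst (snd z))) *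
      g i j ((if snd (snd z) then x else y) (fst z) (fst (snd z))))"
      unfolding g_def
      by (rule delta_functional, fact Gadd, fact Gsc, fact Gloc, rule summand_Deltas[OF xy], rule summand_delta_sum)
        (use xy in \<open>auto simp: mats_def\<close>)
    also have "(\<Sum>i<m. \<Sum>j<m. \<Sum>z\<in>{..<n} \<times> {..<n} \<times> UNIV.
      ((if snd (snd z) then 1 else - 1) * a i (fst z) * b j (fst (snd z))) *
      g i j ((if snd (snd z) then x else y) (fst z) (fst (snd z))))
      = (\<Sum>i<m. \<Sum>j<m. \<Sum>s<n. \<Sum>t<n. \<Sum>c\<in>UNIV. ((if c then 1 else - 1) * a i s * b j t) * g i j ((if c then x else y) s t))"
      by (simp only: sum.cartesian_product split_def fst_conv snd_conv)
    also have "\<dots> = (\<Sum>i<m. \<Sum>j<m. \<Sum>s<n. \<Sum>t<n. ?T i j s t)"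
      by (intro sum.cong refl) (simp add: UNIV_bool algebra_simps)
    also have "\<dots> = (\<Sum>i<m. \<Sum>s<n. \<Sum>j<m. \<Sum>t<n. ?T i j s t)"
      by (rule sum.cong[OF refl], rule sum.swap)
    also have "\<dots> = (\<Sum>s<n. \<Sum>i<m. \<Sum>j<m. \<Sum>t<n. ?T i j s t)" by (rule sum.swap)
    also have "\<dots> = (\<Sum>s<n. \<Sum>i<m. \<Sum>t<n. \<Sum>j<m. ?T i j s t)"
      by (rule sum.cong[OF refl], rule sum.cong[OF refl], rule sum.swap)
    also have "\<dots> = (\<Sum>s<n. \<Sum>t<n. \<Sum>i<m. \<Sum>j<m. ?T i j s t)"
      by (rule sum.cong[OF refl], rule sum.swap)
    finally have Geq: "G (summand (a, b, x, y)) = Re (\<Sum>s<n. \<Sum>t<n. \<Sum>i<m. \<Sum>j<m. ?T i j s t)" .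
    have "0 \<le> F (gram n (matdist x y) a, gram n (matdist x y) b, summand (a, b, x, y))"
      by (intro Fpos rep_cone_summand xy summand_Deltas)
    also have "\<dots> = FA (gram n (matdist x y) a) + FB (gram n (matdist x y) b) - G (summand (a, b, x, y))"
      by (rule split) (rule summand_Deltas[OF xy])
    also have "\<dots> = matdist x y * (\<Sum>s<n. qform m P (\<lambda>i. a i s)) + matdist x y * (\<Sum>t<n. qform m Q (\<lambda>j. b j t))
        - Re (\<Sum>s<n. \<Sum>t<n. \<Sum>i<m. \<Sum>j<m. ?T i j s t)"
      unfolding P Q pairing_gram Geq ..
    finally show ?thesis by (simp add: distrib_left)
  qed
  have gL: "g i j \<in> Lip" if ij: "i < m" "j < m" for i j
  proof -
    have d0: "delta X x0 x0 = 0" by (auto simp: delta_def lip0_def fun_eq_iff)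
    have G0: "G 0 = 0" using Gsc[OF D0, of 0] by simp
    have "g i j x0 = 0"
    proof -
      have u0: "unit_entry i j (0 :: (('h \<Rightarrow> 'h) \<Rightarrow> complex) \<Rightarrow> complex) = 0"
        by (auto simp: unit_entry_def fun_eq_iff)
      have i0: "(\<lambda>f. \<i> * delta X x0 x0 f) = 0" by (simp add: d0 fun_eq_iff)
      show ?thesis using base unfolding g_def unfolding i0 unfolding d0 u0 G0 by (simp add: complex_eq_iff)
    qed
    moreover have "norm (g i j x - g i j y) \<le> (Re (P i i) + Re (Q j j)) * opdist x y" if xy: "x \<in> X" "y \<in> X" for x y
    proof -
      define z where "z = g i j x - g i j y"
      obtain \<theta> where phase: "norm \<theta> = 1" "\<theta> * z = complex_of_real (norm z)" by (rule unit_phase)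
      have \<theta>: "\<theta> * cnj \<theta> = 1" "Re (\<theta> * z) = norm z"
        using phase complex_norm_square[of \<theta>] by simp_all
      let ?a = "unit_entry i 0 \<theta>" and ?b = "unit_entry j 0 (1::complex)"
      have qu: "qform m M (\<lambda>i'. unit_entry k 0 c i' s) = (if s = 0 then Re (M k k * (c * cnj c)) else 0)"
        if "k < m" for M k c s
      proof -
        have "(\<Sum>i'<m. \<Sum>j'<m. M i' j' * (unit_entry k 0 c i' s * cnj (unit_entry k 0 c j' s)))
          = (\<Sum>i'<m. if i' = k then (\<Sum>j'<m. if j' = k then (if s = 0 then M k k * (c * cnj c) else 0) else 0) else 0)"
        proof (rule sum.cong[OF refl])
          fix i'
          have "(\<Sum>j'<m. M i' j' * (unit_entry k 0 c i' s * cnj (unit_entry k 0 c j' s)))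
            = (\<Sum>j'<m. if j' = k then (if i' = k \<and> s = 0 then M k k * (c * cnj c) else 0) else 0)"
            by (rule sum.cong[OF refl]) (auto simp: unit_entry_def)
          then show "(\<Sum>j'<m. M i' j' * (unit_entry k 0 c i' s * cnj (unit_entry k 0 c j' s)))
            = (if i' = k then (\<Sum>j'<m. if j' = k then (if s = 0 then M k k * (c * cnj c) else 0) else 0) else 0)"
            by (cases "i' = k") simp_all
        qed
        then show ?thesis unfolding qform_def using that by simp
      qed
      have pick: "(\<Sum>i'<m. \<Sum>j'<m. ?a i' s * h i' j' * ?b j' t) = (if s = 0 \<and> t = 0 then \<theta> * h i j else 0)"
        for s t and h :: "complex matrix"
      proof -
        have "(\<Sum>i'<m. \<Sum>j'<m. ?a i' s * h i' j' * ?b j' t)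
          = (\<Sum>i'<m. \<Sum>j'<m. unit_entry i j (if s = 0 \<and> t = 0 then \<theta> * h i j else 0) i' j')"
          by (rule sum.cong[OF refl], rule sum.cong[OF refl]) (auto simp: unit_entry_def)
        also have "\<dots> = (\<Sum>i'<m. if i' = i then (\<Sum>j'<m. if j' = j then (if s = 0 \<and> t = 0 then \<theta> * h i j else 0) else 0) else 0)"
          by (rule sum.cong[OF refl]) (simp add: unit_entry_def)
        finally show ?thesis using ij by simp
      qed
      have "(\<Sum>s<n. \<Sum>t<n. if s = 0 \<and> t = 0 then \<theta> * (g i j (corner x s t) - g i j (corner y s t)) else 0)
        = (\<Sum>s<n. if s = 0 then (\<Sum>t<n. if t = 0 then \<theta> * z else 0) else 0)"
        by (rule sum.cong[OF refl]) (auto simp: corner_def z_def intro!: sum.cong)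
      also have "\<dots> = \<theta> * z" using size_pos by simp
      finally have lhs: "(\<Sum>s<n. \<Sum>t<n. if s = 0 \<and> t = 0 then \<theta> * (g i j (corner x s t) - g i j (corner y s t)) else 0) = \<theta> * z" .
      have nonneg: "0 \<le> Re (P i i) + Re (Q j j)"
        using Ppos[of "\<lambda>i'. unit_entry i 0 1 i' 0"] Qpos[of "\<lambda>i'. unit_entry j 0 1 i' 0"] ij by (simp add: qu)
      have "norm z \<le> matdist (corner x) (corner y) * (Re (P i i) + Re (Q j j))"
        using dom[OF corner_mats[OF xy(1)] corner_mats[OF xy(2)], of ?a ?b] size_pos
        unfolding pick lhs \<theta>(2) qu[OF ij(1)] qu[OF ij(2)] \<theta>(1) by simp
      also have "\<dots> \<le> opdist x y * (Re (P i i) + Re (Q j j))"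
        by (rule mult_right_mono[OF matdist_corner[OF xy] nonneg])
      finally show ?thesis unfolding z_def by (simp only: mult.commute)
    qed
    ultimately show ?thesis unfolding lip0_def
      by (auto simp: g_def intro!: exI[of _ "Re (P i i) + Re (Q j j)"])
  qed
  have FAB: "FA id_mat + FB id_mat = 1"
  proof -
    have "G 0 = 0" using Gsc[OF D0, of 0] by simp
    then show ?thesis using split[OF D0, of id_mat id_mat] Fe by simp
  qed
  have trace: "Re (\<Sum>i<m. P i i) + Re (\<Sum>i<m. Q i i) = 1"
    using FAB unfolding P Q sum_id_mat .
  have "s \<le> Re (\<Sum>i<m. \<Sum>j<m. \<nu> i j (g i j))"
  proof -
    have "\<forall>i j. \<exists>S a. finite S \<and> S \<subseteq> X \<and> \<nu> i j = (\<lambda>f. \<Sum>x\<in>S. a x * delta X x0 x f)"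
    proof (intro allI)
      fix i j
      have "\<nu> i j \<in> delta_span X x0" using \<nu> by simp
      then obtain S a where "\<nu> i j = (\<lambda>f. \<Sum>x\<in>S. a x * delta X x0 x f)" "finite S" "S \<subseteq> X"
        unfolding delta_span_def by blast
      then show "\<exists>S a. finite S \<and> S \<subseteq> X \<and> \<nu> i j = (\<lambda>f. \<Sum>x\<in>S. a x * delta X x0 x f)"
        by (intro exI[of _ S] exI[of _ a]) simp
    qed
    then obtain S a where "\<forall>i j. finite (S i j) \<and> S i j \<subseteq> X \<and> \<nu> i j = (\<lambda>f. \<Sum>x\<in>S i j. a i j x * delta X x0 x f)"
      by (simp only: choice_iff) blast
    then have S: "\<And>i j. S i j \<subseteq> X" and Sa: "\<And>i j f. \<nu> i j f = (\<Sum>x\<in>S i j. a i j x * delta X x0 x f)"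
      by simp_all
    have "G \<nu> = Re (\<Sum>i<m. \<Sum>j<m. \<Sum>x\<in>S i j. a i j x * g i j x)"
      unfolding g_def
      by (rule delta_functional, fact Gadd, fact Gsc, fact Gloc, rule \<nu>, rule Sa) (use S in auto)
    also have "(\<Sum>i<m. \<Sum>j<m. \<Sum>x\<in>S i j. a i j x * g i j x) = (\<Sum>i<m. \<Sum>j<m. \<nu> i j (g i j))"
      unfolding Sa using gL by (intro sum.cong refl) (simp add: delta_def)
    finally have "G \<nu> = Re (\<Sum>i<m. \<Sum>j<m. \<nu> i j (g i j))" .
    moreover have "F (s *\<^sub>R id_mat, s *\<^sub>R id_mat, \<nu>) = s - G \<nu>"
      unfolding split[OF \<nu>] FAsc FBsc distrib_left[symmetric] FAB by simp
    ultimately show ?thesis using Fw by simp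
  qed
  with Ppos Qpos gL trace dom show thesis by (rule that)
qed
end

section \<open>Representations of matrices over the span of the deltas\<close>

context pointed_operators
begin

text \<open>Otherwise the separating data, with \<open>P\<close> and \<open>Q\<close> made positive definite, show that \<open>s\<close> is at most \<open>C\<close> up to a small
error.\<close>

lemma rep_cone_contains:
  assumes m: "1 \<le> m" and \<nu>: "\<nu> \<in> Deltas" and C: "dual_bound m \<nu> C" and s: "C < s"
  shows "(s *\<^sub>R id_mat, s *\<^sub>R id_mat, \<nu>) \<in> rep_cone m"
proof (rule ccontr)
  assume out: "(s *\<^sub>R id_mat, s *\<^sub>R id_mat, \<nu>) \<notin> rep_cone m"
  obtain P Q g where P: "\<And>a. 0 \<le> qform m P a" and Q: "\<And>a. 0 \<le> qform m Q a"
    and g: "\<And>i j. i < m \<Longrightarrow> j < m \<Longrightarrow> g i j \<in> Lip" and tr: "Re (\<Sum>i<m. P i i) + Re (\<Sum>i<m. Q i i) = 1"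
    and dom: "\<And>a b x y. x \<in> mats n X \<Longrightarrow> y \<in> mats n X \<Longrightarrow>
      Re (sandwich m a g x y b)
        \<le> matdist x y * (energy m P a + energy m Q b)"
    and big: "s \<le> Re (\<Sum>i<m. \<Sum>j<m. \<nu> i j (g i j))"
    by (rule separating_data[OF m \<nu> out]) blast
  have C0: "0 \<le> C" using C unfolding dual_bound_def by blast
  \<comment> \<open>small enough for \<open>C * (1 + 2 * m * \<epsilon>) < s\<close>\<close>
  define \<epsilon> where "\<epsilon> = (s - C) / (2 * real m * (C + 1))"
  have \<epsilon>: "0 < \<epsilon>" using s C0 m by (simp add: \<epsilon>_def)
  have pert: "qform m (M + \<epsilon> *\<^sub>R id_mat) a = qform m M a + \<epsilon> * sqnorm m a" for M a
    by (simp only: qform_add qform_scaleR qform_id_mat)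
  have pert_pos: "0 < qform m (M + \<epsilon> *\<^sub>R id_mat) a" if M: "\<And>a. 0 \<le> qform m M a" and ex: "\<exists>i<m. a i \<noteq> 0" for M a
  proof -
    obtain i where i: "i < m" "a i \<noteq> 0" using ex by blast
    have "0 < (norm (a i))\<^sup>2" using i by simp
    also have "\<dots> \<le> sqnorm m a" using i by (intro member_le_sum) auto
    finally have "0 < sqnorm m a" .
    then show ?thesis unfolding pert using \<epsilon> M[of a] by (simp add: add_nonneg_pos)
  qed
  have tr_pert: "Re (\<Sum>i<m. (M + \<epsilon> *\<^sub>R id_mat) i i) = Re (\<Sum>i<m. M i i) + real m * \<epsilon>" for M
    by (simp add: sum.distrib id_mat_def)
  have "Re (\<Sum>i<m. \<Sum>j<m. \<nu> i j (g i j))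
    \<le> C * (Re (\<Sum>i<m. (P + \<epsilon> *\<^sub>R id_mat) i i) + Re (\<Sum>i<m. (Q + \<epsilon> *\<^sub>R id_mat) i i))"
  proof (rule Lip_matrix_of_functional[OF g pert_pos[OF P] pert_pos[OF Q] _ _ C m])
    fix a b :: "complex matrix" and x y assume xy: "x \<in> mats n X" "y \<in> mats n X"
    have le: "qform m M a \<le> qform m (M + \<epsilon> *\<^sub>R id_mat) a" for M a
      unfolding pert using \<epsilon> by (simp add: sum_nonneg)
    have "matdist x y * (energy m P a + energy m Q b)
      \<le> matdist x y * (energy m (P + \<epsilon> *\<^sub>R id_mat) a + energy m (Q + \<epsilon> *\<^sub>R id_mat) b)"
      by (intro mult_left_mono add_mono sum_mono le matdist_nonneg xy)
    with dom[OF xy, of a b]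
    show "Re (sandwich m a g x y b)
      \<le> matdist x y * (energy m (P + \<epsilon> *\<^sub>R id_mat) a + energy m (Q + \<epsilon> *\<^sub>R id_mat) b)"
      by linarith
  qed (use \<nu> in auto)
  also have "\<dots> = C * (1 + 2 * real m * \<epsilon>)" unfolding tr_pert using tr by (simp add: algebra_simps)
  also have "2 * real m * \<epsilon> = (s - C) / (C + 1)" using C0 m by (simp add: \<epsilon>_def)
  also have "C * (1 + (s - C) / (C + 1)) = C + (s - C) * (C / (C + 1))" by (simp add: distrib_left)
  also have "\<dots> < C + (s - C) * 1"
    using s C0 by (intro add_strict_left_mono mult_strict_left_mono) auto
  finally show False using big by simp
qed

text \<open>A representation of \<open>\<nu>\<close> in normalised form: all blocks of the diagonal have norm at most 1, and the squared norms of the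
two scalar matrices are at most \<open>s\<close>. There are \<open>N\<close> terms, but the data are defined for all indices, with
coefficients 0 from \<open>N\<close> on, so that countably many of these representations can be indexed by pairs of numbers.\<close>

definition splitting where
  "splitting m s \<nu> (N::nat) a b c x y \<longleftrightarrow>
    (\<forall>l. x l \<in> mats n X \<and> y l \<in> mats n X \<and> norm (c l) * matdist (x l) (y l) \<le> 1) \<and>
    (\<forall>l\<ge>N. \<forall>i s. a l i s = 0) \<and>
    (\<forall>i<m. \<forall>j<m. \<forall>f\<in>Lip. \<nu> i j f = (\<Sum>l<N. block_term a b c x y l i j f)) \<and>
    (\<forall>L \<xi>. finite L \<longrightarrow> frame n m L a \<xi> \<le> s * sqnorm m \<xi>) \<and>
    (\<forall>L \<xi>. finite L \<longrightarrow> frame n m L b \<xi> \<le> s * sqnorm m \<xi>)"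

text \<open>The square root of \<open>\<parallel>x l - y l\<parallel>\<close> is distributed to both scalar matrices, and the inverse of the norm becomes the
scalar \<open>c l\<close>.\<close>

lemma finite_representation:
  assumes m: "1 \<le> m" and \<nu>: "\<nu> \<in> Deltas" and C: "dual_bound m \<nu> C" and s: "C < s"
  shows "\<exists>N a b c x y. splitting m s \<nu> N a b c x y"
proof -
  obtain ts where ts: "represents m ts \<nu>"
    and row: "\<And>\<xi>. (\<Sum>g\<leftarrow>ts. row_weight m g \<xi>) \<le> qform m (s *\<^sub>R id_mat) \<xi>"
    and col: "\<And>\<xi>. (\<Sum>g\<leftarrow>ts. col_weight m g \<xi>) \<le> qform m (s *\<^sub>R id_mat) \<xi>"
    using rep_cone_contains[OF m \<nu> C s] unfolding rep_cone_def by blast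
  define N where "N = length ts"
  define x where "x l = (if l < N then fst (snd (snd (ts ! l))) else corner x0)" for l
  define y where "y l = (if l < N then snd (snd (snd (ts ! l))) else corner x0)" for l
  define w where "w l = matdist (x l) (y l)" for l
  define a where "a l i s = (if l < N then of_real (sqrt (w l)) * fst (ts ! l) i s else 0)" for l i s
  define b where "b l i s = (if l < N then of_real (sqrt (w l)) * fst (snd (ts ! l)) i s else 0)" for l i s
  \<comment> \<open>If \<open>w l = 0\<close> then \<open>x l\<close> and \<open>y l\<close> agree, and the block vanishes whatever \<open>c l\<close> is; here \<open>1 / 0 = 0\<close>.\<close>
  define c where "c l = complex_of_real (1 / w l)" for l
  have ts_l: "ts ! l = (fst (ts ! l), fst (snd (ts ! l)), x l, y l)" if "l < N" for l
    using that by (simp add: x_def y_def)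
  have xy: "x l \<in> mats n X" "y l \<in> mats n X" for l
  proof -
    have "x l \<in> mats n X \<and> y l \<in> mats n X" if l: "l < N"
    proof -
      have "ts ! l \<in> set ts" using l by (simp add: N_def)
      then show ?thesis using ts ts_l[OF l] unfolding represents_def admissible_def by (metis (mono_tags, lifting) case_prodD)
    qed
    then show "x l \<in> mats n X" "y l \<in> mats n X"
      using corner_mats[OF base] by (cases "l < N", simp, simp add: x_def y_def)+
  qed
  have w0: "0 \<le> w l" for l unfolding w_def by (rule matdist_nonneg[OF xy])
  have cw: "norm (c l) * matdist (x l) (y l) \<le> 1" for l
    using w0[of l] unfolding w_def[symmetric] c_def by (cases "w l = 0") (simp_all add: norm_of_real del: of_real_divide)
  have sqw: "of_real (sqrt (w l)) * of_real (sqrt (w l)) = complex_of_real (w l)" for l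
    using w0[of l] by (metis of_real_mult real_sqrt_mult_self abs_of_nonneg)
  have term_eq: "block_term a b c x y l i j f = summand (ts ! l) i j f" if l: "l < N" and f: "f \<in> Lip" for l i j f
  proof -
    have "a l i s * (c l * (f (x l s t) - f (y l s t))) * b l j t
      = fst (ts ! l) i s * (delta X x0 (x l s t) f - delta X x0 (y l s t) f) * fst (snd (ts ! l)) j t"
      if st: "s < n" "t < n" for s t
    proof (cases "w l = 0")
      case True
      then have "x l s t = y l s t" using matdist_eq_0[OF xy _ st] unfolding w_def by blast
      then show ?thesis by simp
    next
      case False
      have "a l i s * (c l * (f (x l s t) - f (y l s t))) * b l j t
        = (of_real (sqrt (w l)) * of_real (sqrt (w l)) * c l) *
          (fst (ts ! l) i s * (f (x l s t) - f (y l s t)) * fst (snd (ts ! l)) j t)"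
        using l by (simp add: a_def b_def mult_ac)
      also have "of_real (sqrt (w l)) * of_real (sqrt (w l)) * c l = 1" unfolding sqw c_def using False by simp
      finally show ?thesis using f by (simp add: delta_def)
    qed
    then have "block_term a b c x y l i j f = summand (fst (ts ! l), fst (snd (ts ! l)), x l, y l) i j f"
      unfolding block_term_def summand_def prod.case by (intro sum.cong refl) simp
    then show ?thesis using ts_l[OF l] by simp
  qed
  have rep: "\<nu> i j f = (\<Sum>l<N. block_term a b c x y l i j f)" if "i < m" "j < m" "f \<in> Lip" for i j f
  proof -
    have "\<nu> i j f = (\<Sum>g\<leftarrow>ts. summand g i j f)" using ts that unfolding represents_def by blast
    also have "\<dots> = (\<Sum>l<N. summand (ts ! l) i j f)" by (simp add: sum_list_sum_nth N_def atLeast0LessThan)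
    also have "\<dots> = (\<Sum>l<N. block_term a b c x y l i j f)" using term_eq that by (intro sum.cong refl) simp
    finally show ?thesis .
  qed
  have bound: "frame n m L h \<xi> \<le> s * sqnorm m \<xi>"
    if L: "finite L" and h: "\<And>l i s. h l i s = (if l < N then of_real (sqrt (w l)) * k l i s else 0)"
      and tot: "(\<Sum>l<N. w l * (\<Sum>s'<n. (norm (\<Sum>i<m. \<xi> i * k l i s'))\<^sup>2)) \<le> qform m (s *\<^sub>R id_mat) \<xi>"
    for L \<xi> and h k :: "nat \<Rightarrow> nat \<Rightarrow> nat \<Rightarrow> complex"
  proof -
    have in_N: "(\<Sum>s'<n. (norm (\<Sum>i<m. \<xi> i * h l i s'))\<^sup>2) = w l * (\<Sum>s'<n. (norm (\<Sum>i<m. \<xi> i * k l i s'))\<^sup>2)"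
      if "l < N" for l
    proof -
      have eq: "(\<Sum>i<m. \<xi> i * h l i s') = of_real (sqrt (w l)) * (\<Sum>i<m. \<xi> i * k l i s')" for s'
        unfolding sum_distrib_left by (rule sum.cong[OF refl]) (simp add: h that)
      have "(norm (\<Sum>i<m. \<xi> i * h l i s'))\<^sup>2 = w l * (norm (\<Sum>i<m. \<xi> i * k l i s'))\<^sup>2" for s'
        unfolding eq norm_mult power_mult_distrib by (simp add: w0)
      then show ?thesis by (simp only: sum_distrib_left)
    qed
    have "frame n m L h \<xi> = (\<Sum>l\<in>L \<inter> {..<N}. \<Sum>s'<n. (norm (\<Sum>i<m. \<xi> i * h l i s'))\<^sup>2)"
      using L by (intro sum.mono_neutral_right) (auto simp: h)
    also have "\<dots> \<le> (\<Sum>l<N. \<Sum>s'<n. (norm (\<Sum>i<m. \<xi> i * h l i s'))\<^sup>2)"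
      by (intro sum_mono2) (auto intro: sum_nonneg)
    also have "\<dots> = (\<Sum>l<N. w l * (\<Sum>s'<n. (norm (\<Sum>i<m. \<xi> i * k l i s'))\<^sup>2))"
      using in_N by (intro sum.cong refl) simp
    also have "\<dots> \<le> s * sqnorm m \<xi>" using tot by (simp only: qform_scaleR qform_id_mat)
    finally show ?thesis .
  qed
  have row': "(\<Sum>l<N. w l * (\<Sum>s'<n. (norm (\<Sum>i<m. \<xi> i * fst (ts ! l) i s'))\<^sup>2)) \<le> qform m (s *\<^sub>R id_mat) \<xi>" for \<xi>
  proof -
    have "(\<Sum>g\<leftarrow>ts. row_weight m g \<xi>) = (\<Sum>l<N. row_weight m (ts ! l) \<xi>)"
      by (simp add: sum_list_sum_nth N_def atLeast0LessThan)
    also have "\<dots> = (\<Sum>l<N. w l * (\<Sum>s'<n. (norm (\<Sum>i<m. \<xi> i * fst (ts ! l) i s'))\<^sup>2))"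
      by (intro sum.cong refl) (simp add: row_weight_def split_def w_def x_def y_def)
    finally show ?thesis using row[of \<xi>] by simp
  qed
  have col': "(\<Sum>l<N. w l * (\<Sum>s'<n. (norm (\<Sum>i<m. \<xi> i * fst (snd (ts ! l)) i s'))\<^sup>2)) \<le> qform m (s *\<^sub>R id_mat) \<xi>" for \<xi>
  proof -
    have "(\<Sum>g\<leftarrow>ts. col_weight m g \<xi>) = (\<Sum>l<N. col_weight m (ts ! l) \<xi>)"
      by (simp add: sum_list_sum_nth N_def atLeast0LessThan)
    also have "\<dots> = (\<Sum>l<N. w l * (\<Sum>s'<n. (norm (\<Sum>i<m. \<xi> i * fst (snd (ts ! l)) i s'))\<^sup>2))"
      by (intro sum.cong refl) (simp add: col_weight_def split_def w_def x_def y_def)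
    finally show ?thesis using col[of \<xi>] by simp
  qed
  show ?thesis
    unfolding splitting_def
  proof (rule exI[of _ N], rule exI[of _ a], rule exI[of _ b], rule exI[of _ c], rule exI[of _ x], rule exI[of _ y],
      intro conjI allI impI ballI)
    fix L :: "nat set" and \<xi> :: "nat \<Rightarrow> complex" assume L: "finite L"
    show "frame n m L a \<xi> \<le> s * sqnorm m \<xi>"
      by (rule bound[OF L a_def row'])
    show "frame n m L b \<xi> \<le> s * sqnorm m \<xi>"
      by (rule bound[OF L b_def col'])
  qed (use xy cw rep in \<open>auto simp: a_def\<close>)
qed

lemma approximation:
  assumes \<mu>: "\<mu> \<in> mats m (lip_free n X x0)" and \<eta>: "0 < \<eta>" and m: "1 \<le> m"
  shows "\<exists>\<nu>\<in>Deltas. dual_bound m (\<lambda>i j f. \<mu> i j f - \<nu> i j f) \<eta>"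
proof -
  define e where "e = \<eta> / (real m * real m)"
  have e: "0 < e" using \<eta> m by (simp add: e_def)
  have "\<forall>i j. \<exists>\<psi>\<in>delta_span X x0. i < m \<longrightarrow> j < m \<longrightarrow> dual_bound 1 (\<lambda>_ _ f. \<mu> i j f - \<psi> f) e"
  proof (intro allI)
    fix i j
    show "\<exists>\<psi>\<in>delta_span X x0. i < m \<longrightarrow> j < m \<longrightarrow> dual_bound 1 (\<lambda>_ _ f. \<mu> i j f - \<psi> f) e"
    proof (cases "i < m \<and> j < m")
      case True
      then have L: "\<mu> i j \<in> lip_free n X x0" using \<mu> by (simp add: mats_def)
      then obtain \<psi> where \<psi>: "\<psi> \<in> delta_span X x0" "free_mnorm n X x0 1 (\<lambda>_ _ f. \<mu> i j f - \<psi> f) < e"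
        unfolding lip_free_def using e by blast
      have "\<mu> i j \<in> cdual Lip (lip_mnorm n X)" using L unfolding lip_free_def by blast
      then obtain C where C: "dual_bound 1 (\<lambda>_ _. \<mu> i j) C" using cdual_dual_bound by blast
      obtain C' where C': "dual_bound 1 (\<lambda>_ _. \<psi>) C'" using cdual_dual_bound[OF delta_span_cdual[OF \<psi>(1)]] by blast
      have "dual_bound 1 (\<lambda>_ _ f. \<mu> i j f - \<psi> f) e"
        by (rule dual_bound_mono[OF dual_bound_free_mnorm[OF dual_bound_diff[OF C C']]]) (use \<psi> in simp)
      then show ?thesis using \<psi>(1) by blast
    next
      case False
      then show ?thesis using delta_span_zero by blast
    qed
  qed
  then obtain \<nu> where \<nu>: "\<forall>i j. \<nu> i j \<in> delta_span X x0 \<and> (i < m \<longrightarrow> j < m \<longrightarrow> dual_bound 1 (\<lambda>_ _ f. \<mu> i j f - \<nu> i j f) e)"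
    unfolding Bex_def by (simp only: choice_iff) blast
  have "dual_bound m (\<lambda>i j f. \<mu> i j f - \<nu> i j f) (\<Sum>i<m. \<Sum>j<m. e)"
    by (rule dual_bound_entries) (use \<nu> in simp)
  moreover have "(\<Sum>i<m. \<Sum>j<m. e) = \<eta>" using m by (simp add: e_def)
  ultimately show ?thesis using \<nu> by (intro bexI[of _ \<nu>]) auto
qed
end

section \<open>Representations of arbitrary matrices\<close>

lemma sum_halves: "(\<Sum>k = K..<L. 1 / 2 ^ k :: real) \<le> 2 / 2 ^ K"
proof -
  have "K \<le> L \<Longrightarrow> (\<Sum>k = K..<L. 1 / 2 ^ k :: real) = 2 / 2 ^ K - 2 / 2 ^ L"
    by (induction L rule: dec_induct) auto
  then show ?thesis by (cases "K \<le> L") auto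
qed

text \<open>The rows bound the sum over an arbitrary finite set of pairs; no order of summation is involved.\<close>

lemma sum_pairs_le:
  fixes R :: "nat \<times> nat \<Rightarrow> real"
  assumes R: "\<And>p. 0 \<le> R p" and row: "\<And>k L. finite L \<Longrightarrow> (\<Sum>l\<in>L. R (k, l)) \<le> S k"
    and J: "finite J" "fst ` J \<subseteq> I" and I: "finite I"
  shows "(\<Sum>p\<in>J. R p) \<le> (\<Sum>k\<in>I. S k)"
proof -
  have "(\<Sum>p\<in>J. R p) \<le> (\<Sum>p\<in>I \<times> snd ` J. R p)"
    using J I R by (intro sum_mono2) (force simp: image_iff)+
  also have "\<dots> = (\<Sum>k\<in>I. \<Sum>l\<in>snd ` J. R (k, l))"
    by (simp add: sum.cartesian_product split_def)
  also have "\<dots> \<le> (\<Sum>k\<in>I. S k)" using J by (intro sum_mono row) auto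
  finally show ?thesis .
qed

context pointed_operators
begin

text \<open>The matrix \<open>\<mu>\<close> is the sum of the telescoping series \<open>\<tau>\<close> of differences of approximations \<open>\<nu> k\<close>. The representations of the
\<open>\<tau> k\<close> together represent \<open>\<mu>\<close>, and the last statement expresses convergence along the finite sets \<open>J\<close> of pairs.
It holds because a set \<open>J\<close> that contains all terms of the first blocks consists of these, with sum \<open>\<nu> K\<close>, and of terms
of later blocks; by \<open>product_bound\<close> the norm of the latter is at most a tail of the series of the \<open>s k\<close>.\<close>

lemma series_representation:
  assumes \<mu>: "\<mu> \<in> mats m (lip_free n X x0)" and m: "1 \<le> m" and \<epsilon>: "0 < \<epsilon>"
  obtains S a b c x y where "\<And>p. x p \<in> mats n X" "\<And>p. y p \<in> mats n X"
    "\<And>p. norm (c p) * matdist (x p) (y p) \<le> 1" "0 \<le> S" "S \<le> free_mnorm n X x0 m \<mu> + \<epsilon>"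
    "\<And>J \<xi>. finite J \<Longrightarrow> frame n m J a \<xi> \<le> S * sqnorm m \<xi>"
    "\<And>J \<xi>. finite J \<Longrightarrow> frame n m J b \<xi> \<le> S * sqnorm m \<xi>"
    "\<And>e. 0 < e \<Longrightarrow> \<exists>B :: (nat \<times> nat) set. finite B \<and> (\<forall>J. finite J \<longrightarrow> B \<subseteq> J \<longrightarrow>
      dual_bound m (\<lambda>i j f. \<mu> i j f - (\<Sum>p\<in>J. block_term a b c x y p i j f)) e)"
proof -
  let ?M = "free_mnorm n X x0 m \<mu>"
  have "\<mu> \<in> mats m (cdual Lip (lip_mnorm n X))" using \<mu> unfolding mats_def lip_free_def by blast
  then obtain C where "dual_bound m \<mu> C" using mats_cdual_dual_bound by blast
  then have M: "dual_bound m \<mu> ?M" by (rule dual_bound_free_mnorm)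
  then have M0: "0 \<le> ?M" unfolding dual_bound_def by blast
  define \<delta> where "\<delta> = \<epsilon> / 8"
  have \<delta>: "0 < \<delta>" using \<epsilon> by (simp add: \<delta>_def)
  have "\<forall>k. \<exists>\<nu>. \<nu> \<in> Deltas \<and> dual_bound m (\<lambda>i j f. \<mu> i j f - \<nu> i j f) (\<delta> / 2 ^ k)"
  proof
    fix k :: nat
    have "0 < \<delta> / 2 ^ k" using \<delta> by simp
    from approximation[OF \<mu> this m] show "\<exists>\<nu>. \<nu> \<in> Deltas \<and> dual_bound m (\<lambda>i j f. \<mu> i j f - \<nu> i j f) (\<delta> / 2 ^ k)"
      by blast
  qed
  then obtain \<nu> where \<nu>: "\<And>k. \<nu> k \<in> Deltas"
    and \<nu>_bound: "\<And>k. dual_bound m (\<lambda>i j f. \<mu> i j f - \<nu> k i j f) (\<delta> / 2 ^ k)"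
    by (simp only: choice_iff) blast
  define \<tau> where "\<tau> k = (if k = 0 then \<nu> 0 else \<nu> k - \<nu> (k - 1))" for k
  \<comment> \<open>Strictly more than the norm of \<open>\<tau> k\<close>; the sum of all \<open>s k\<close> is \<open>?M + 8 * \<delta>\<close>.\<close>
  define s where "s k = (if k = 0 then ?M else 0) + 4 * \<delta> / 2 ^ k" for k :: nat
  have \<tau>: "\<tau> k \<in> Deltas" for k
    unfolding \<tau>_def using subspace_diff[OF subspace_Deltas \<nu> \<nu>] \<nu> by (cases "k = 0") simp_all
  have \<tau>_bound: "dual_bound m (\<tau> k) ((if k = 0 then ?M else 0) + 3 * \<delta> / 2 ^ k)" for k
  proof (cases k)
    case 0
    have "dual_bound m (\<lambda>i j f. \<mu> i j f - (\<mu> i j f - \<nu> 0 i j f)) (?M + \<delta> / 2 ^ 0)"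
      by (rule dual_bound_diff[OF M \<nu>_bound])
    then have "dual_bound m (\<nu> 0) (?M + \<delta> / 2 ^ 0)" by simp
    then have "dual_bound m (\<nu> 0) (?M + 3 * \<delta>)" by (rule dual_bound_mono) (use \<delta> in simp)
    then show ?thesis using 0 by (simp add: \<tau>_def)
  next
    case (Suc k')
    have "dual_bound m (\<lambda>i j f. (\<mu> i j f - \<nu> k' i j f) - (\<mu> i j f - \<nu> k i j f)) (\<delta> / 2 ^ k' + \<delta> / 2 ^ k)"
      by (rule dual_bound_diff[OF \<nu>_bound \<nu>_bound])
    moreover have "(\<lambda>i j f. (\<mu> i j f - \<nu> k' i j f) - (\<mu> i j f - \<nu> k i j f)) = \<tau> k"
      using Suc by (simp add: \<tau>_def fun_eq_iff)
    moreover have "\<delta> / 2 ^ k' + \<delta> / 2 ^ k = (if k = 0 then ?M else 0) + 3 * \<delta> / 2 ^ k"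
      using Suc by simp
    ultimately show ?thesis by simp
  qed
  have "\<forall>k. \<exists>N a b c x y. splitting m (s k) (\<tau> k) N a b c x y"
  proof
    fix k
    have "(if k = 0 then ?M else 0) + 3 * \<delta> / 2 ^ k < s k" using \<delta> by (simp add: s_def divide_strict_right_mono)
    from finite_representation[OF m \<tau> \<tau>_bound this]
    show "\<exists>N a b c x y. splitting m (s k) (\<tau> k) N a b c x y" .
  qed
  then obtain N a b c x y where "\<forall>k. splitting m (s k) (\<tau> k) (N k) (a k) (b k) (c k) (x k) (y k)"
    unfolding choice_iff by (elim exE)
  note all = this[unfolded splitting_def]
  define a' where "a' p = a (fst p) (snd p)" for p
  define b' where "b' p = b (fst p) (snd p)" for p
  define c' where "c' p = c (fst p) (snd p)" for p
  define x' where "x' p = x (fst p) (snd p)" for p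
  define y' where "y' p = y (fst p) (snd p)" for p
  have xy: "x' p \<in> mats n X" "y' p \<in> mats n X" and c1: "norm (c' p) * matdist (x' p) (y' p) \<le> 1" for p
    using all by (simp_all add: x'_def y'_def c'_def)
  have ab: "frame n m J a' \<xi> \<le> (\<Sum>k\<in>I. s k) * sqnorm m \<xi>"
    "frame n m J b' \<xi> \<le> (\<Sum>k\<in>I. s k) * sqnorm m \<xi>"
    if "finite J" "fst ` J \<subseteq> I" "finite I" for J I \<xi>
    unfolding sum_distrib_right using that all
    by (intro sum_pairs_le; simp add: a'_def b'_def sum_nonneg)+
  have s_sum: "(\<Sum>k = K..<L. s k) \<le> (if K = 0 then ?M else 0) + 8 * \<delta> / 2 ^ K" for K L
  proof -
    have "(\<Sum>k = K..<L. s k) = (\<Sum>k = K..<L. if k = 0 then ?M else 0) + 4 * \<delta> * (\<Sum>k = K..<L. 1 / 2 ^ k)"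
      by (simp add: s_def sum.distrib sum_distrib_left)
    also have "(\<Sum>k = K..<L. if k = 0 then ?M else 0) \<le> (if K = 0 then ?M else 0)"
      using M0 by (cases "K = 0") (auto intro!: sum_nonpos)
    also have "4 * \<delta> * (\<Sum>k = K..<L. 1 / 2 ^ k) \<le> 4 * \<delta> * (2 / 2 ^ K)"
      using \<delta> by (intro mult_left_mono sum_halves) auto
    finally show ?thesis by simp
  qed
  have bounded_fst: "\<exists>L. fst ` J \<subseteq> {K..<L}" if "finite J" "\<And>p. p \<in> J \<Longrightarrow> K \<le> fst p" for J :: "(nat \<times> nat) set" and K
  proof -
    have "finite (fst ` J)" using that by simp
    then obtain L where "\<forall>k\<in>fst ` J. k < L" using finite_nat_set_iff_bounded by blast
    then show ?thesis using that by (intro exI[of _ L]) auto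
  qed
  have tail: "frame n m J a' \<xi> \<le> ((if K = 0 then ?M else 0) + 8 * \<delta> / 2 ^ K) * sqnorm m \<xi>"
    "frame n m J b' \<xi> \<le> ((if K = 0 then ?M else 0) + 8 * \<delta> / 2 ^ K) * sqnorm m \<xi>"
    if J: "finite J" "\<And>p. p \<in> J \<Longrightarrow> K \<le> fst p" for J K \<xi>
  proof -
    obtain L where L: "fst ` J \<subseteq> {K..<L}" using bounded_fst[of J K] J by blast
    have "(\<Sum>k = K..<L. s k) * sqnorm m \<xi> \<le> ((if K = 0 then ?M else 0) + 8 * \<delta> / 2 ^ K) * sqnorm m \<xi>"
      by (intro mult_right_mono s_sum) (simp add: sum_nonneg)
    with ab[OF J(1) L finite_atLeastLessThan, of \<xi>]
    show "frame n m J a' \<xi> \<le> ((if K = 0 then ?M else 0) + 8 * \<delta> / 2 ^ K) * sqnorm m \<xi>"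
      "frame n m J b' \<xi> \<le> ((if K = 0 then ?M else 0) + 8 * \<delta> / 2 ^ K) * sqnorm m \<xi>"
      by linarith+
  qed
  have telescope: "(\<Sum>k\<le>K. \<tau> k i j f) = \<nu> K i j f" for K i j f
    by (induction K) (simp_all add: \<tau>_def)
  have err: "\<exists>B. finite B \<and> (\<forall>J. finite J \<longrightarrow> B \<subseteq> J \<longrightarrow>
      dual_bound m (\<lambda>i j f. \<mu> i j f - (\<Sum>p\<in>J. block_term a' b' c' x' y' p i j f)) e)" if e: "0 < e" for e
  proof -
    obtain K where "(1 / 2) ^ K < e / (5 * \<delta>)" using real_arch_pow_inv[of "e / (5 * \<delta>)" "1 / 2"] e \<delta> by auto
    then have K: "5 * \<delta> / 2 ^ K < e" using \<delta> by (simp add: field_simps power_one_over)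
    \<comment> \<open>all terms of the blocks up to \<open>K\<close>, whose sum is \<open>\<nu> K\<close>\<close>
    let ?B = "SIGMA k:{..K}. {..<N k}"
    have "dual_bound m (\<lambda>i j f. \<mu> i j f - (\<Sum>p\<in>J. block_term a' b' c' x' y' p i j f)) e"
      if J: "finite J" "?B \<subseteq> J" for J
    proof -
      let ?J2 = "{p \<in> J. Suc K \<le> fst p}" and ?J1 = "{p \<in> J. fst p \<le> K}"
      define r where "r = 8 * \<delta> / 2 ^ Suc K"
      have r: "0 \<le> r" using \<delta> by (simp add: r_def)
      have r_eq: "r = (if Suc K = 0 then ?M else 0) + 8 * \<delta> / 2 ^ Suc K" by (simp add: r_def)
      have sqrt_r: "1 * sqrt r * sqrt r = r" using r by simp
      have split: "(\<Sum>p\<in>J. block_term a' b' c' x' y' p i j f) = \<nu> K i j f + (\<Sum>p\<in>?J2. block_term a' b' c' x' y' p i j f)"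
        if ij: "i < m" "j < m" "f \<in> Lip" for i j f
      proof -
        have "(\<Sum>p\<in>J. block_term a' b' c' x' y' p i j f)
          = (\<Sum>p\<in>?J1 \<union> ?J2. block_term a' b' c' x' y' p i j f)" by (rule sum.cong) auto
        also have "\<dots> = (\<Sum>p\<in>?J1. block_term a' b' c' x' y' p i j f) + (\<Sum>p\<in>?J2. block_term a' b' c' x' y' p i j f)"
          using J by (intro sum.union_disjoint) auto
        also have "(\<Sum>p\<in>?J1. block_term a' b' c' x' y' p i j f) = (\<Sum>p\<in>?B. block_term a' b' c' x' y' p i j f)"
        proof (rule sum.mono_neutral_right)
          show "\<forall>p\<in>?J1 - ?B. block_term a' b' c' x' y' p i j f = 0"
          proof
            fix p assume p: "p \<in> ?J1 - ?B"
            then have "N (fst p) \<le> snd p" by (cases p) auto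
            then have "a' p i s = 0" for s using all by (simp add: a'_def)
            then show "block_term a' b' c' x' y' p i j f = 0" by (simp add: block_term_def)
          qed
        qed (use J in auto)
        also have "\<dots> = (\<Sum>k\<le>K. \<Sum>l<N k. block_term a' b' c' x' y' (k, l) i j f)"
          by (simp add: sum.Sigma split_def)
        also have "\<dots> = (\<Sum>k\<le>K. \<tau> k i j f)"
          using all ij by (intro sum.cong refl) (simp add: block_term_def a'_def b'_def c'_def x'_def y'_def)
        finally show ?thesis unfolding telescope .
      qed
      have "dual_bound m (\<lambda>i j f. \<Sum>p\<in>?J2. block_term a' b' c' x' y' p i j f)
          (1 * sqrt r * sqrt r)"
      proof (rule product_bound[OF xy(1) xy(2) c1])
        fix \<xi> :: "nat \<Rightarrow> complex"
        show "frame n m ?J2 a' \<xi> \<le> (sqrt r)\<^sup>2 * sqnorm m \<xi>"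
          unfolding real_sqrt_pow2[OF r] unfolding r_eq by (rule tail(1)) (use J(1) in simp_all)
        show "frame n m ?J2 b' \<xi> \<le> (sqrt r)\<^sup>2 * sqnorm m \<xi>"
          unfolding real_sqrt_pow2[OF r] unfolding r_eq by (rule tail(2)) (use J(1) in simp_all)
      qed (use r in auto)
      then have "dual_bound m (\<lambda>i j f. \<Sum>p\<in>?J2. block_term a' b' c' x' y' p i j f) r"
        unfolding sqrt_r .
      from dual_bound_diff[OF \<nu>_bound this, of K]
      have "dual_bound m (\<lambda>i j f. \<mu> i j f - (\<Sum>p\<in>J. block_term a' b' c' x' y' p i j f)) (\<delta> / 2 ^ K + r)"
        by (rule iffD1[OF dual_bound_cong, rotated]) (simp add: split)
      then show ?thesis by (rule dual_bound_mono) (use K in \<open>simp add: r_def\<close>)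
    qed
    moreover have "finite ?B" by simp
    ultimately show ?thesis by blast
  qed
  show thesis
  proof (rule that[of x' y' c' "?M + \<epsilon>" a' b'])
    fix J \<xi> assume J: "finite (J :: (nat \<times> nat) set)"
    show "frame n m J a' \<xi> \<le> (?M + \<epsilon>) * sqnorm m \<xi>"
      "frame n m J b' \<xi> \<le> (?M + \<epsilon>) * sqnorm m \<xi>"
      using tail[of J 0 \<xi>] J by (simp_all add: \<delta>_def)
  qed (use xy c1 err M0 \<epsilon> in auto)
qed

text \<open>The pairs that index the terms are enumerated by \<open>prod_decode\<close>. Convergence along finite sets implies
convergence of the truncations.\<close>

lemma good_representation:
  assumes \<mu>: "\<mu> \<in> mats m (lip_free n X x0)" and m: "1 \<le> m" and \<epsilon>: "0 < \<epsilon>"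
  shows "\<exists>\<alpha> \<beta> D c x y. \<alpha> \<in> row_mats_inf m \<and> \<beta> \<in> col_mats_inf m \<and>
    D \<in> block_mats_inf n X x0 \<and> is_delta_diagonal n X x0 D c x y \<and> is_product n X x0 m \<mu> \<alpha> D \<beta> \<and>
    row_norm_inf m \<alpha> * col_norm_inf m \<beta> * (SUP l. norm (c l) * matdist (x l) (y l)) \<le> free_mnorm n X x0 m \<mu> + \<epsilon>"
proof -
  obtain S a b c x y where xy: "\<And>p. x p \<in> mats n X" "\<And>p. y p \<in> mats n X"
    and c1: "\<And>p. norm (c p) * matdist (x p) (y p) \<le> 1" and S: "0 \<le> S" "S \<le> free_mnorm n X x0 m \<mu> + \<epsilon>"
    and a: "\<And>J \<xi>. finite J \<Longrightarrow> frame n m J a \<xi> \<le> S * sqnorm m \<xi>"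
    and b: "\<And>J \<xi>. finite J \<Longrightarrow> frame n m J b \<xi> \<le> S * sqnorm m \<xi>"
    and err: "\<And>e. 0 < e \<Longrightarrow> \<exists>B :: (nat \<times> nat) set. finite B \<and> (\<forall>J. finite J \<longrightarrow> B \<subseteq> J \<longrightarrow>
      dual_bound m (\<lambda>i j f. \<mu> i j f - (\<Sum>p\<in>J. block_term a b c x y p i j f)) e)"
    by (rule series_representation[OF \<mu> m \<epsilon>]) blast
  define \<alpha> where "\<alpha> i q = a (prod_decode (q div n)) i (q mod n)" for i q
  define \<beta> where "\<beta> q j = b (prod_decode (q div n)) j (q mod n)" for q j
  define c' where "c' l = c (prod_decode l)" for l
  define x' where "x' l = x (prod_decode l)" for l
  define y' where "y' l = y (prod_decode l)" for l
  define D where "D p q i j = (if p = q then (\<lambda>f. c' p * (delta X x0 (x' p i j) f - delta X x0 (y' p i j) f)) else (\<lambda>f. 0))" for p q i j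
  have diag: "is_delta_diagonal n X x0 D c' x' y'"
    unfolding is_delta_diagonal_def D_def using xy by (simp add: x'_def y'_def)
  have c1': "norm (c' l) * matdist (x' l) (y' l) \<le> 1" for l unfolding c'_def x'_def y'_def by (rule c1)
  have D: "D \<in> block_mats_inf n X x0" by (rule block_mats_of_diagonal[OF diag c1'])
  have inj: "inj_on prod_decode A" for A by (rule inj_prod_decode)
  have vb: "vnorm N (\<lambda>q. \<Sum>i<m. \<xi> i * h (prod_decode (q div n)) i (q mod n)) \<le> sqrt S * vnorm m \<xi>"
    if h: "\<And>J \<xi>. finite J \<Longrightarrow> frame n m J h \<xi> \<le> S * sqnorm m \<xi>"
    for h :: "nat \<times> nat \<Rightarrow> nat \<Rightarrow> nat \<Rightarrow> complex" and N and \<xi> :: "nat \<Rightarrow> complex"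
  proof -
    have "(\<Sum>q<N. (norm (\<Sum>i<m. \<xi> i * h (prod_decode (q div n)) i (q mod n)))\<^sup>2)
      \<le> (\<Sum>q<N * n. (norm (\<Sum>i<m. \<xi> i * h (prod_decode (q div n)) i (q mod n)))\<^sup>2)"
      using size_pos by (intro sum_mono2) auto
    also have "\<dots> = (\<Sum>l<N. \<Sum>s<n. (norm (\<Sum>i<m. \<xi> i * h (prod_decode l) i s))\<^sup>2)"
      by (rule sum_div_mod[of "\<lambda>l s. (norm (\<Sum>i<m. \<xi> i * h (prod_decode l) i s))\<^sup>2"])
    also have "\<dots> = (\<Sum>p\<in>prod_decode ` {..<N}. \<Sum>s<n. (norm (\<Sum>i<m. \<xi> i * h p i s))\<^sup>2)"
      by (simp add: sum.reindex[OF inj])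
    also have "\<dots> \<le> S * sqnorm m \<xi>" by (rule h) simp
    also have "\<dots> = (sqrt S * vnorm m \<xi>)\<^sup>2" unfolding power_mult_distrib vnorm_sq using S by simp
    finally show ?thesis unfolding L2_set_def[of _ "{..<N}"] using S by (intro real_le_lsqrt) (auto intro: sum_nonneg)
  qed
  have A: "cmat_norm m N \<alpha> \<le> sqrt S" for N
    by (rule row_norm_least) (use S vb[OF a] in \<open>simp_all add: \<alpha>_def\<close>)
  have B: "cmat_norm N m \<beta> \<le> sqrt S" for N
    by (rule col_norm_least) (use S vb[OF b] in \<open>simp_all add: \<beta>_def\<close>)
  have rows: "\<alpha> \<in> row_mats_inf m" "row_norm_inf m \<alpha> \<le> sqrt S"
  proof -
    show "\<alpha> \<in> row_mats_inf m"
      unfolding row_mats_inf_def by (intro CollectI bdd_aboveI2[where M = "sqrt S"] A)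
    show "row_norm_inf m \<alpha> \<le> sqrt S"
      unfolding row_norm_inf_def by (rule cSUP_least) (use A in auto)
  qed
  have cols: "\<beta> \<in> col_mats_inf m" "col_norm_inf m \<beta> \<le> sqrt S"
  proof -
    show "\<beta> \<in> col_mats_inf m"
      unfolding col_mats_inf_def by (intro CollectI bdd_aboveI2[where M = "sqrt S"] B)
    show "col_norm_inf m \<beta> \<le> sqrt S"
      unfolding col_norm_inf_def by (rule cSUP_least) (use B in auto)
  qed
  have R0: "0 \<le> row_norm_inf m \<alpha>"
    unfolding row_norm_inf_def using rows(1)
    by (intro cSUP_upper2[of _ _ 0] cmat_norm_nonneg) (auto simp: row_mats_inf_def)
  have C0: "0 \<le> col_norm_inf m \<beta>"
    unfolding col_norm_inf_def using cols(1)
    by (intro cSUP_upper2[of _ _ 0] cmat_norm_nonneg) (auto simp: col_mats_inf_def)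
  have sup1: "(SUP l. norm (c' l) * matdist (x' l) (y' l)) \<le> 1" by (rule cSUP_least) (use c1' in auto)
  have "row_norm_inf m \<alpha> * col_norm_inf m \<beta> * (SUP l. norm (c' l) * matdist (x' l) (y' l))
    \<le> row_norm_inf m \<alpha> * col_norm_inf m \<beta> * 1" using R0 C0 sup1 by (intro mult_left_mono) auto
  also have "\<dots> \<le> sqrt S * sqrt S" unfolding mult_1_right using rows cols R0 C0 S by (intro mult_mono) auto
  also have "\<dots> = S" using S by simp
  finally have cost: "row_norm_inf m \<alpha> * col_norm_inf m \<beta> * (SUP l. norm (c' l) * matdist (x' l) (y' l)) \<le> free_mnorm n X x0 m \<mu> + \<epsilon>"
    using S by linarith
  have trunc: "trunc_prod n r \<alpha> D \<beta> i j f = (\<Sum>p\<in>prod_decode ` {..<r}. block_term a b c x y p i j f)"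
    if f: "f \<in> Lip" for r i j f
  proof -
    have "trunc_prod n r \<alpha> D \<beta> i j f = (\<Sum>l<r. block_term a b c x y (prod_decode l) i j f)"
      unfolding trunc_prod_eq[OF diag f] block_term_def
      by (intro sum.cong refl) (simp add: \<alpha>_def \<beta>_def c'_def x'_def y'_def)
    then show ?thesis by (simp add: sum.reindex[OF inj])
  qed
  \<comment> \<open>From some \<open>r\<close> on, the first \<open>r\<close> pairs include any given finite set.\<close>
  have "is_product n X x0 m \<mu> \<alpha> D \<beta>"
    unfolding is_product_def
  proof (rule LIMSEQ_I)
    fix e :: real assume e: "0 < e"
    then obtain Bs :: "(nat \<times> nat) set" where Bs: "finite Bs" and bnd: "\<And>J. finite J \<Longrightarrow> Bs \<subseteq> J \<Longrightarrow>
      dual_bound m (\<lambda>i j f. \<mu> i j f - (\<Sum>p\<in>J. block_term a b c x y p i j f)) (e / 2)"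
      using err[of "e / 2"] by auto
    have "finite (prod_encode ` Bs)" using Bs by simp
    then obtain r0 where r0: "\<forall>q\<in>prod_encode ` Bs. q < r0" using finite_nat_set_iff_bounded by blast
    show "\<exists>no. \<forall>r\<ge>no. norm (free_mnorm n X x0 m (\<lambda>i j f. \<mu> i j f - trunc_prod n r \<alpha> D \<beta> i j f) - 0) < e"
    proof (intro exI[of _ r0] allI impI)
      fix r assume r: "r0 \<le> r"
      have "Bs \<subseteq> prod_decode ` {..<r}"
      proof
        fix p assume "p \<in> Bs"
        then have "prod_encode p < r" using r0 r by auto
        then show "p \<in> prod_decode ` {..<r}" by (intro image_eqI[of _ _ "prod_encode p"]) auto
      qed
      then have "dual_bound m (\<lambda>i j f. \<mu> i j f - (\<Sum>p\<in>prod_decode ` {..<r}. block_term a b c x y p i j f)) (e / 2)"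
        by (intro bnd) auto
      then have d: "dual_bound m (\<lambda>i j f. \<mu> i j f - trunc_prod n r \<alpha> D \<beta> i j f) (e / 2)"
        by (rule iffD1[OF dual_bound_cong, rotated]) (simp add: trunc)
      from free_mnorm_least[OF d] dual_bound_free_mnorm[OF d]
      show "norm (free_mnorm n X x0 m (\<lambda>i j f. \<mu> i j f - trunc_prod n r \<alpha> D \<beta> i j f) - 0) < e"
        using e unfolding dual_bound_def by auto
    qed
  qed
  then show ?thesis using rows(1) cols(1) D diag cost by blast
qed

end

theorem theorem5p3:
  fixes X :: "('h::complex_hilbert_space \<Rightarrow> 'h) set" and x0 :: "'h \<Rightarrow> 'h"
    and n m :: nat
    and \<mu> :: "nat \<Rightarrow> nat \<Rightarrow> (('h \<Rightarrow> 'h) \<Rightarrow> complex) \<Rightarrow> complex"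
  assumes "pointed_operator_metric_space X x0"
    and "n \<ge> 1" and "m \<ge> 1"
    and "\<mu> \<in> mats m (lip_free n X x0)"
  shows "ereal (free_mnorm n X x0 m \<mu>) =
    Inf {ereal (row_norm_inf m \<alpha> * col_norm_inf m \<beta> *
           (SUP l. norm (c l) * opmat_norm n n (\<lambda>i j h. x l i j h - y l i j h))) | \<alpha> \<beta> D c x y.
         \<alpha> \<in> row_mats_inf m \<and> \<beta> \<in> col_mats_inf m \<and>
         D \<in> block_mats_inf n X x0 \<and> is_delta_diagonal n X x0 D c x y \<and>
         is_product n X x0 m \<mu> \<alpha> D \<beta>}"
    (is "_ = Inf ?costs")
proof (rule antisym)
  interpret pointed_operators X x0 n
    by (rule pointed_operators.intro)
      (use assms(1,2) in \<open>auto simp: pointed_operator_metric_space_def bounded_clinear_def\<close>)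
  show "ereal (free_mnorm n X x0 m \<mu>) \<le> Inf ?costs"
    using free_mnorm_le_cost[OF assms(4)] by (intro Inf_greatest) auto
  show "Inf ?costs \<le> ereal (free_mnorm n X x0 m \<mu>)"
  proof (rule ereal_le_epsilon2)
    fix \<epsilon> :: real assume "0 < \<epsilon>"
    from good_representation[OF assms(4) assms(3) this]
    obtain \<alpha> \<beta> D c x y where rep: "\<alpha> \<in> row_mats_inf m" "\<beta> \<in> col_mats_inf m" "D \<in> block_mats_inf n X x0"
      "is_delta_diagonal n X x0 D c x y" "is_product n X x0 m \<mu> \<alpha> D \<beta>"
      and cost: "row_norm_inf m \<alpha> * col_norm_inf m \<beta> * (SUP l. norm (c l) * matdist (x l) (y l))
        \<le> free_mnorm n X x0 m \<mu> + \<epsilon>"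
      by (elim exE conjE) (rule that)
    have "Inf ?costs \<le> ereal (row_norm_inf m \<alpha> * col_norm_inf m \<beta> * (SUP l. norm (c l) * matdist (x l) (y l)))"
      by (rule Inf_lower) (use rep in blast)
    also have "\<dots> \<le> ereal (free_mnorm n X x0 m \<mu>) + ereal \<epsilon>" using cost by simp
    finally show "Inf ?costs \<le> ereal (free_mnorm n X x0 m \<mu>) + ereal \<epsilon>" .
  qed
qed

end
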